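(* Let $a,b,c$ be positive real numbers with $a>b$, $a>c$, $2a>1$. The operator $$J^a_{b,c}g(s)=\frac{1}{|\Gamma(a+is)|^2\,\Gamma(b+c)}\int_0^\infty(1+x)^{-a-b}\,g\Bigl(\frac{x}{x+1}\Bigr)\,{}_2F_1(b+is,b-is;b+c;-x)\,x^{b+c-1}(1+x)^{b-c}\,dx$$ (defined by this integral on polynomials $g$ and extended by continuity) is a unitary operator from $W^a_{b,c}$ onto $$L^2\left(\mathbb{R}_+,\ \frac1\pi\left|\frac{\Gamma(a+is)\Gamma(b+is)\Gamma(c+is)}{\Gamma(2is)}\right|^2ds\right).$$
   Context: $\mathbb{R}_+=[0,\infty)$; ${}_2F_1$ is the Gauss hypergeometric function (analytically continued to $\mathbb{C}\setminus[1,\infty)$ in its last argument). The Hilbert space $W^a_{b,c}$ consists of all holomorphic functions $f$ in the disk $|z|<1$ with $\iint_{|z|<1}|f(z)|^2(1-|z|^2)^{2a-2}\,dz<\infty$ ($dz$ is the Lebesgue measure in the disk), with the scalar product $$\langle f,g\rangle=\frac1{\pi\,\Gamma(2a-1)}\iint_{|z|<1}f(z)\overline{g(z)}\,(1-|z|^2)^{2a-2}\,{}_2F_1(a-b,a-c;2a-1;1-|z|^2)\,dz.$$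
   Formalization: The weight of the target L² space is taken with 1/(2π) in place of the printed 1/π; with 1/π the operator is √2 times a unitary one (for a=1, b=c=1/2, g=1 the squared norms are 8/π and 4/π). *)

theory Defs
  imports "HOL-Complex_Analysis.Complex_Analysis"
begin

section \<open>The Gauss hypergeometric function\<close>

text \<open>
  The Gauss series in the unit disk and its holomorphic continuation to the rest of the slit plane.
  The continuation is unique because the slit plane is connected; it exists whenever
  \<open>c\<close> is not a nonpositive integer.  The value 0 on the cut is a convention that only matters for
  the origin in the area integral below, a null set.
\<close>

definition gauss_series :: "complex \<Rightarrow> complex \<Rightarrow> complex \<Rightarrow> complex \<Rightarrow> complex" where
  "gauss_series a b c z = eval_fps (fps_hypergeo [a, b] [c] 1) z"

definition slit_plane :: "complex set" where
  "slit_plane = - complex_of_real ` {1..}"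

definition hyp2F1 :: "complex \<Rightarrow> complex \<Rightarrow> complex \<Rightarrow> complex \<Rightarrow> complex" where
  "hyp2F1 a b c z =
     (if z \<in> ball 0 1 then gauss_series a b c z
      else if z \<in> slit_plane
      then THE w. \<exists>F. F holomorphic_on slit_plane \<and>
                      (\<forall>u\<in>ball 0 1. F u = gauss_series a b c u) \<and> F z = w
      else 0)"


section \<open>The Hilbert space of holomorphic functions in the disk\<close>

text \<open>
  Elements are represented by total functions; two of them that agree on the disk represent the
  same element.
\<close>

definition W_space :: "real \<Rightarrow> real \<Rightarrow> real \<Rightarrow> (complex \<Rightarrow> complex) set" where
  "W_space a b c =
     {f. f holomorphic_on ball 0 1 \<and>
         set_integrable lborel (ball 0 1) (\<lambda>z. (norm (f z))\<^sup>2 * (1 - (norm z)\<^sup>2) powr (2 * a - 2))}"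

definition W_inner ::
    "real \<Rightarrow> real \<Rightarrow> real \<Rightarrow> (complex \<Rightarrow> complex) \<Rightarrow> (complex \<Rightarrow> complex) \<Rightarrow> complex" where
  "W_inner a b c f g =
     1 / of_real (pi * Gamma (2 * a - 1)) *
     (LINT z:ball 0 1|lborel. f z * cnj (g z) * of_real ((1 - (norm z)\<^sup>2) powr (2 * a - 2)) *
        hyp2F1 (of_real (a - b)) (of_real (a - c)) (of_real (2 * a - 1)) (of_real (1 - (norm z)\<^sup>2)))"

definition W_dist ::
    "real \<Rightarrow> real \<Rightarrow> real \<Rightarrow> (complex \<Rightarrow> complex) \<Rightarrow> (complex \<Rightarrow> complex) \<Rightarrow> real" where
  "W_dist a b c f g = sqrt (Re (W_inner a b c (\<lambda>z. f z - g z) (\<lambda>z. f z - g z)))"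


section \<open>Complex \<open>L\<^sup>2\<close> spaces and the spectral measure\<close>

text \<open>Elements are represented by functions, to be identified when equal almost everywhere.\<close>

definition L2_space :: "'a measure \<Rightarrow> ('a \<Rightarrow> complex) set" where
  "L2_space M = {h \<in> borel_measurable M. integrable M (\<lambda>x. (norm (h x))\<^sup>2)}"

definition L2_inner :: "'a measure \<Rightarrow> ('a \<Rightarrow> complex) \<Rightarrow> ('a \<Rightarrow> complex) \<Rightarrow> complex" where
  "L2_inner M h k = (LINT x|M. h x * cnj (k x))"

definition L2_dist :: "'a measure \<Rightarrow> ('a \<Rightarrow> complex) \<Rightarrow> ('a \<Rightarrow> complex) \<Rightarrow> real" where
  "L2_dist M h k = sqrt (Re (L2_inner M (\<lambda>x. h x - k x) (\<lambda>x. h x - k x)))"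

text \<open>
  The normalising constant is \<open>1 / (2\<pi>)\<close>, as in the orthogonality relation of the continuous dual
  Hahn polynomials.  The source prints \<open>1 / \<pi>\<close>, which is off by a factor 2:
  the transform of the constant 1 is \<open>1 / (\<Gamma>(a+b) \<Gamma>(a+c))\<close>, the squared norm of 1 in the disk
  space is \<open>\<Gamma>(b+c) / (\<Gamma>(a+b) \<Gamma>(a+c))\<close>, and the integral over \<open>s \<ge> 0\<close> of
  \<open>|\<Gamma>(a+is) \<Gamma>(b+is) \<Gamma>(c+is) / \<Gamma>(2is)|\<^sup>2\<close> is \<open>2\<pi> \<Gamma>(a+b) \<Gamma>(a+c) \<Gamma>(b+c)\<close>.
\<close>

definition spectral_measure :: "real \<Rightarrow> real \<Rightarrow> real \<Rightarrow> real measure" where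
  "spectral_measure a b c =
     density (restrict_space lborel {0..})
       (\<lambda>s. ennreal (1 / (2 * pi) *
          (norm (Gamma (of_real a + \<i> * of_real s) * Gamma (of_real b + \<i> * of_real s) *
                 Gamma (of_real c + \<i> * of_real s) / Gamma (2 * \<i> * of_real s)))\<^sup>2))"


section \<open>The integral operator\<close>

definition J_integrand ::
    "real \<Rightarrow> real \<Rightarrow> real \<Rightarrow> (complex \<Rightarrow> complex) \<Rightarrow> real \<Rightarrow> real \<Rightarrow> complex" where
  "J_integrand a b c g s x =
     of_real ((1 + x) powr (- a - b)) * g (of_real (x / (x + 1))) *
     hyp2F1 (of_real b + \<i> * of_real s) (of_real b - \<i> * of_real s) (of_real (b + c)) (of_real (- x)) *
     of_real (x powr (b + c - 1) * (1 + x) powr (b - c))"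

definition J_integral ::
    "real \<Rightarrow> real \<Rightarrow> real \<Rightarrow> (complex \<Rightarrow> complex) \<Rightarrow> real \<Rightarrow> complex" where
  "J_integral a b c g s =
     1 / of_real ((norm (Gamma (of_real a + \<i> * of_real s :: complex)))\<^sup>2 * Gamma (b + c)) *
     (LINT x:{0<..}|lborel. J_integrand a b c g s x)"

text \<open>
  Extension by continuity from the polynomials: the image of \<open>f\<close> is the \<open>L\<^sup>2\<close>-limit of the
  transforms of \<open>p n\<close>, for every sequence of polynomials \<open>p n\<close> converging to \<open>f\<close>.
\<close>

definition J_op ::
    "real \<Rightarrow> real \<Rightarrow> real \<Rightarrow> (complex \<Rightarrow> complex) \<Rightarrow> real \<Rightarrow> complex" where
  "J_op a b c f =
     (SOME h. h \<in> L2_space (spectral_measure a b c) \<and>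
        (\<forall>p :: nat \<Rightarrow> complex poly.
           (\<lambda>n. W_dist a b c (poly (p n)) f) \<longlonglongrightarrow> 0 \<longrightarrow>
           (\<lambda>n. L2_dist (spectral_measure a b c) (J_integral a b c (poly (p n))) h) \<longlonglongrightarrow> 0))"

text \<open>
  The extension is legitimate: the integrals converge absolutely, the transforms of polynomials are
  square integrable, polynomials are dense, and the extended operator restricts to the integral.
\<close>

definition J_well_defined :: "real \<Rightarrow> real \<Rightarrow> real \<Rightarrow> bool" where
  "J_well_defined a b c \<longleftrightarrow>
     (\<forall>p s. 0 \<le> s \<longrightarrow> set_integrable lborel {0<..} (J_integrand a b c (poly p) s)) \<and>
     (\<forall>p. poly p \<in> W_space a b c \<and>
          J_integral a b c (poly p) \<in> L2_space (spectral_measure a b c)) \<and>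
     (\<forall>f\<in>W_space a b c. \<forall>e>0. \<exists>p. W_dist a b c (poly p) f < e) \<and>
     (\<forall>p. AE s in spectral_measure a b c. J_op a b c (poly p) s = J_integral a b c (poly p) s)"


section \<open>Unitary operators onto an \<open>L\<^sup>2\<close> space\<close>

text \<open>
  \<open>V\<close> is a space of functions with scalar product \<open>ip\<close>.  Preservation of scalar products together
  with linearity shows that \<open>U\<close> respects the identification of representatives.
\<close>

definition unitary_onto_L2 ::
    "('x \<Rightarrow> complex) set \<Rightarrow> (('x \<Rightarrow> complex) \<Rightarrow> ('x \<Rightarrow> complex) \<Rightarrow> complex) \<Rightarrow>
     'y measure \<Rightarrow> (('x \<Rightarrow> complex) \<Rightarrow> 'y \<Rightarrow> complex) \<Rightarrow> bool" where
  "unitary_onto_L2 V ip M U \<longleftrightarrow>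
     (\<forall>f\<in>V. U f \<in> L2_space M) \<and>
     (\<forall>f\<in>V. \<forall>g\<in>V. \<forall>\<alpha> \<beta>.
        AE y in M. U (\<lambda>x. \<alpha> * f x + \<beta> * g x) y = \<alpha> * U f y + \<beta> * U g y) \<and>
     (\<forall>f\<in>V. \<forall>g\<in>V. L2_inner M (U f) (U g) = ip f g) \<and>
     (\<forall>h\<in>L2_space M. \<exists>f\<in>V. AE y in M. U f y = h y)"

end

theory Submission
  imports Defs "HOL-Probability.Probability"
begin

text \<open>
  Euler's integral continues the hypergeometric function to the slit plane and gives, at \<open>-x\<close>, a
  power series in \<open>x / (1 + x)\<close>.  Integrating it termwise and summing by Gauss's theorem, the
  transform of \<open>(1 - z)\<^sup>n\<close> is \<open>(a + is)\<^sub>n (a - is)\<^sub>n / (\<Gamma>(a + b + n) \<Gamma>(a + c + n))\<close>.  Hence \<open>z\<^sup>n\<close>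
  goes to a multiple of the \<open>n\<close>-th continuous dual Hahn polynomial, which is orthogonal to
  \<open>(b + is)\<^sub>m (b - is)\<^sub>m\<close> for \<open>m < n\<close> because the inner product is an \<open>n\<close>-th finite difference of a
  polynomial of degree \<open>m\<close>; its norm agrees with that of \<open>z\<^sup>n\<close>, again by Gauss's theorem.

  The integral of the weight is \<open>4\<pi> \<Gamma>(a + b) \<Gamma>(a + c) \<Gamma>(b + c)\<close> over the line: shifting the
  contour by \<open>i\<close> shows that the quotient of both sides has period 1 in each parameter, a monotonicity
  argument as in the Bohr--Mollerup theorem makes it constant, and for \<open>(1/2, 1/2, 1)\<close> it is elementary.
  The transform is onto because the weight decays exponentially, so that polynomials are dense.
\<close>

section \<open>Exponential decay of the Gamma function\<close>

text \<open>Two coincidences drive the proof. Under z = x / (x + 1) the factor (1 - z)^n becomes (1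
  + x)^(-n), so it only raises \<open>a\<close> to \<open>a + n\<close> and one evaluation serves
  every n; this is why the expansion is made around 1 although the disk space favours powers of z.
  On the spectral side, (a + is)_k (a - is)_k and (b + is)_m (b - is)_m only raise parameters of the
  weight, so its total mass, known for all parameters, already contains every mixed inner product.
  The weight itself resists a contour shift: 1 / |Gamma(2is)|^2 is 2s sinh(2 pi s) / pi, whose
  factor s is not periodic. The shifted integrand therefore omits that factor; sin(2 pi z), which
  has period 1, remains, and s reappears in the difference of the two edges. For (1/2, 1/2, 1) the
  mass on the line is pi^2 and the product of Gamma values is pi/4, whence 4 pi. Evenness of the
  weight halves this on the half-line, which matches the constant 1 / (2 pi) of
  \<open>spectral_measure\<close>.\<close>

lemma norm_Gamma_ratio_mono:
  fixes x x' y :: real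
  assumes "0 < x" "x \<le> x'"
  shows "norm (Gamma (Complex x y)) / Gamma x \<le> norm (Gamma (Complex x' y)) / Gamma x'"
proof -
  \<comment> \<open>Euler's limit for Gamma turns the quotient into a product of factors (x + k) /
    |x + k + iy|; the powers of n have equal modulus and cancel. Each factor increases with x, which
    \<open>factor\<close> proves by squaring.\<close>
  have ser: "norm (Gamma_series (Complex x y) n) / Gamma_series x n = (\<Prod>k=0..n. (x + real k) / norm (Complex (x + real k) y))"
    if "0 < x" for x n
  proof -
    have "norm (exp (Complex x y * of_real (ln (real n)))) = exp (x * ln (real n))"
      by (simp add: norm_exp_eq_Re)
    moreover have "norm (pochhammer (Complex x y) (n+1)) = (\<Prod>k=0..n. norm (Complex (x + real k) y))"
      by (simp add: pochhammer_prod atLeastLessThanSuc_atLeastAtMost prod_norm[symmetric] complex_eq_iff)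
         (intro prod.cong refl, simp add: cmod_def)
    moreover have "pochhammer x (n+1) = (\<Prod>k=0..n. x + real k)"
      by (simp add: pochhammer_prod atLeastLessThanSuc_atLeastAtMost)
    moreover have "pochhammer x (n+1) > 0" using that by (intro pochhammer_pos)
    ultimately show ?thesis
      by (simp add: Gamma_series_def norm_mult norm_divide norm_fact prod_dividef del: pochhammer_Suc)
  qed
  have lim: "(\<lambda>n. norm (Gamma_series (Complex x y) n) / Gamma_series x n) \<longlonglongrightarrow> norm (Gamma (Complex x y)) / Gamma x"
    if "0 < x" for x
  proof -
    have "Gamma x \<noteq> 0" using Gamma_real_pos[OF that] by simp
    thus ?thesis by (intro tendsto_divide tendsto_norm Gamma_series_LIMSEQ)
  qed
  have factor: "(x + k) / norm (Complex (x + k) y) \<le> (x' + k) / norm (Complex (x' + k) y)" for k :: nat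
  proof -
    have p: "0 < x + k" "0 < x' + k" "x + k \<le> x' + k" using assms by auto
    have "(x + k)\<^sup>2 * ((x' + k)\<^sup>2 + y\<^sup>2) \<le> (x' + k)\<^sup>2 * ((x + k)\<^sup>2 + y\<^sup>2)"
      using mult_right_mono[OF power_mono[OF p(3), of 2], of "y\<^sup>2"] p by (simp add: algebra_simps)
    hence "((x + k) * norm (Complex (x' + k) y))\<^sup>2 \<le> ((x' + k) * norm (Complex (x + k) y))\<^sup>2"
      by (simp only: power_mult_distrib cmod_power2 complex.sel)
    hence "(x + k) * norm (Complex (x' + k) y) \<le> (x' + k) * norm (Complex (x + k) y)"
      by (rule power2_le_imp_le) (use p in auto)
    moreover have "norm (Complex (x' + k) y) > 0" "norm (Complex (x + k) y) > 0"
      using p by (auto simp: complex_eq_iff)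
    ultimately show ?thesis by (simp add: field_simps)
  qed
  show ?thesis
  proof (rule LIMSEQ_le[OF lim lim])
    show "\<exists>N. \<forall>n\<ge>N. norm (Gamma_series (Complex x y) n) / Gamma_series x n
             \<le> norm (Gamma_series (Complex x' y) n) / Gamma_series x' n"
      using assms by (auto simp: ser intro!: exI[of _ 0] prod_mono factor)
  qed (use assms in auto)
qed

lemma sinh_of_real: "sinh (complex_of_real x) = of_real (sinh x)"
  and cosh_of_real: "cosh (complex_of_real x) = of_real (cosh x)"
  by (simp_all add: sinh_def cosh_def scaleR_conv_of_real exp_of_real flip: of_real_minus)

text \<open>On the line Re z = 1/2 the reflection z -> 1 - z is complex conjugation, so the
  reflection formula evaluates the squared modulus exactly.\<close>

lemma norm_Gamma_half: "(norm (Gamma (Complex (1/2) y)))\<^sup>2 = pi / cosh (pi * y)"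
proof -
  have "Gamma (Complex (1/2) y) * Gamma (cnj (Complex (1/2) y)) = of_real pi / sin (of_real pi * Complex (1/2) y)"
  proof -
    have "1 - Complex (1/2) y = cnj (Complex (1/2) y)" by (simp add: complex_eq_iff)
    thus ?thesis using Gamma_reflection_complex[of "Complex (1/2) y"] by simp
  qed
  also have "sin (of_real pi * Complex (1/2) y) = of_real (cosh (pi * y))"
  proof -
    have "of_real pi * Complex (1/2) y = of_real pi / 2 + \<i> * of_real (pi * y)"
      by (simp add: complex_eq_iff)
    hence "sin (of_real pi * Complex (1/2) y) = cosh (of_real (pi * y))"
      by (simp add: sin_add cosh_conv_cos)
    thus ?thesis by (simp only: cosh_of_real)
  qed
  finally have "of_real ((norm (Gamma (Complex (1/2) y)))\<^sup>2) = complex_of_real (pi / cosh (pi * y))"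
    by (simp only: complex_norm_square cnj_Gamma of_real_divide)
  thus ?thesis by (simp only: of_real_eq_iff)
qed

lemma poly_le_exp:
  fixes e :: real
  assumes "e > 0"
  obtains C where "C > 0" "\<And>t. t \<ge> 0 \<Longrightarrow> (1 + t) ^ N \<le> C * exp (e * t)"
proof -
  \<comment> \<open>From 1 + t \<le> m (1 + t/m) \<le> m exp (t/m) for m \<ge> 1, the N-th power
    grows with rate N/m; this m makes N/m \<le> e.\<close>
  define m where "m = real N / e + 1"
  have m: "m \<ge> 1" using assms by (simp add: m_def)
  have "(1 + t) ^ N \<le> m ^ N * exp (e * t)" if "t \<ge> 0" for t
  proof -
    have "1 + t \<le> m * (1 + t / m)" using m that by (simp add: field_simps)
    also have "\<dots> \<le> m * exp (t / m)" using m by (intro mult_left_mono exp_ge_add_one_self) auto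
    finally have "(1 + t) ^ N \<le> (m * exp (t / m)) ^ N" using that by (intro power_mono) auto
    also have "\<dots> = m ^ N * exp (real N * (t / m))" by (simp only: power_mult_distrib exp_of_nat_mult)
    also have "\<dots> \<le> m ^ N * exp (e * t)"
    proof -
      have "real N \<le> e * m" using assms by (simp add: m_def field_simps)
      hence "real N * t \<le> e * m * t" using that by (intro mult_right_mono)
      hence "real N * (t / m) \<le> e * t" using m by (simp add: field_simps)
      thus ?thesis using m by simp
    qed
    finally show ?thesis .
  qed
  moreover have "m ^ N > 0" using m by simp
  ultimately show ?thesis using that by blast
qed

text \<open>On Re z = 1/2 the decay has the exact rate pi/2. The functional equation carries it to
  the line Re z = X, a half-integer beyond B, at the cost of a power of 1 + |y|;
  \<open>norm_Gamma_ratio_mono\<close> then brings it back to every x in the strip. The power is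
  absorbed by the loss e = pi/2 - \<eta> in the rate.\<close>

lemma Gamma_exp_decay:
  fixes \<delta> B \<eta> :: real
  assumes "0 < \<delta>" "\<eta> < pi / 2"
  obtains C where "C > 0" "\<And>x y. \<delta> \<le> x \<Longrightarrow> x \<le> B \<Longrightarrow> norm (Gamma (Complex x y)) \<le> C * exp (- \<eta> * \<bar>y\<bar>)"
proof -
  obtain N :: nat where N: "B \<le> real N" using real_arch_simple by blast
  define X where "X = real N + 1/2"
  have "compact (Gamma ` {\<delta>..X})"
    using assms by (intro compact_continuous_image continuous_on_Gamma) (auto elim!: nonpos_Ints_cases)
  then obtain G where "G > 0" "\<And>g. g \<in> Gamma ` {\<delta>..X} \<Longrightarrow> norm g \<le> G"
    using compact_imp_bounded[of "Gamma ` {\<delta>..X}"] unfolding bounded_pos by metis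
  hence G: "\<And>x. x \<in> {\<delta>..X} \<Longrightarrow> Gamma x \<le> G" "G > 0" by (fastforce simp: abs_le_iff)+
  define e where "e = pi / 2 - \<eta>"
  have "e > 0" using assms by (simp add: e_def)
  then obtain C where C: "C > 0" "\<And>t. t \<ge> 0 \<Longrightarrow> (1 + t) ^ N \<le> C * exp (e * t)"
    using poly_le_exp by blast
  have half: "norm (Gamma (Complex (1/2) y)) \<le> sqrt (2 * pi) * exp (- (pi/2) * \<bar>y\<bar>)" for y
  proof (rule power2_le_imp_le)
    have "exp (pi * \<bar>y\<bar>) \<le> 2 * cosh (pi * y)" 
      by (cases "y \<ge> 0") (auto simp: cosh_def)
    moreover have "cosh (pi * y) > 0" by (rule cosh_real_pos)
    ultimately have "pi / cosh (pi * y) \<le> 2 * pi / exp (pi * \<bar>y\<bar>)"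
      by (simp add: field_simps)
    also have "\<dots> = (sqrt (2 * pi) * exp (- (pi/2) * \<bar>y\<bar>))\<^sup>2"
      by (simp add: power_mult_distrib exp_minus field_simps flip: exp_double)
    finally show "(norm (Gamma (Complex (1/2) y)))\<^sup>2 \<le> (sqrt (2 * pi) * exp (- (pi/2) * \<bar>y\<bar>))\<^sup>2"
      by (simp add: norm_Gamma_half)
  qed auto
  have top: "norm (Gamma (Complex X y)) \<le> X ^ N * (1 + \<bar>y\<bar>) ^ N * (sqrt (2 * pi) * exp (- (pi/2) * \<bar>y\<bar>))" for y
  proof -
    have z: "Complex (1/2) y \<notin> \<int>\<^sub>\<le>\<^sub>0" by (auto elim!: nonpos_Ints_cases simp: complex_eq_iff)
    have "Gamma (Complex X y) = pochhammer (Complex (1/2) y) N * Gamma (Complex (1/2) y)"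
    proof -
      have "Complex (1/2) y + of_nat N = Complex X y" by (simp add: complex_eq_iff X_def)
      thus ?thesis using pochhammer_Gamma[OF z, of N] z by (simp add: Gamma_eq_zero_iff)
    qed
    moreover have "norm (pochhammer (Complex (1/2) y) N) \<le> (X * (1 + \<bar>y\<bar>)) ^ N"
    proof -
      have "norm (pochhammer (Complex (1/2) y) N) = (\<Prod>k<N. norm (Complex (1/2) y + of_nat k))"
        by (simp add: pochhammer_prod prod_norm atLeast0LessThan)
      also have "\<dots> \<le> (\<Prod>k<N. X * (1 + \<bar>y\<bar>))"
      proof (intro prod_mono conjI)
        fix k assume k: "k \<in> {..<N}"
        have "norm (Complex (1/2) y + of_nat k) \<le> \<bar>1/2 + real k\<bar> + \<bar>y\<bar>"
          using cmod_le[of "Complex (1/2) y + of_nat k"] by simp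
        also have "\<dots> \<le> X + X * \<bar>y\<bar>" 
          using k mult_right_mono[of 1 X "\<bar>y\<bar>"] by (auto simp: X_def)
        finally show "norm (Complex (1/2) y + of_nat k) \<le> X * (1 + \<bar>y\<bar>)" by (simp add: algebra_simps)
      qed auto
      finally show ?thesis by simp
    qed
    ultimately show ?thesis
      by (simp only: norm_mult power_mult_distrib) (intro mult_mono half; simp add: X_def)
  qed
  define K where "K = G / Gamma X * (X ^ N * C * sqrt (2 * pi))"
  have X: "X > 0" by (simp add: X_def)
  have KK: "K > 0" using G C X by (auto simp: K_def Gamma_real_pos)
  moreover have "norm (Gamma (Complex x y)) \<le> K * exp (- \<eta> * \<bar>y\<bar>)" if "\<delta> \<le> x" "x \<le> B" for x y
  proof -
    have x: "0 < x" "x \<le> X" using that assms N by (auto simp: X_def)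
    have Gx: "Gamma x > 0" "Gamma X > 0" using x by (auto simp: Gamma_real_pos)
    have "norm (Gamma (Complex x y)) \<le> Gamma x / Gamma X * norm (Gamma (Complex X y))"
      using norm_Gamma_ratio_mono[OF x, of y] Gx by (simp add: field_simps)
    also have "\<dots> \<le> G / Gamma X * (X ^ N * (1 + \<bar>y\<bar>) ^ N * (sqrt (2 * pi) * exp (- (pi/2) * \<bar>y\<bar>)))"
    proof (intro mult_mono top divide_right_mono)
      show "0 \<le> G / Gamma X" using G(2) Gx by (intro divide_nonneg_pos) auto
    qed (use G(1)[of x] Gx x that in auto)
    also have "\<dots> \<le> G / Gamma X * (X ^ N * (C * exp (e * \<bar>y\<bar>)) * (sqrt (2 * pi) * exp (- (pi/2) * \<bar>y\<bar>)))"
      using G Gx X C by (intro mult_left_mono mult_right_mono) auto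
    also have "\<dots> = K * (exp (e * \<bar>y\<bar>) * exp (- (pi/2) * \<bar>y\<bar>))"
      by (simp add: K_def)
    also have "exp (e * \<bar>y\<bar>) * exp (- (pi/2) * \<bar>y\<bar>) = exp (- \<eta> * \<bar>y\<bar>)"
      by (simp add: e_def algebra_simps flip: exp_add)
    finally show ?thesis .
  qed
  ultimately show ?thesis using that by blast
qed

section \<open>The contour shift\<close>

lemma integrable_exp_abs:
  fixes e :: real assumes "e > 0"
  shows "integrable lborel (\<lambda>y. exp (- e * \<bar>y\<bar>))"
proof -
  have "(\<lambda>y. exp (- e * y)) absolutely_integrable_on {0..}"
    using integrable_on_exp_minus_to_infinity[OF assms, of 0]
    by (intro nonnegative_absolutely_integrable_1) auto
  hence 1: "integrable lborel (\<lambda>y. indicator {0..} y * exp (- e * y))"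
    by (simp add: set_integrable_def integrable_completion)
  have 2: "integrable lborel (\<lambda>y. indicator {0..} (- y) * exp (- e * (- y)))"
    using lborel_integrable_real_affine[OF 1, of "-1" 0] by simp
  show ?thesis
  proof (rule Bochner_Integration.integrable_bound)
    show "integrable lborel (\<lambda>y. indicator {0..} y * exp (- e * y) + indicator {0..} (- y) * exp (- e * (- y)))"
      by (rule Bochner_Integration.integrable_add[OF 1 2])
  qed (auto simp: indicator_def)
qed

text \<open>Cauchy's theorem on a strip, with a primitive P in place of a contour: the truncated
  integrals along the two vertical lines are differences of P, and along the horizontal edges, of
  length 1, the bound on D makes P change by a quantity that tends to 0.\<close>

lemma integral_strip_shift:
  fixes D :: "complex \<Rightarrow> complex"
  assumes hol: "D holomorphic_on {z. -\<delta> < Re z \<and> Re z < 1 + \<delta>}" and "\<delta> > 0" "e > 0"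
    and bnd: "\<And>x y. 0 \<le> x \<Longrightarrow> x \<le> 1 \<Longrightarrow> norm (D (Complex x y)) \<le> C * exp (- e * \<bar>y\<bar>)"
  shows "integrable lborel (\<lambda>y. D (Complex 0 y))" "integrable lborel (\<lambda>y. D (Complex 1 y))"
    "(LINT y|lborel. D (Complex 0 y)) = (LINT y|lborel. D (Complex 1 y))"
proof -
  let ?S = "{z. -\<delta> < Re z \<and> Re z < 1 + \<delta>}"
  have S: "open ?S" "convex ?S"
  proof -
    have *: "?S = {z. Re z > -\<delta>} \<inter> {z. Re z < 1 + \<delta>}" by auto
    show "open ?S" unfolding * by (intro open_Int open_halfspace_Re_gt open_halfspace_Re_lt)
    show "convex ?S" unfolding * by (intro convex_Int convex_halfspace_Re_gt convex_halfspace_Re_lt)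
  qed
  obtain P where P: "\<And>z. z \<in> ?S \<Longrightarrow> (P has_field_derivative D z) (at z)"
  proof -
    obtain g where g: "\<And>z. z \<in> ?S \<Longrightarrow> (g has_field_derivative D z) (at z within ?S)"
      using holomorphic_convex_primitive'[OF S(2,1) hol] by blast
    show ?thesis
      by (rule that[of g], subst at_within_open[OF _ S(1), symmetric]) (assumption, rule g)
  qed
  have cont: "continuous_on UNIV (\<lambda>y. D (Complex x y))" if "0 \<le> x" "x \<le> 1" for x
  proof -
    have "continuous_on UNIV (\<lambda>y. Complex x y)"
      unfolding Complex_eq by (intro continuous_intros)
    with holomorphic_on_imp_continuous_on[OF hol] show ?thesis
      by (rule continuous_on_compose2) (use that \<open>\<delta> > 0\<close> in auto)
  qed
  have meas: "(\<lambda>y. D (Complex x y)) \<in> borel_measurable borel" if "0 \<le> x" "x \<le> 1" for x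
    by (rule borel_measurable_continuous_onI[OF cont[OF that]])
  have integ: "integrable lborel (\<lambda>y. D (Complex x y))" if "0 \<le> x" "x \<le> 1" for x
  proof (rule Bochner_Integration.integrable_bound)
    show "integrable lborel (\<lambda>y. C * exp (- e * \<bar>y\<bar>))" using integrable_exp_abs[OF \<open>e > 0\<close>] by simp
    show "AE y in lborel. norm (D (Complex x y)) \<le> norm (C * exp (- e * \<bar>y\<bar>))"
      using bnd[OF that] by (auto intro!: order.trans[OF bnd[OF that]])
  qed (use meas[OF that] in simp)
  show "integrable lborel (\<lambda>y. D (Complex 0 y))" "integrable lborel (\<lambda>y. D (Complex 1 y))"
    by (rule integ; simp)+
  \<comment> \<open>On a vertical line dz = i dy, hence the factor \<i> between P and the integral
    over y.\<close>
  have trunc: "(\<lambda>n. P (Complex x (real n)) - P (Complex x (- real n))) \<longlonglongrightarrow> \<i> * (LINT y|lborel. D (Complex x y))"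
    if x: "0 \<le> x" "x \<le> 1" for x
  proof -
    have "(\<lambda>n. LINT y|lborel. indicator {-real n..real n} y *\<^sub>R D (Complex x y)) \<longlonglongrightarrow> (LINT y|lborel. D (Complex x y))"
    proof (rule integral_dominated_convergence[where w="\<lambda>y. norm (D (Complex x y))"])
      show "AE y in lborel. (\<lambda>n. indicator {-real n..real n} y *\<^sub>R D (Complex x y)) \<longlonglongrightarrow> D (Complex x y)"
      proof (rule AE_I2, rule tendsto_eventually)
        fix y :: real
        obtain N :: nat where "\<bar>y\<bar> \<le> real N" using real_arch_simple by blast
        thus "\<forall>\<^sub>F n in sequentially. indicator {-real n..real n} y *\<^sub>R D (Complex x y) = D (Complex x y)"
          by (intro eventually_sequentiallyI[of N]) (auto simp: indicator_def)
      qed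
    qed (use integ[OF x] meas[OF x] in \<open>auto simp: indicator_def\<close>)
    moreover have "(LINT y|lborel. indicator {-real n..real n} y *\<^sub>R D (Complex x y)) = (P (Complex x (real n)) - P (Complex x (- real n))) / \<i>" for n
    proof -
      have "(LINT y:{-real n..real n}|lborel. D (Complex x y)) = integral {-real n..real n} (\<lambda>y. D (Complex x y))"
        by (intro set_borel_integral_eq_integral borel_integrable_atLeastAtMost' continuous_on_subset[OF cont[OF x]]) auto
      also have "((\<lambda>y. D (Complex x y)) has_integral (P (Complex x (real n)) / \<i> - P (Complex x (- real n)) / \<i>)) {-real n..real n}"
      proof (rule fundamental_theorem_of_calculus)
        fix y
        have "((\<lambda>y. P (Complex x y)) has_vector_derivative \<i> * D (Complex x y)) (at y within {-real n..real n})"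
        proof (rule field_vector_diff_chain_within[unfolded o_def, where f="Complex x"])
          show "(Complex x has_vector_derivative \<i>) (at y within {-real n..real n})"
            unfolding Complex_eq by (auto intro!: derivative_eq_intros has_vector_derivative_at_within simp: scaleR_conv_of_real has_vector_derivative_def)
          show "(P has_field_derivative D (Complex x y)) (at (Complex x y) within Complex x ` {- real n..real n})"
            by (rule has_field_derivative_at_within[OF P]) (use x \<open>\<delta> > 0\<close> in auto)
        qed
        thus "((\<lambda>y. P (Complex x y) / \<i>) has_vector_derivative D (Complex x y)) (at y within {-real n..real n})"
          using has_vector_derivative_divide[where a="\<i>"] by fastforce
      qed simp
      hence "integral {-real n..real n} (\<lambda>y. D (Complex x y)) = P (Complex x (real n)) / \<i> - P (Complex x (- real n)) / \<i>"
        by (rule integral_unique)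
      finally show ?thesis by (simp only: set_lebesgue_integral_def diff_divide_distrib)
    qed
    ultimately have "(\<lambda>n. \<i> * ((P (Complex x (real n)) - P (Complex x (- real n))) / \<i>)) \<longlonglongrightarrow> \<i> * (LINT y|lborel. D (Complex x y))"
      by (intro tendsto_mult tendsto_const) simp
    thus ?thesis by simp
  qed
  have horiz: "(\<lambda>n. P (Complex 1 (\<sigma> * real n)) - P (Complex 0 (\<sigma> * real n))) \<longlonglongrightarrow> 0" if "\<bar>\<sigma>\<bar> = 1" for \<sigma> :: real
  proof (rule Lim_null_comparison)
    have "norm (P (Complex 1 y) - P (Complex 0 y)) \<le> C * exp (- e * \<bar>y\<bar>) * norm (Complex 1 y - Complex 0 y)" for y
    proof (rule field_differentiable_bound[where S="closed_segment (Complex 0 y) (Complex 1 y)" and f'=D])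
      fix z assume "z \<in> closed_segment (Complex 0 y) (Complex 1 y)"
      then obtain t where t: "0 \<le> t" "t \<le> 1" "z = (1 - t) *\<^sub>R Complex 0 y + t *\<^sub>R Complex 1 y"
        by (auto simp: in_segment)
      hence z: "z = Complex t y" by (simp add: complex_eq_iff algebra_simps)
      show "(P has_field_derivative D z) (at z within closed_segment (Complex 0 y) (Complex 1 y))"
        by (rule has_field_derivative_at_within[OF P]) (use z t \<open>\<delta> > 0\<close> in auto)
      show "norm (D z) \<le> C * exp (- e * \<bar>y\<bar>)" unfolding z by (rule bnd[OF t(1,2)])
    qed auto
    moreover have "norm (Complex 1 y - Complex 0 y) = 1" for y by (simp add: cmod_def)
    ultimately show "\<forall>\<^sub>F n in sequentially. norm (P (Complex 1 (\<sigma> * real n)) - P (Complex 0 (\<sigma> * real n))) \<le> C * exp (- e * real n)"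
    proof (intro always_eventually allI)
      fix n assume *: "\<And>y. norm (P (Complex 1 y) - P (Complex 0 y)) \<le> C * exp (- e * \<bar>y\<bar>) * norm (Complex 1 y - Complex 0 y)"
        "\<And>y. norm (Complex 1 y - Complex 0 y) = 1"
      show "norm (P (Complex 1 (\<sigma> * real n)) - P (Complex 0 (\<sigma> * real n))) \<le> C * exp (- e * real n)"
        using *(1)[of "\<sigma> * real n"] that unfolding *(2) by (simp add: abs_mult)
    qed
    have "(\<lambda>n. exp (- e * real n)) \<longlonglongrightarrow> 0"
      using \<open>e > 0\<close> by real_asymp
    thus "(\<lambda>n. C * exp (- e * real n)) \<longlonglongrightarrow> 0" by (auto intro: tendsto_mult_right_zero)
  qed
  have "(\<lambda>n. (P (Complex 1 (real n)) - P (Complex 1 (- real n))) - (P (Complex 0 (real n)) - P (Complex 0 (- real n)))) \<longlonglongrightarrow>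
      \<i> * (LINT y|lborel. D (Complex 1 y)) - \<i> * (LINT y|lborel. D (Complex 0 y))"
    by (intro tendsto_diff trunc) auto
  moreover have "(\<lambda>n. (P (Complex 1 (real n)) - P (Complex 1 (- real n))) - (P (Complex 0 (real n)) - P (Complex 0 (- real n)))) \<longlonglongrightarrow> 0 - 0"
    using tendsto_diff[OF horiz[of 1] horiz[of "-1"]] by (simp add: algebra_simps)
  ultimately have "\<i> * (LINT y|lborel. D (Complex 1 y)) - \<i> * (LINT y|lborel. D (Complex 0 y)) = 0 - 0"
    by (rule LIMSEQ_unique)
  thus "(LINT y|lborel. D (Complex 0 y)) = (LINT y|lborel. D (Complex 1 y))" by simp
qed

section \<open>The total mass of the continuous dual Hahn weight\<close>

text \<open>This is 2 pi times the density of \<open>spectral_measure\<close>, taken on the whole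
  line. At s = 0 the pole of Gamma has the default value 0, so the quotient and the weight are 0,
  which agrees with the limit.\<close>

definition hahn_weight :: "real \<Rightarrow> real \<Rightarrow> real \<Rightarrow> real \<Rightarrow> real" where
  "hahn_weight a b c s = (norm (Gamma (Complex a s) * Gamma (Complex b s) * Gamma (Complex c s) / Gamma (Complex 0 (2 * s))))\<^sup>2"

lemma hahn_weight_nonneg: "hahn_weight a b c s \<ge> 0"
  by (simp add: hahn_weight_def)

lemma hahn_weight_commute: "hahn_weight a b c s = hahn_weight b a c s" "hahn_weight a b c s = hahn_weight a c b s"
  by (simp_all add: hahn_weight_def mult_ac)

lemma pos_notin_nonpos_Ints: "0 < x \<Longrightarrow> (x::real) \<notin> \<int>\<^sub>\<le>\<^sub>0"
  by (auto elim!: nonpos_Ints_cases)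

lemma Complex_notin_nonpos_Ints: "0 < x \<Longrightarrow> Complex x y \<notin> \<int>\<^sub>\<le>\<^sub>0"
  by (auto elim!: nonpos_Ints_cases simp: complex_eq_iff)

lemma hahn_weight_uminus: "hahn_weight a b c (- s) = hahn_weight a b c s"
proof -
  have "norm (Gamma (Complex x (- y))) = norm (Gamma (Complex x y))" for x y
    by (metis cnj_Gamma complex_cnj complex_mod_cnj)
  thus ?thesis by (simp add: hahn_weight_def norm_mult norm_divide)
qed

lemma sin_2pi_imaginary: "sin (2 * of_real pi * Complex 0 s) = \<i> * of_real (sinh (2 * pi * s))"
proof -
  have "2 * of_real pi * Complex 0 s = \<i> * of_real (2 * pi * s)"
    by (simp add: complex_eq_iff)
  moreover have "\<i> * sinh (of_real (2 * pi * s)) = sin (\<i> * of_real (2 * pi * s))"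
    unfolding sinh_conv_sin by simp
  ultimately show ?thesis by (simp only: sinh_of_real)
qed

text \<open>The reflection formula is applied to the entire function \<open>rGamma\<close>, so s = 0
  is included. In this form the weight is visibly continuous, and the growth of sinh can be compared
  with the decay of the three squared Gamma factors.\<close>

lemma hahn_weight_eq_sinh:
  "hahn_weight a b c s = (norm (Gamma (Complex a s) * Gamma (Complex b s) * Gamma (Complex c s)))\<^sup>2 * (2 * s * sinh (2 * pi * s) / pi)"
proof -
  have "complex_of_real ((norm (rGamma (Complex 0 (2 * s))))\<^sup>2) = rGamma (Complex 0 (2 * s)) * rGamma (- Complex 0 (2 * s))"
    by (simp only: complex_norm_square cnj_rGamma complex_cnj complex_minus minus_zero)
  also have "\<dots> = - Complex 0 (2 * s) * sin (of_real pi * Complex 0 (2 * s)) / of_real pi"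
    by (rule rGamma_reflection_complex')
  also have "of_real pi * Complex 0 (2 * s) = 2 * of_real pi * Complex 0 s"
    by (simp add: complex_eq_iff)
  also have "- Complex 0 (2 * s) * sin (2 * of_real pi * Complex 0 s) / of_real pi = of_real (2 * s * sinh (2 * pi * s) / pi)"
    unfolding sin_2pi_imaginary by (simp add: complex_eq_iff)
  finally have "(norm (rGamma (Complex 0 (2 * s))))\<^sup>2 = 2 * s * sinh (2 * pi * s) / pi"
    by (simp only: of_real_eq_iff)
  moreover have "hahn_weight a b c s = (norm (Gamma (Complex a s) * Gamma (Complex b s) * Gamma (Complex c s)))\<^sup>2 * (norm (rGamma (Complex 0 (2 * s))))\<^sup>2"
    by (simp add: hahn_weight_def norm_mult norm_divide power_mult_distrib power_divide rGamma_inverse_Gamma norm_inverse power_inverse divide_inverse)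
  ultimately show ?thesis by (simp only:)
qed

lemma continuous_hahn_weight:
  assumes "0 < a" "0 < b" "0 < c"
  shows "continuous_on UNIV (hahn_weight a b c)"
proof -
  have "continuous_on UNIV (\<lambda>s. Gamma (Complex x s))" if "0 < x" for x
  proof (rule continuous_on_compose2[OF continuous_on_Gamma])
    show "continuous_on UNIV (Complex x)" unfolding Complex_eq by (intro continuous_intros)
    show "Complex x ` UNIV \<inter> \<int>\<^sub>\<le>\<^sub>0 = {}" using Complex_notin_nonpos_Ints[OF that] by auto
  qed auto
  note * = this[OF assms(1)] this[OF assms(2)] this[OF assms(3)]
  show ?thesis unfolding hahn_weight_eq_sinh
    by (intro continuous_intros *) auto
qed

lemma hahn_weight_decay:
  assumes "0 < a" "0 < b" "0 < c"
  obtains C where "C > 0" "\<And>s. hahn_weight a b c s \<le> C * exp (- (pi / 4) * \<bar>s\<bar>)"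
proof -
  \<comment> \<open>Three squared Gamma factors decay with rate 6 (5 pi / 12) = 5 pi / 2. The
    hyperbolic sine uses 2 pi of it and the factor s another pi/4, which leaves pi/4.\<close>
  define \<eta> where "\<eta> = 5 * pi / 12"
  have \<eta>: "\<eta> < pi / 2" by (simp add: \<eta>_def)
  obtain K where K: "K > 0" "\<And>x y. Min {a,b,c} \<le> x \<Longrightarrow> x \<le> Max {a,b,c} \<Longrightarrow> norm (Gamma (Complex x y)) \<le> K * exp (- \<eta> * \<bar>y\<bar>)"
    using Gamma_exp_decay[of "Min {a,b,c}" \<eta> "Max {a,b,c}"] assms \<eta> by auto
  obtain M where M: "M > 0" "\<And>t. t \<ge> 0 \<Longrightarrow> (1 + t) ^ 1 \<le> M * exp (pi/4 * t)"
    using poly_le_exp[of "pi/4" 1] by auto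
  have "hahn_weight a b c s \<le> (K ^ 6 * 2 * M / pi) * exp (- (pi / 4) * \<bar>s\<bar>)" for s
  proof -
    have "norm (Gamma (Complex a s) * Gamma (Complex b s) * Gamma (Complex c s)) \<le> (K * exp (- \<eta> * \<bar>s\<bar>)) ^ 3"
      unfolding norm_mult power3_eq_cube using K(1) by (intro mult_mono K(2)) auto
    hence "(norm (Gamma (Complex a s) * Gamma (Complex b s) * Gamma (Complex c s)))\<^sup>2 \<le> ((K * exp (- \<eta> * \<bar>s\<bar>)) ^ 3)\<^sup>2"
      by (intro power_mono) auto
    also have "((K * exp (- \<eta> * \<bar>s\<bar>)) ^ 3)\<^sup>2 = K ^ 6 * exp (- (5*pi/2) * \<bar>s\<bar>)"
      by (simp add: power_mult_distrib flip: exp_of_nat_mult power_mult) (simp add: \<eta>_def)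
    finally have 1: "(norm (Gamma (Complex a s) * Gamma (Complex b s) * Gamma (Complex c s)))\<^sup>2 \<le> K ^ 6 * exp (- (5*pi/2) * \<bar>s\<bar>)" .
    have 0: "2 * s * sinh (2 * pi * s) = 2 * \<bar>s\<bar> * sinh (2 * pi * \<bar>s\<bar>)"
      by (cases "s \<ge> 0") auto
    also have "\<dots> \<le> 2 * (M * exp (pi/4 * \<bar>s\<bar>)) * exp (2 * pi * \<bar>s\<bar>)"
      using M(2)[of "\<bar>s\<bar>"] M(1) by (intro mult_mono) (auto simp: sinh_def intro: order_trans[OF _ exp_ge_zero])
    finally have 2: "2 * s * sinh (2 * pi * s) / pi \<le> 2 * (M * exp (pi/4 * \<bar>s\<bar>)) * exp (2 * pi * \<bar>s\<bar>) / pi"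
      by (intro divide_right_mono) auto
    have "hahn_weight a b c s \<le> (K ^ 6 * exp (- (5*pi/2) * \<bar>s\<bar>)) * (2 * (M * exp (pi/4 * \<bar>s\<bar>)) * exp (2 * pi * \<bar>s\<bar>) / pi)"
      unfolding hahn_weight_eq_sinh using K by (intro mult_mono[OF 1 2]) (simp_all only: 0, auto)
    also have "\<dots> = (K ^ 6 * 2 * M / pi) * (exp (- (5*pi/2) * \<bar>s\<bar>) * exp (pi/4 * \<bar>s\<bar>) * exp (2 * pi * \<bar>s\<bar>))"
      by simp
    also have "exp (- (5*pi/2) * \<bar>s\<bar>) * exp (pi/4 * \<bar>s\<bar>) * exp (2 * pi * \<bar>s\<bar>) = exp (- (pi / 4) * \<bar>s\<bar>)"
      by (simp add: field_simps flip: exp_add)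
    finally show ?thesis .
  qed
  moreover have "K ^ 6 * 2 * M / pi > 0" using K M by simp
  ultimately show ?thesis using that by blast
qed

lemma integrable_hahn_weight:
  assumes "0 < a" "0 < b" "0 < c"
  shows "integrable lborel (hahn_weight a b c)"
proof -
  obtain C where C: "C > 0" "\<And>s. hahn_weight a b c s \<le> C * exp (- (pi / 4) * \<bar>s\<bar>)"
    using hahn_weight_decay[OF assms] by blast
  show ?thesis
  proof (rule Bochner_Integration.integrable_bound)
    show "integrable lborel (\<lambda>s. C * exp (- (pi / 4) * \<bar>s\<bar>))"
      using integrable_exp_abs[of "pi/4"] by simp
  qed (use C continuous_hahn_weight[OF assms] in \<open>auto simp: hahn_weight_nonneg intro: borel_measurable_continuous_onI\<close>)
qed

definition hahn_integral :: "real \<Rightarrow> real \<Rightarrow> real \<Rightarrow> real" where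
  "hahn_integral a b c = (LINT s|lborel. hahn_weight a b c s)"

lemma hahn_integral_commute:
  "hahn_integral a b c = hahn_integral b a c" "hahn_integral a b c = hahn_integral a c b"
proof -
  have "hahn_weight a b c = hahn_weight b a c" "hahn_weight a b c = hahn_weight a c b" using hahn_weight_commute by (intro ext; blast)+
  thus "hahn_integral a b c = hahn_integral b a c" "hahn_integral a b c = hahn_integral a c b"
    by (simp_all add: hahn_integral_def)
qed

lemma Gamma_Complex_plus1: "0 < x \<Longrightarrow> Gamma (Complex (x + 1) y) = Complex x y * Gamma (Complex x y)"
proof -
  assume "0 < x"
  have "Complex (x + 1) y = Complex x y + 1" by (simp add: complex_eq_iff)
  thus ?thesis using Gamma_plus1[OF Complex_notin_nonpos_Ints[OF \<open>0 < x\<close>], of y]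
    by (simp only:)
qed

lemma hahn_weight_plus1: "0 < a \<Longrightarrow> hahn_weight (a + 1) b c s = (a\<^sup>2 + s\<^sup>2) * hahn_weight a b c s"
  by (simp add: hahn_weight_def Gamma_Complex_plus1 norm_mult norm_divide power_mult_distrib power_divide cmod_power2)

text \<open>
  With \<open>z = is\<close> and up to a factor \<open>\<pi>\<close>, the integrand \<open>D\<close> is the weight times
  \<open>- (a - z)(b - z)(c - z) / (2z)\<close> at \<open>z\<close> and the weight times \<open>- (a + z)(b + z)(c + z) / (2z)\<close> at \<open>1 + z\<close>,
  so the shift annihilates the integral of \<open>ab + ac + bc - s\<^sup>2\<close> against the weight.
\<close>

lemma hahn_integral_plus1:
  assumes "0 < a" "0 < b" "0 < c"
  shows "hahn_integral (a + 1) b c = (a + b) * (a + c) * hahn_integral a b c"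
proof -
  \<comment> \<open>At z = is the pair Gamma(a + z) Gamma(a + 1 - z) equals (a - is) |Gamma(a +
    is)|^2, and at z = 1 + is it equals (a + is) |Gamma(a + is)|^2. So an analytic function
    reproduces the squared moduli of the weight on both edges.\<close>
  define D where "D = (\<lambda>z :: complex. sin (2 * of_real pi * z) * ((Gamma (of_real a + z) * Gamma (of_real a + 1 - z)) *
      (Gamma (of_real b + z) * Gamma (of_real b + 1 - z)) * (Gamma (of_real c + z) * Gamma (of_real c + 1 - z))))"
  define m where "m = Min {a,b,c}"
  define B where "B = Max {a,b,c} + 1"
  have m: "0 < m" "m \<le> a" "m \<le> b" "m \<le> c" "a + 1 \<le> B" "b + 1 \<le> B" "c + 1 \<le> B"
    using assms by (auto simp: m_def B_def)
  \<comment> \<open>Six Gamma factors of rate 5 pi / 12 against the growth rate 2 pi of the sine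
    leave pi/2.\<close>
  define \<eta> where "\<eta> = 5 * pi / 12"
  have \<eta>: "\<eta> < pi / 2" by (simp add: \<eta>_def)
  obtain K where K: "K > 0" "\<And>x y. m \<le> x \<Longrightarrow> x \<le> B \<Longrightarrow> norm (Gamma (Complex x y)) \<le> K * exp (- \<eta> * \<bar>y\<bar>)"
    using Gamma_exp_decay[of m \<eta> B] m \<eta> by blast
  have nonpos: "z \<notin> \<int>\<^sub>\<le>\<^sub>0" if "Re z > 0" for z :: complex
    using that by (auto elim!: nonpos_Ints_cases)
  have hol: "D holomorphic_on {z. - m < Re z \<and> Re z < 1 + m}"
    unfolding D_def using m by (intro holomorphic_intros) (auto intro!: nonpos)
  have bnd: "norm (D (Complex x y)) \<le> K ^ 6 * exp (- (pi/2) * \<bar>y\<bar>)" if x: "0 \<le> x" "x \<le> 1" for x y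
  proof -
    define k where "k = K * exp (- \<eta> * \<bar>y\<bar>)"
    have k: "k \<ge> 0" using K(1) by (simp add: k_def)
    have "norm (sin (2 * of_real pi * Complex x y)) \<le> exp (2 * pi * \<bar>y\<bar>)"
    proof -
      have "norm (sin (2 * of_real pi * Complex x y)) = norm (exp (\<i> * (2 * of_real pi * Complex x y)) - exp (- (\<i> * (2 * of_real pi * Complex x y)))) / 2"
        by (simp add: sin_exp_eq norm_divide norm_mult)
      also have "\<dots> \<le> (norm (exp (\<i> * (2 * of_real pi * Complex x y))) + norm (exp (- (\<i> * (2 * of_real pi * Complex x y))))) / 2"
        by (intro divide_right_mono norm_triangle_ineq4) auto
      also have "\<dots> \<le> (exp (2 * pi * \<bar>y\<bar>) + exp (2 * pi * \<bar>y\<bar>)) / 2"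
        by (intro divide_right_mono add_mono) (auto simp: norm_exp_eq_Re abs_if)
      finally show ?thesis by simp
    qed
    moreover have "norm ((Gamma (of_real p + Complex x y) * Gamma (of_real p + 1 - Complex x y))) \<le> k * k"
      if "p \<in> {a,b,c}" for p
    proof -
      have "of_real p + Complex x y = Complex (p + x) y" "of_real p + 1 - Complex x y = Complex (p + 1 - x) (-y)"
        by (auto simp: complex_eq_iff)
      thus ?thesis unfolding norm_mult
        using K(2)[of "p + x" y] K(2)[of "p + 1 - x" "-y"] m x that k by (intro mult_mono) (auto simp: k_def simp del: mult_minus_left)
    qed
    ultimately have *: "norm (sin (2 * of_real pi * Complex x y)) \<le> exp (2 * pi * \<bar>y\<bar>)"
      "\<And>p. p \<in> {a,b,c} \<Longrightarrow> norm (Gamma (of_real p + Complex x y) * Gamma (of_real p + 1 - Complex x y)) \<le> k * k"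
      by blast+
    have "norm (D (Complex x y)) = norm (sin (2 * of_real pi * Complex x y)) *
       (norm (Gamma (of_real a + Complex x y) * Gamma (of_real a + 1 - Complex x y)) *
        norm (Gamma (of_real b + Complex x y) * Gamma (of_real b + 1 - Complex x y)) *
        norm (Gamma (of_real c + Complex x y) * Gamma (of_real c + 1 - Complex x y)))"
      unfolding D_def by (simp only: norm_mult)
    also have "\<dots> \<le> exp (2 * pi * \<bar>y\<bar>) * ((k * k) * (k * k) * (k * k))"
      by (intro mult_mono *(1) *(2)[of a] *(2)[of b] *(2)[of c] mult_nonneg_nonneg norm_ge_zero exp_ge_zero k insertI1 insertI2)
    also have "\<dots> = K ^ 6 * (exp (2 * pi * \<bar>y\<bar>) * exp (- \<eta> * \<bar>y\<bar>) ^ 6)"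
      by (simp add: eval_nat_numeral k_def)
    also have "exp (2 * pi * \<bar>y\<bar>) * exp (- \<eta> * \<bar>y\<bar>) ^ 6 = exp (- (pi/2) * \<bar>y\<bar>)"
      by (simp add: \<eta>_def field_simps flip: exp_of_nat_mult exp_add)
    finally show ?thesis .
  qed
  note shift = integral_strip_shift[OF hol m(1) pi_half_gt_zero bnd]
  let ?F = "\<lambda>s. (a * b + a * c + b * c - s\<^sup>2) * hahn_weight a b c s"
  have D: "D (Complex 0 s) - D (Complex 1 s) = of_real (pi * ?F s)" for s
  proof -
    define G where "G = complex_of_real ((norm (Gamma (Complex a s) * Gamma (Complex b s) * Gamma (Complex c s)))\<^sup>2)"
    have conj: "Gamma (of_real p + Complex 0 s) * Gamma (of_real p + 1 - Complex 0 s) = Complex p (-s) * of_real ((norm (Gamma (Complex p s)))\<^sup>2)"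
      if "0 < p" for p
    proof -
      have "of_real p + Complex 0 s = Complex p s" "of_real p + 1 - Complex 0 s = Complex (p + 1) (- s)"
        by (auto simp: complex_eq_iff)
      moreover have "Gamma (Complex p (- s)) = cnj (Gamma (Complex p s))" by (simp only: cnj_Gamma complex_cnj)
      ultimately show ?thesis using Gamma_Complex_plus1[OF that, of "-s"] complex_norm_square[of "Gamma (Complex p s)"]
        by (simp add: mult_ac)
    qed
    have conj1: "Gamma (of_real p + Complex 1 s) * Gamma (of_real p + 1 - Complex 1 s) = Complex p s * of_real ((norm (Gamma (Complex p s)))\<^sup>2)"
      if "0 < p" for p
    proof -
      have "of_real p + Complex 1 s = Complex (p + 1) s" "of_real p + 1 - Complex 1 s = Complex p (- s)"
        by (auto simp: complex_eq_iff)
      moreover have "Gamma (Complex p (- s)) = cnj (Gamma (Complex p s))" by (simp only: cnj_Gamma complex_cnj)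
      ultimately show ?thesis using Gamma_Complex_plus1[OF that, of "s"] complex_norm_square[of "Gamma (Complex p s)"]
        by (simp add: mult_ac)
    qed
    have G: "G = of_real ((norm (Gamma (Complex a s)))\<^sup>2) * of_real ((norm (Gamma (Complex b s)))\<^sup>2) * of_real ((norm (Gamma (Complex c s)))\<^sup>2)"
      by (simp add: G_def norm_mult power_mult_distrib)
    have D0: "D (Complex 0 s) = \<i> * of_real (sinh (2 * pi * s)) * G * (Complex a (-s) * Complex b (-s) * Complex c (-s))"
      unfolding D_def conj[OF assms(1)] conj[OF assms(2)] conj[OF assms(3)] sin_2pi_imaginary G by (simp add: mult_ac)
    have "2 * of_real pi * Complex 1 s = 2 * of_real pi * Complex 0 s + 2 * of_real pi"
      by (simp add: complex_eq_iff)
    hence "sin (2 * of_real pi * Complex 1 s) = \<i> * of_real (sinh (2 * pi * s))"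
      using sin_of_real[of "2 * pi", where 'a=complex] cos_of_real[of "2 * pi", where 'a=complex]
      by (simp add: sin_add sin_2pi_imaginary)
    hence D1: "D (Complex 1 s) = \<i> * of_real (sinh (2 * pi * s)) * G * (Complex a s * Complex b s * Complex c s)"
      unfolding D_def conj1[OF assms(1)] conj1[OF assms(2)] conj1[OF assms(3)] G by (simp add: mult_ac)
    \<comment> \<open>Only the part odd in s survives, and it supplies the factor s that D
      omits.\<close>
    have "Complex a (-s) * Complex b (-s) * Complex c (-s) - Complex a s * Complex b s * Complex c s = - (2 * \<i> * s * (a * b + a * c + b * c - s\<^sup>2))"
      by (simp add: complex_eq_iff power2_eq_square) algebra
    hence "D (Complex 0 s) - D (Complex 1 s) = \<i> * of_real (sinh (2 * pi * s)) * G * (- (2 * \<i> * s * (a * b + a * c + b * c - s\<^sup>2)))"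
      unfolding D0 D1 by (simp only: right_diff_distrib[symmetric])
    also have "\<dots> = G * of_real (2 * s * sinh (2 * pi * s) * (a * b + a * c + b * c - s\<^sup>2))"
      by (simp add: algebra_simps)
    also have "\<dots> = of_real (pi * ?F s)"
      unfolding hahn_weight_eq_sinh G_def by (simp add: field_simps)
    finally show ?thesis .
  qed
  \<comment> \<open>By \<open>hahn_weight_plus1\<close> the second moment is a combination of the
    weights with \<open>a + 1\<close> and \<open>a\<close>, both integrable.\<close>
  have int2: "integrable lborel (\<lambda>s. s\<^sup>2 * hahn_weight a b c s)"
  proof -
    have "integrable lborel (\<lambda>s. hahn_weight (a + 1) b c s - a\<^sup>2 * hahn_weight a b c s)"
      using assms by (intro Bochner_Integration.integrable_diff integrable_mult_right integrable_hahn_weight) auto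
    moreover have "hahn_weight (a + 1) b c s - a\<^sup>2 * hahn_weight a b c s = s\<^sup>2 * hahn_weight a b c s" for s
      using assms by (simp add: hahn_weight_plus1 distrib_right)
    ultimately show ?thesis by (simp only:)
  qed
  have "(LINT s|lborel. D (Complex 0 s) - D (Complex 1 s)) = 0"
    using shift by (subst Bochner_Integration.integral_diff) auto
  hence "(LINT s|lborel. ?F s) = 0"
    unfolding D integral_complex_of_real by simp
  also have "(LINT s|lborel. ?F s) = (LINT s|lborel. (a * b + a * c + b * c) * hahn_weight a b c s - s\<^sup>2 * hahn_weight a b c s)"
    by (simp add: algebra_simps)
  also have "\<dots> = (a * b + a * c + b * c) * hahn_integral a b c - (LINT s|lborel. s\<^sup>2 * hahn_weight a b c s)"
    unfolding hahn_integral_def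
    using int2 integrable_hahn_weight[OF assms] by (subst Bochner_Integration.integral_diff) auto
  finally have "(LINT s|lborel. s\<^sup>2 * hahn_weight a b c s) = (a * b + a * c + b * c) * hahn_integral a b c" by simp
  moreover have "hahn_integral (a + 1) b c = (LINT s|lborel. a\<^sup>2 * hahn_weight a b c s + s\<^sup>2 * hahn_weight a b c s)"
    unfolding hahn_integral_def hahn_weight_plus1[OF assms(1)] distrib_right ..
  moreover have "\<dots> = a\<^sup>2 * hahn_integral a b c + (LINT s|lborel. s\<^sup>2 * hahn_weight a b c s)"
    unfolding hahn_integral_def
    using int2 integrable_hahn_weight[OF assms] by (subst Bochner_Integration.integral_add) auto
  \<comment> \<open>Here a^2 + ab + ac + bc = (a + b)(a + c).\<close>
  ultimately show ?thesis by (simp add: algebra_simps power2_eq_square)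
qed

text \<open>For n > 0 the quotient is exactly Gamma x divided by Euler's sequence
  \<open>Gamma_series'\<close>, and that sequence tends to Gamma x.\<close>

lemma Gamma_shift_asymp:
  fixes x :: real
  assumes "0 < x"
  shows "(\<lambda>n. Gamma (x + real n) / (fact (n - 1) * real n powr x)) \<longlonglongrightarrow> 1"
proof -
  have "(\<lambda>n. Gamma x / Gamma_series' x n) \<longlonglongrightarrow> Gamma x / Gamma x"
    using Gamma_real_pos[OF assms] by (intro tendsto_intros Gamma_series'_LIMSEQ) auto
  moreover have "Gamma x / Gamma_series' x n = Gamma (x + real n) / (fact (n - 1) * real n powr x)" if "n > 0" for n
  proof -
    have "x \<notin> \<int>\<^sub>\<le>\<^sub>0" using assms by (auto elim!: nonpos_Ints_cases)
    thus ?thesis using that Gamma_real_pos[OF assms] pochhammer_Gamma[of x n]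
      by (simp add: Gamma_series'_def powr_def)
  qed
  ultimately show ?thesis using Gamma_real_pos[OF assms]
    by (auto intro: Lim_transform_eventually eventually_mono[OF eventually_gt_at_top[of 0]])
qed

section \<open>Periodicity and monotonicity of the normalised total mass\<close>

definition hahn_ratio :: "real \<Rightarrow> real \<Rightarrow> real \<Rightarrow> real" where
  "hahn_ratio a b c = hahn_integral a b c / (Gamma (a + b) * Gamma (a + c) * Gamma (b + c))"

lemma hahn_ratio_plus1:
  assumes "0 < a" "0 < b" "0 < c"
  shows "hahn_ratio (a + 1) b c = hahn_ratio a b c"
proof -
  have "Gamma (a + 1 + b) = (a + b) * Gamma (a + b)" "Gamma (a + 1 + c) = (a + c) * Gamma (a + c)"
    using Gamma_plus1[of "a + b"] Gamma_plus1[of "a + c"] assms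
    by (auto simp: add_ac pos_notin_nonpos_Ints)
  thus ?thesis using assms by (simp add: hahn_ratio_def hahn_integral_plus1)
qed

text \<open>
  The integral divided by \<open>\<Gamma>(a)\<^sup>2\<close> increases with \<open>a\<close>, and \<open>q\<close> is the same quotient for the right
  hand side; since \<open>q (a + n) / q (a' + n) \<longlonglongrightarrow> 1\<close>, the periodic ratio is monotone.
\<close>

lemma hahn_ratio_le:
  assumes "0 < a" "0 < b" "0 < c" "a \<le> a'"
  shows "hahn_ratio a b c \<le> hahn_ratio a' b c"
proof -
  \<comment> \<open>The factor Gamma(b + c) is left out because it does not depend on x. The
    exponents combine to q (x + n) ~ n^(b + c), a growth independent of x, so that quotients of q at
    shifted points tend to 1.\<close>
  define q where "q = (\<lambda>x. Gamma (x + b) * Gamma (x + c) / (Gamma x)\<^sup>2)"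
  have q: "(\<lambda>n. q (x + real n) / real n powr (b + c)) \<longlonglongrightarrow> 1" if x: "0 < x" for x
  proof -
    define g where "g = (\<lambda>x n. Gamma (x + real n) / (fact (n - 1) * real n powr x))"
    have "(\<lambda>n. g (x + b) n * g (x + c) n / (g x n)\<^sup>2) \<longlonglongrightarrow> 1 * 1 / 1\<^sup>2"
      using assms x unfolding g_def by (intro tendsto_mult tendsto_divide tendsto_power Gamma_shift_asymp) auto
    moreover have "g (x + b) n * g (x + c) n / (g x n)\<^sup>2 = q (x + real n) / real n powr (b + c)" if "n > 0" for n
    proof -
      have "Gamma (x + real n) > 0" using x by (intro Gamma_real_pos) auto
      thus ?thesis using that
        by (simp add: g_def q_def powr_add power2_eq_square add_ac field_simps)
    qed
    ultimately show ?thesis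
      by (auto intro: Lim_transform_eventually eventually_mono[OF eventually_gt_at_top[of 0]])
  qed
  have per: "hahn_ratio (x + real n) b c = hahn_ratio x b c" if "0 < x" for x n
    using that assms by (induction n) (auto simp: hahn_ratio_plus1 add.assoc[symmetric] add.commute[of 1])
  have mono: "hahn_ratio x b c * q x \<le> hahn_ratio x' b c * q x'" if "0 < x" "x \<le> x'" for x x'
  proof -
    have eq: "hahn_ratio x b c * q x = hahn_integral x b c / (Gamma x)\<^sup>2 / Gamma (b + c)" if "0 < x" for x
    proof -
      have "Gamma (x + b) > 0" "Gamma (x + c) > 0" "Gamma x > 0" using assms that by (auto intro: Gamma_real_pos)
      thus ?thesis by (simp add: hahn_ratio_def q_def)
    qed
    have "hahn_integral x b c / (Gamma x)\<^sup>2 = (LINT s|lborel. hahn_weight x b c s / (Gamma x)\<^sup>2)"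
      by (simp add: hahn_integral_def)
    also have "\<dots> \<le> (LINT s|lborel. hahn_weight x' b c s / (Gamma x')\<^sup>2)"
    proof (rule integral_mono)
      fix s
      have "(norm (Gamma (Complex x s)) / Gamma x)\<^sup>2 \<le> (norm (Gamma (Complex x' s)) / Gamma x')\<^sup>2"
        using that Gamma_real_pos[of x] by (intro power_mono norm_Gamma_ratio_mono) auto
      from mult_right_mono[OF this, of "(norm (Gamma (Complex b s) * Gamma (Complex c s) / Gamma (Complex 0 (2 * s))))\<^sup>2"]
      show "hahn_weight x b c s / (Gamma x)\<^sup>2 \<le> hahn_weight x' b c s / (Gamma x')\<^sup>2"
        by (simp add: hahn_weight_def norm_mult norm_divide power_mult_distrib power_divide mult_ac)
    qed (use assms that in \<open>auto intro!: integrable_hahn_weight\<close>)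
    also have "\<dots> = hahn_integral x' b c / (Gamma x')\<^sup>2"
      by (simp add: hahn_integral_def)
    finally have "hahn_integral x b c / (Gamma x)\<^sup>2 / Gamma (b + c) \<le> hahn_integral x' b c / (Gamma x')\<^sup>2 / Gamma (b + c)"
      using assms by (intro divide_right_mono) (auto intro!: less_imp_le Gamma_real_pos)
    thus ?thesis using that by (simp add: eq)
  qed
  show ?thesis
  proof (rule LIMSEQ_le)
    let ?Q = "\<lambda>x n. q (x + real n) / real n powr (b + c)"
    show "(\<lambda>n. hahn_ratio a b c * ?Q a n) \<longlonglongrightarrow> hahn_ratio a b c"
      using tendsto_mult[OF tendsto_const q[OF assms(1)]] by simp
    show "(\<lambda>n. hahn_ratio a' b c * ?Q a' n) \<longlonglongrightarrow> hahn_ratio a' b c"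
      using tendsto_mult[OF tendsto_const q[of a']] assms by simp
    have "hahn_ratio a b c * ?Q a n \<le> hahn_ratio a' b c * ?Q a' n" for n
      using divide_right_mono[OF mono[of "a + real n" "a' + real n"], of "real n powr (b + c)"] per[of a n] per[of a' n] assms
      by simp
    thus "\<exists>N. \<forall>n\<ge>N. hahn_ratio a b c * ?Q a n \<le> hahn_ratio a' b c * ?Q a' n" by blast
  qed
qed

text \<open>A monotone function of period 1 is constant: an integer shift puts y above x, so each
  value bounds the other.\<close>

lemma hahn_ratio_const:
  assumes "0 < a" "0 < b" "0 < c" "0 < a'"
  shows "hahn_ratio a b c = hahn_ratio a' b c"
proof -
  have le: "hahn_ratio x b c \<le> hahn_ratio y b c" if "0 < x" "0 < y" for x y
  proof -
    obtain n :: nat where n: "x \<le> y + real n" using real_arch_simple[of "x - y"] by (auto simp: algebra_simps)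
    have "hahn_ratio (y + real n) b c = hahn_ratio y b c"
      using that assms by (induction n) (auto simp: hahn_ratio_plus1 add.assoc[symmetric] add.commute[of 1])
    thus ?thesis using hahn_ratio_le[OF that(1) assms(2,3) n] by simp
  qed
  show ?thesis using le[of a a'] le[of a' a] assms by simp
qed

text \<open>Both moduli are elementary by reflection: |Gamma(1/2 + is)|^2 = pi / cosh(pi s) and
  |Gamma(1 + is)|^2 sinh(pi s) = pi s. The latter is kept as a product so that s = 0 is covered; the
  factor sinh(pi s) is supplied by the double-angle formula for sinh(2 pi s).\<close>

lemma hahn_weight_half_half_1: "hahn_weight (1/2) (1/2) 1 s = 4 * pi\<^sup>2 * (s\<^sup>2 / cosh (pi * s))"
proof -
  have *: "(norm (Gamma (Complex 1 s)))\<^sup>2 * sinh (pi * s) = pi * s"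
  proof -
    have "complex_of_real ((norm (Gamma (Complex 1 s)))\<^sup>2) = Gamma (Complex 1 s) * Gamma (Complex 1 (- s))"
      by (simp only: complex_norm_square cnj_Gamma complex_cnj)
    also have "\<dots> * of_real (sinh (pi * s)) = of_real (pi * s)"
    proof (cases "s = 0")
      case False
      hence ni: "Complex 0 s \<notin> \<int>\<^sub>\<le>\<^sub>0" by (auto elim!: nonpos_Ints_cases simp: complex_eq_iff)
      have 1: "Complex 1 s = Complex 0 s + 1" "Complex 1 (- s) = 1 - Complex 0 s" by (auto simp: complex_eq_iff)
      have 2: "of_real pi * Complex 0 s = \<i> * of_real (pi * s)" by (simp add: complex_eq_iff)
      have "\<i> * sinh (of_real (pi * s)) = sin (\<i> * of_real (pi * s))" unfolding sinh_conv_sin by simp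
      hence sn: "sin (of_real pi * Complex 0 s) = \<i> * of_real (sinh (pi * s))" unfolding 2 by (simp only: sinh_of_real)
      have "sinh (pi * s) \<noteq> 0" using False by simp
      have "Gamma (Complex 1 s) * Gamma (Complex 1 (- s)) = Complex 0 s * (Gamma (Complex 0 s) * Gamma (1 - Complex 0 s))"
        unfolding 1 Gamma_plus1[OF ni] by simp
      also have "\<dots> = Complex 0 s * of_real pi / (\<i> * of_real (sinh (pi * s)))"
        unfolding Gamma_reflection_complex sn by simp
      also have "\<dots> * of_real (sinh (pi * s)) = Complex 0 s * of_real pi / \<i>"
        using \<open>sinh (pi * s) \<noteq> 0\<close> by simp
      also have "\<dots> = of_real (pi * s)" by (simp add: complex_eq_iff)
      finally show ?thesis .
    qed simp
    finally show ?thesis by (simp only: of_real_mult[symmetric] of_real_eq_iff)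
  qed
  have "hahn_weight (1/2) (1/2) 1 s = (pi / cosh (pi * s)) * (pi / cosh (pi * s)) * ((norm (Gamma (Complex 1 s)))\<^sup>2 * (2 * s * (2 * sinh (pi * s) * cosh (pi * s)) / pi))"
    unfolding hahn_weight_eq_sinh norm_mult power_mult_distrib norm_Gamma_half
    using sinh_double[of "pi * s"] by (simp add: mult_ac)
  also have "\<dots> = (pi / cosh (pi * s)) * (pi / cosh (pi * s)) * (4 * s * cosh (pi * s) / pi) * ((norm (Gamma (Complex 1 s)))\<^sup>2 * sinh (pi * s))"
    by simp
  also have "\<dots> = 4 * pi\<^sup>2 * (s\<^sup>2 / cosh (pi * s))"
    unfolding * by (simp add: power2_eq_square field_simps)
  finally show ?thesis .
qed

lemma integral_sech:
  "integrable lborel (\<lambda>s. 1 / cosh (pi * s))" "(LINT s|lborel. 1 / cosh (pi * s)) = 1"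
proof -
  have lim: "((\<lambda>s. 2 / pi * arctan (exp (pi * s))) \<longlongrightarrow> 1) at_top"
       "((\<lambda>s. 2 / pi * arctan (exp (pi * s))) \<longlongrightarrow> 0) at_bot"
    by real_asymp+
  have deriv: "DERIV (\<lambda>s. 2 / pi * arctan (exp (pi * s))) x :> 1 / cosh (pi * x)" for x
  proof -
    have "1 + (exp (pi * x))\<^sup>2 = 2 * cosh (pi * x) * exp (pi * x)"
      by (simp add: cosh_def exp_minus power2_eq_square field_simps)
    thus ?thesis by (auto intro!: derivative_eq_intros simp: divide_simps) 
  qed
  have "set_integrable lborel (einterval (-\<infinity>) \<infinity>) (\<lambda>s. 1 / cosh (pi * s))"
    and *: "(LBINT s=-\<infinity>..\<infinity>. 1 / cosh (pi * s)) = 1 - 0"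
    using lim by (intro interval_integral_FTC_nonneg[where F="\<lambda>s. 2 / pi * arctan (exp (pi * s))" and A=0 and B=1] deriv;
        auto simp: ereal_tendsto_simps intro!: continuous_intros)+
  thus "integrable lborel (\<lambda>s. 1 / cosh (pi * s))" "(LINT s|lborel. 1 / cosh (pi * s)) = 1"
    by (simp_all add: set_integrable_def interval_lebesgue_integral_def set_lebesgue_integral_def)
qed

text \<open>A second contour shift. The edge values of D are (1/2 - is)^2 and -(1/2 + is)^2 times pi
  / cosh(pi s), and their difference (1/2 - 2 s^2) pi / cosh(pi s) has integral 0. So the second
  moment of 1 / cosh(pi s) is a quarter of its integral, which is 1.\<close>

lemma hahn_integral_base: "hahn_integral (1/2) (1/2) 1 = pi\<^sup>2"
proof -
  define D where "D = (\<lambda>z :: complex. (1/2 - z) * (Gamma (1/2 + z) * Gamma (3/2 - z)))"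
  obtain K where K: "K > 0" "\<And>x y. 1/4 \<le> x \<Longrightarrow> x \<le> 2 \<Longrightarrow> norm (Gamma (Complex x y)) \<le> K * exp (- (pi/4) * \<bar>y\<bar>)"
    using Gamma_exp_decay[of "1/4" "pi/4" 2] by auto
  obtain M where M: "M > 0" "\<And>t. t \<ge> 0 \<Longrightarrow> (1 + t) ^ 1 \<le> M * exp (pi/4 * t)"
    using poly_le_exp[of "pi/4" 1] by auto
  have nonpos: "z \<notin> \<int>\<^sub>\<le>\<^sub>0" if "Re z > 0" for z :: complex
    using that by (auto elim!: nonpos_Ints_cases)
  have hol: "D holomorphic_on {z. - (1/4) < Re z \<and> Re z < 1 + 1/4}"
    unfolding D_def by (intro holomorphic_intros) (auto intro!: nonpos)
  have bnd: "norm (D (Complex x y)) \<le> (M * K\<^sup>2) * exp (- (pi/4) * \<bar>y\<bar>)" if x: "0 \<le> x" "x \<le> 1" for x y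
  proof -
    have "norm (1/2 - Complex x y) \<le> M * exp (pi/4 * \<bar>y\<bar>)"
      using cmod_le[of "1/2 - Complex x y"] M(2)[of "\<bar>y\<bar>"] x by (auto simp: abs_if split: if_splits)
    moreover have "norm (Gamma (1/2 + Complex x y)) \<le> K * exp (- (pi/4) * \<bar>y\<bar>)"
      using K(2)[of "1/2 + x" y] x by (simp add: Complex_eq add_ac)
    moreover have "norm (Gamma (3/2 - Complex x y)) \<le> K * exp (- (pi/4) * \<bar>y\<bar>)"
      using K(2)[of "3/2 - x" "-y"] x by (simp add: Complex_eq algebra_simps)
    ultimately have "norm (D (Complex x y)) \<le> (M * exp (pi/4 * \<bar>y\<bar>)) * ((K * exp (- (pi/4) * \<bar>y\<bar>)) * (K * exp (- (pi/4) * \<bar>y\<bar>)))"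
      unfolding D_def norm_mult using M(1) K(1) by (intro mult_mono) auto
    also have "\<dots> = (M * K\<^sup>2) * (exp (pi/4 * \<bar>y\<bar>) * exp (- (pi/4) * \<bar>y\<bar>) * exp (- (pi/4) * \<bar>y\<bar>))"
      by (simp add: power2_eq_square)
    also have "exp (pi/4 * \<bar>y\<bar>) * exp (- (pi/4) * \<bar>y\<bar>) * exp (- (pi/4) * \<bar>y\<bar>) = exp (- (pi/4) * \<bar>y\<bar>)"
      by (simp flip: exp_add)
    finally show ?thesis .
  qed
  note shift = integral_strip_shift[OF hol _ _ bnd]
  have D: "D (Complex 0 s) - D (Complex 1 s) = of_real (pi * ((1/2) * (1 / cosh (pi * s)) - 2 * (s\<^sup>2 / cosh (pi * s))))" for s
  proof -
    have sq: "Gamma (Complex (1/2) s) * Gamma (Complex (1/2) (- s)) = of_real (pi / cosh (pi * s))"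
      using norm_Gamma_half[of s] complex_norm_square[of "Gamma (Complex (1/2) s)"] by (simp only: cnj_Gamma complex_cnj)
    have e: "1/2 + Complex 0 s = Complex (1/2) s" "3/2 - Complex 0 s = Complex (1/2 + 1) (- s)"
       "1/2 + Complex 1 s = Complex (1/2 + 1) s" "3/2 - Complex 1 s = Complex (1/2) (- s)"
      by (simp_all add: complex_eq_iff)
    have g: "Gamma (Complex (1/2 + 1) y) = Complex (1/2) y * Gamma (Complex (1/2) y)" for y
      by (rule Gamma_Complex_plus1) simp
    have "D (Complex 0 s) - D (Complex 1 s) = ((1/2 - Complex 0 s) * Complex (1/2) (- s) - (1/2 - Complex 1 s) * Complex (1/2) s)
       * (Gamma (Complex (1/2) s) * Gamma (Complex (1/2) (- s)))"
      unfolding D_def e g by (simp add: algebra_simps)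
    also have "(1/2 - Complex 0 s) * Complex (1/2) (- s) - (1/2 - Complex 1 s) * Complex (1/2) s = of_real (1/2 - 2 * s\<^sup>2)"
      by (simp add: complex_eq_iff power2_eq_square)
    also have "of_real (1/2 - 2 * s\<^sup>2) * (Gamma (Complex (1/2) s) * Gamma (Complex (1/2) (- s))) = complex_of_real ((1/2 - 2 * s\<^sup>2) * (pi / cosh (pi * s)))"
      unfolding sq by (simp only: of_real_mult)
    also have "(1/2 - 2 * s\<^sup>2) * (pi / cosh (pi * s)) = pi * ((1/2) * (1 / cosh (pi * s)) - 2 * (s\<^sup>2 / cosh (pi * s)))"
      by (simp add: algebra_simps diff_divide_distrib)
    finally show ?thesis .
  qed
  have int2: "integrable lborel (\<lambda>s. s\<^sup>2 / cosh (pi * s))"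
  proof -
    have "integrable lborel (\<lambda>s. hahn_weight (1/2) (1/2) 1 s / (4 * pi\<^sup>2))"
      by (intro integrable_divide integrable_hahn_weight) auto
    thus ?thesis by (simp add: hahn_weight_half_half_1)
  qed
  have "(LINT s|lborel. D (Complex 0 s) - D (Complex 1 s)) = 0"
    using shift by (subst Bochner_Integration.integral_diff) auto
  hence "(LINT s|lborel. (1/2) * (1 / cosh (pi * s)) - 2 * (s\<^sup>2 / cosh (pi * s))) = 0"
    unfolding D integral_complex_of_real by simp
  also have "(LINT s|lborel. (1/2) * (1 / cosh (pi * s)) - 2 * (s\<^sup>2 / cosh (pi * s))) = 1/2 - 2 * (LINT s|lborel. s\<^sup>2 / cosh (pi * s))"
  proof (subst Bochner_Integration.integral_diff)
    show "integrable lborel (\<lambda>s. (1/2) * (1 / cosh (pi * s)))" "integrable lborel (\<lambda>s. 2 * (s\<^sup>2 / cosh (pi * s)))"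
      by (intro integrable_mult_right integral_sech(1) int2)+
  qed (simp only: integral_mult_right_zero integral_sech)
  finally have "(LINT s|lborel. s\<^sup>2 / cosh (pi * s)) = 1/4" by simp
  thus ?thesis by (simp add: hahn_integral_def hahn_weight_half_half_1 integral_mult_right_zero del: times_divide_eq_right)
qed

text \<open>\<open>hahn_ratio_const\<close> varies the first parameter only; the symmetry of the
  quotient moves each parameter in turn to that position.\<close>

theorem hahn_integral_eq:
  assumes "0 < a" "0 < b" "0 < c"
  shows "hahn_integral a b c = 4 * pi * (Gamma (a + b) * Gamma (a + c) * Gamma (b + c))"
proof -
  have comm: "hahn_ratio x y z = hahn_ratio y x z" "hahn_ratio x y z = hahn_ratio x z y" for x y z
    unfolding hahn_ratio_def hahn_integral_commute(1)[of x y z] hahn_integral_commute(2)[of x z y]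
    by (simp_all add: add.commute mult_ac)
  have "hahn_ratio a b c = hahn_ratio (1/2) b c" using assms by (intro hahn_ratio_const) auto
  also have "\<dots> = hahn_ratio b (1/2) c" by (rule comm)
  also have "\<dots> = hahn_ratio (1/2) (1/2) c" using assms by (intro hahn_ratio_const) auto
  also have "\<dots> = hahn_ratio (1/2) c (1/2)" by (rule comm)
  also have "\<dots> = hahn_ratio c (1/2) (1/2)" by (rule comm)
  also have "\<dots> = hahn_ratio 1 (1/2) (1/2)" using assms by (intro hahn_ratio_const) auto
  also have "\<dots> = hahn_ratio (1/2) (1/2) 1" using comm by metis
  also have "\<dots> = 4 * pi"
  proof -
    have g: "Gamma (3/2 :: real) = sqrt pi / 2"
      using Gamma_plus1[of "1/2 :: real"] pos_notin_nonpos_Ints[of "1/2"] Gamma_one_half_real by simp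
    have e: "1/2 + 1/2 = (1::real)" "1/2 + 1 = (3/2::real)" by auto
    show ?thesis unfolding hahn_ratio_def hahn_integral_base e g by (simp add: power2_eq_square)
  qed
  finally have *: "hahn_ratio a b c = 4 * pi" .
  have "Gamma (a + b) > 0" "Gamma (a + c) > 0" "Gamma (b + c) > 0"
    using assms by (auto intro: Gamma_real_pos)
  thus ?thesis using * by (simp add: hahn_ratio_def field_simps)
qed

section \<open>Square-integrable functions\<close>

lemma L2_spaceI: "h \<in> borel_measurable M \<Longrightarrow> integrable M (\<lambda>x. (norm (h x))\<^sup>2) \<Longrightarrow> h \<in> L2_space M"
  by (simp add: L2_space_def)

lemma L2_spaceD:
  assumes "h \<in> L2_space M"
  shows "h \<in> borel_measurable M" "integrable M (\<lambda>x. (norm (h x))\<^sup>2)"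
  using assms by (auto simp: L2_space_def)

lemma borel_measurable_cnj [measurable]:
  "f \<in> borel_measurable M \<Longrightarrow> (\<lambda>x. cnj (f x)) \<in> borel_measurable M"
  by (rule borel_measurable_continuous_on[where f=cnj]) (auto intro: continuous_intros)

lemma integrable_L2_mult:
  assumes "h \<in> L2_space M" "k \<in> L2_space M"
  shows "integrable M (\<lambda>x. h x * cnj (k x))"
proof (rule Bochner_Integration.integrable_bound)
  show "integrable M (\<lambda>x. (norm (h x))\<^sup>2 + (norm (k x))\<^sup>2)"
    using assms by (auto simp: L2_space_def)
  have "norm (h x * cnj (k x)) \<le> (norm (h x))\<^sup>2 + (norm (k x))\<^sup>2" for x
    using sum_squares_bound[of "norm (h x)" "norm (k x)"] zero_le_power2[of "norm (h x)"] zero_le_power2[of "norm (k x)"]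
      mult_nonneg_nonneg[of "norm (h x)" "norm (k x)"]
    by (simp only: norm_mult complex_mod_cnj)
  thus "AE x in M. norm (h x * cnj (k x)) \<le> norm ((norm (h x))\<^sup>2 + (norm (k x))\<^sup>2)" by simp
  have [measurable]: "h \<in> borel_measurable M" "k \<in> borel_measurable M"
    using assms by (auto simp: L2_space_def)
  show "(\<lambda>x. h x * cnj (k x)) \<in> borel_measurable M" by measurable
qed

lemma L2_space_scale: "h \<in> L2_space M \<Longrightarrow> (\<lambda>x. \<alpha> * h x) \<in> L2_space M"
  by (auto simp: L2_space_def norm_mult power_mult_distrib)

lemma L2_space_add:
  assumes "h \<in> L2_space M" "k \<in> L2_space M"
  shows "(\<lambda>x. h x + k x) \<in> L2_space M"
proof (rule L2_spaceI)
  have [measurable]: "h \<in> borel_measurable M" "k \<in> borel_measurable M"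
    using assms by (auto simp: L2_space_def)
  show "(\<lambda>x. h x + k x) \<in> borel_measurable M" by measurable
  show "integrable M (\<lambda>x. (norm (h x + k x))\<^sup>2)"
  proof (rule Bochner_Integration.integrable_bound)
    show "integrable M (\<lambda>x. 2 * (norm (h x))\<^sup>2 + 2 * (norm (k x))\<^sup>2)"
      using assms by (auto simp: L2_space_def)
    have "(norm (h x + k x))\<^sup>2 \<le> 2 * (norm (h x))\<^sup>2 + 2 * (norm (k x))\<^sup>2" for x
      using power_mono[OF norm_triangle_ineq[of "h x" "k x"], of 2] sum_squares_bound[of "norm (h x)" "norm (k x)"]
      by (simp add: power2_sum)
    thus "AE x in M. norm ((norm (h x + k x))\<^sup>2) \<le> norm (2 * (norm (h x))\<^sup>2 + 2 * (norm (k x))\<^sup>2)" by simp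
  qed measurable
qed

lemma L2_space_diff:
  assumes "h \<in> L2_space M" "k \<in> L2_space M"
  shows "(\<lambda>x. h x - k x) \<in> L2_space M"
  using L2_space_add[OF assms(1) L2_space_scale[OF assms(2), of "-1"]] by simp

lemma L2_space_sum:
  "finite A \<Longrightarrow> (\<And>i. i \<in> A \<Longrightarrow> f i \<in> L2_space M) \<Longrightarrow> (\<lambda>x. \<Sum>i\<in>A. f i x) \<in> L2_space M"
  by (induction A rule: finite_induct) (auto simp: L2_space_add L2_spaceI)

lemma L2_inner_self: "L2_inner M h h = of_real (LINT x|M. (norm (h x))\<^sup>2)"
  by (simp add: L2_inner_def complex_norm_square[symmetric] integral_complex_of_real flip: of_real_power)

definition L2_norm :: "'a measure \<Rightarrow> ('a \<Rightarrow> complex) \<Rightarrow> real" where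
  "L2_norm M h = sqrt (LINT x|M. (norm (h x))\<^sup>2)"

lemma L2_dist_norm: "L2_dist M h k = L2_norm M (\<lambda>x. h x - k x)"
  by (simp add: L2_dist_def L2_norm_def L2_inner_self)

lemma L2_norm_nonneg [simp]: "L2_norm M h \<ge> 0"
  by (simp add: L2_norm_def)

lemma L2_norm_sq: "(L2_norm M h)\<^sup>2 = (LINT x|M. (norm (h x))\<^sup>2)"
  by (simp add: L2_norm_def)

lemma L2_inner_self_norm: "L2_inner M h h = of_real ((L2_norm M h)\<^sup>2)"
  by (simp add: L2_inner_self L2_norm_sq)

lemma L2_inner_add_left:
  assumes "f \<in> L2_space M" "g \<in> L2_space M" "h \<in> L2_space M"
  shows "L2_inner M (\<lambda>x. f x + g x) h = L2_inner M f h + L2_inner M g h"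
  unfolding L2_inner_def distrib_right
  using assms by (intro Bochner_Integration.integral_add integrable_L2_mult)

lemma L2_inner_scale_left: "L2_inner M (\<lambda>x. \<alpha> * f x) h = \<alpha> * L2_inner M f h"
  by (simp add: L2_inner_def mult.assoc)

lemma L2_inner_cnj: "cnj (L2_inner M f g) = L2_inner M g f"
  unfolding L2_inner_def by (subst Bochner_Integration.integral_cnj[symmetric]) (simp add: mult.commute)

lemma L2_inner_add_right:
  assumes "f \<in> L2_space M" "g \<in> L2_space M" "h \<in> L2_space M"
  shows "L2_inner M h (\<lambda>x. f x + g x) = L2_inner M h f + L2_inner M h g"
  unfolding L2_inner_def complex_cnj_add distrib_left
  using assms by (intro Bochner_Integration.integral_add integrable_L2_mult)

lemma L2_inner_scale_right: "L2_inner M h (\<lambda>x. \<alpha> * f x) = cnj \<alpha> * L2_inner M h f"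
  unfolding L2_inner_def by (simp add: mult.left_commute)

lemma L2_inner_diff_left:
  assumes "f \<in> L2_space M" "g \<in> L2_space M" "h \<in> L2_space M"
  shows "L2_inner M (\<lambda>x. f x - g x) h = L2_inner M f h - L2_inner M g h"
  using L2_inner_add_left[OF assms(1) L2_space_scale[OF assms(2), of "-1"] assms(3)] L2_inner_scale_left[of M "-1" g h]
  by simp

lemma L2_inner_sum_left:
  "finite A \<Longrightarrow> (\<And>i. i \<in> A \<Longrightarrow> f i \<in> L2_space M) \<Longrightarrow> h \<in> L2_space M \<Longrightarrow>
     L2_inner M (\<lambda>x. \<Sum>i\<in>A. f i x) h = (\<Sum>i\<in>A. L2_inner M (f i) h)"
proof (induction A rule: finite_induct)
  case (insert i A)
  thus ?case using L2_inner_add_left[of "f i" M "\<lambda>x. \<Sum>i\<in>A. f i x" h] L2_space_sum[of A f M] by simp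
qed (simp add: L2_inner_def)

lemma L2_inner_sum_right:
  assumes "finite A" "\<And>i. i \<in> A \<Longrightarrow> f i \<in> L2_space M" "h \<in> L2_space M"
  shows "L2_inner M h (\<lambda>x. \<Sum>i\<in>A. f i x) = (\<Sum>i\<in>A. L2_inner M h (f i))"
  by (subst L2_inner_cnj[symmetric], subst L2_inner_sum_left[OF assms]) (simp_all add: L2_inner_cnj cnj_sum)

lemma L2_Cauchy_Schwarz:
  assumes "f \<in> L2_space M" "g \<in> L2_space M"
  shows "norm (L2_inner M f g) \<le> L2_norm M f * L2_norm M g"
proof -
  have [measurable]: "f \<in> borel_measurable M" "g \<in> borel_measurable M"
    using assms by (auto simp: L2_space_def)
  have sq: "(\<integral>\<^sup>+x. (ennreal (norm (h x)))\<^sup>2 \<partial>M) = ennreal ((L2_norm M h)\<^sup>2)" if "h \<in> L2_space M" for h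
    using that unfolding L2_norm_sq by (simp add: ennreal_power nn_integral_eq_integral L2_space_def)
  have I: "integrable M (\<lambda>x. norm (f x * cnj (g x)))" using integrable_L2_mult[OF assms] by simp
  have "(\<integral>\<^sup>+x. ennreal (norm (f x)) * ennreal (norm (g x)) \<partial>M)\<^sup>2
     \<le> (\<integral>\<^sup>+x. (ennreal (norm (f x)))\<^sup>2 \<partial>M) * (\<integral>\<^sup>+x. (ennreal (norm (g x)))\<^sup>2 \<partial>M)"
    by (rule Cauchy_Schwarz_nn_integral) measurable
  also have "(\<integral>\<^sup>+x. ennreal (norm (f x)) * ennreal (norm (g x)) \<partial>M) = (\<integral>\<^sup>+x. ennreal (norm (f x * cnj (g x))) \<partial>M)"
    by (simp add: norm_mult ennreal_mult)
  also have "\<dots> = ennreal (LINT x|M. norm (f x * cnj (g x)))"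
    by (rule nn_integral_eq_integral[OF I]) auto
  finally have "(LINT x|M. norm (f x * cnj (g x)))\<^sup>2 \<le> (L2_norm M f * L2_norm M g)\<^sup>2"
    unfolding sq[OF assms(1)] sq[OF assms(2)]
    by (simp add: ennreal_power ennreal_mult[symmetric] power_mult_distrib)
  hence "(LINT x|M. norm (f x * cnj (g x))) \<le> L2_norm M f * L2_norm M g"
    by (rule power2_le_imp_le) auto
  moreover have "norm (L2_inner M f g) \<le> (LINT x|M. norm (f x * cnj (g x)))"
    unfolding L2_inner_def by (rule integral_norm_bound)
  ultimately show ?thesis by simp
qed

lemma L2_norm_triangle:
  assumes "f \<in> L2_space M" "g \<in> L2_space M"
  shows "L2_norm M (\<lambda>x. f x + g x) \<le> L2_norm M f + L2_norm M g"
proof (rule power2_le_imp_le)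
  have fg: "(\<lambda>x. f x + g x) \<in> L2_space M" by (rule L2_space_add[OF assms])
  have "of_real ((L2_norm M (\<lambda>x. f x + g x))\<^sup>2) = L2_inner M f f + L2_inner M g g + (L2_inner M f g + cnj (L2_inner M f g))"
    unfolding L2_inner_self_norm[symmetric] L2_inner_add_left[OF assms fg] L2_inner_cnj
    by (simp add: L2_inner_add_right assms)
  hence "(L2_norm M (\<lambda>x. f x + g x))\<^sup>2 = (L2_norm M f)\<^sup>2 + (L2_norm M g)\<^sup>2 + 2 * Re (L2_inner M f g)"
    unfolding L2_inner_self_norm complex_add_cnj by (simp only: of_real_add[symmetric] of_real_eq_iff)
  also have "Re (L2_inner M f g) \<le> L2_norm M f * L2_norm M g"
    using L2_Cauchy_Schwarz[OF assms] complex_Re_le_cmod order.trans by blast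
  finally show "(L2_norm M (\<lambda>x. f x + g x))\<^sup>2 \<le> (L2_norm M f + L2_norm M g)\<^sup>2"
    by (simp add: power2_sum)
qed simp

lemma L2_dist_triangle:
  assumes "f \<in> L2_space M" "g \<in> L2_space M" "h \<in> L2_space M"
  shows "L2_dist M f h \<le> L2_dist M f g + L2_dist M g h"
  using L2_norm_triangle[OF L2_space_diff[OF assms(1,2)] L2_space_diff[OF assms(2,3)]]
  by (simp add: L2_dist_norm)

lemma L2_dist_commute: "L2_dist M f g = L2_dist M g f"
  by (simp add: L2_dist_norm L2_norm_def norm_minus_commute)

lemma L2_dist_nonneg [simp]: "L2_dist M f g \<ge> 0"
  by (simp add: L2_dist_norm)

lemma L2_dist_eq_0_AE:
  assumes "f \<in> L2_space M" "g \<in> L2_space M" "L2_dist M f g = 0"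
  shows "AE x in M. f x = g x"
proof -
  have "(LINT x|M. (norm (f x - g x))\<^sup>2) = 0"
    using assms(3) by (simp add: L2_dist_norm L2_norm_def)
  moreover have "integrable M (\<lambda>x. (norm (f x - g x))\<^sup>2)"
    using L2_spaceD(2)[OF L2_space_diff[OF assms(1,2)]] .
  ultimately have "AE x in M. (norm (f x - g x))\<^sup>2 = 0"
    by (subst (asm) integral_nonneg_eq_0_iff_AE) auto
  thus ?thesis by eventually_elim simp
qed

text \<open>Fatou's lemma for the squared norms; membership of the limit comes out together with the
  bound. Only a lower limit enters, so a bound valid from some index on is enough.\<close>

lemma L2_norm_le_Fatou:
  assumes f: "\<And>n. f n \<in> L2_space M" and [measurable]: "g \<in> borel_measurable M"
    and lim: "AE x in M. (\<lambda>n. f n x) \<longlonglongrightarrow> g x" and bnd: "\<forall>\<^sub>F n in sequentially. L2_norm M (f n) \<le> B" and "B \<ge> 0"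
  shows "g \<in> L2_space M" "L2_norm M g \<le> B"
proof -
  have [measurable]: "f n \<in> borel_measurable M" for n using f by (auto simp: L2_space_def)
  have "(\<integral>\<^sup>+x. ennreal ((norm (g x))\<^sup>2) \<partial>M) = (\<integral>\<^sup>+x. liminf (\<lambda>n. ennreal ((norm (f n x))\<^sup>2)) \<partial>M)"
  proof (rule nn_integral_cong_AE)
    show "AE x in M. ennreal ((norm (g x))\<^sup>2) = liminf (\<lambda>n. ennreal ((norm (f n x))\<^sup>2))"
      using lim
    proof eventually_elim
      case (elim x)
      have "(\<lambda>n. ennreal ((norm (f n x))\<^sup>2)) \<longlonglongrightarrow> ennreal ((norm (g x))\<^sup>2)"
        by (intro tendsto_ennrealI tendsto_intros elim)
      thus ?case by (intro lim_imp_Liminf[symmetric]) auto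
    qed
  qed
  also have "\<dots> \<le> liminf (\<lambda>n. \<integral>\<^sup>+x. ennreal ((norm (f n x))\<^sup>2) \<partial>M)"
    by (rule nn_integral_liminf) measurable
  also have "\<dots> \<le> ennreal (B\<^sup>2)"
  proof -
    have "(\<integral>\<^sup>+x. ennreal ((norm (f n x))\<^sup>2) \<partial>M) = ennreal ((L2_norm M (f n))\<^sup>2)" for n
      unfolding L2_norm_sq using f by (intro nn_integral_eq_integral) (auto simp: L2_space_def)
    moreover have "\<forall>\<^sub>F n in sequentially. ennreal ((L2_norm M (f n))\<^sup>2) \<le> ennreal (B\<^sup>2)"
      using bnd by eventually_elim (auto intro!: ennreal_leI power_mono)
    ultimately have "limsup (\<lambda>n. \<integral>\<^sup>+x. ennreal ((norm (f n x))\<^sup>2) \<partial>M) \<le> ennreal (B\<^sup>2)"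
      by (intro Limsup_bounded) simp
    thus ?thesis using Liminf_le_Limsup[of sequentially] order.trans trivial_limit_sequentially by blast
  qed
  finally have le: "(\<integral>\<^sup>+x. ennreal ((norm (g x))\<^sup>2) \<partial>M) \<le> ennreal (B\<^sup>2)" .
  hence I: "integrable M (\<lambda>x. (norm (g x))\<^sup>2)"
    by (intro integrableI_bounded) (auto intro: le_less_trans)
  thus "g \<in> L2_space M" by (intro L2_spaceI) auto
  have "ennreal ((L2_norm M g)\<^sup>2) \<le> ennreal (B\<^sup>2)"
    using le nn_integral_eq_integral[OF I] by (simp add: L2_norm_sq)
  thus "L2_norm M g \<le> B" using \<open>B \<ge> 0\<close> by (simp add: power2_le_iff_abs_le)
qed

text \<open>Along a subsequence with distances at most \<open>2\<^sup>-\<^sup>k\<close> the increments are summable almost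
  everywhere, since \<open>(\<Sum>u\<^sub>k)\<^sup>2 \<le> \<Sum>2\<^sup>-\<^sup>k \<sqdot> \<Sum>2\<^sup>k u\<^sub>k\<^sup>2\<close>; the limit is identified by Fatou.\<close>

theorem L2_complete:
  assumes f: "\<And>n. f n \<in> L2_space M"
    and cauchy: "\<And>e. e > 0 \<Longrightarrow> \<exists>N. \<forall>m\<ge>N. \<forall>n\<ge>N. L2_dist M (f m) (f n) < e"
  obtains h where "h \<in> L2_space M" "(\<lambda>n. L2_dist M (f n) h) \<longlonglongrightarrow> 0"
proof -
  have [measurable]: "f n \<in> borel_measurable M" for n using f by (auto simp: L2_space_def)
  have "\<exists>r. strict_mono (r :: nat \<Rightarrow> nat) \<and> (\<forall>k. \<forall>m\<ge>r k. \<forall>n\<ge>r k. L2_dist M (f m) (f n) < (1/2) ^ k)"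
  proof -
    obtain N where N: "\<And>k m n. m \<ge> N k \<Longrightarrow> n \<ge> N k \<Longrightarrow> L2_dist M (f m) (f n) < (1/2) ^ k"
      using cauchy[of "(1/2) ^ k" for k] by (metis zero_less_divide_1_iff zero_less_numeral zero_less_power)
    \<comment> \<open>Adding all earlier thresholds keeps r k above N k, and the summand k makes r
      strictly increasing.\<close>
    define r where "r = (\<lambda>k. k + (\<Sum>i\<le>k. N i))"
    have "strict_mono r" by (rule strict_mono_Suc_iff[THEN iffD2]) (auto simp: r_def)
    moreover have "N k \<le> r k" for k
      using member_le_sum[of k "{..k}" N] by (simp add: r_def)
    ultimately show ?thesis using N by (meson order.trans)
  qed
  then obtain r where r: "strict_mono r" "\<And>k m n. m \<ge> r k \<Longrightarrow> n \<ge> r k \<Longrightarrow> L2_dist M (f m) (f n) < (1/2) ^ k" by blast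
  define u where "u = (\<lambda>k x. f (r (Suc k)) x - f (r k) x)"
  have uL: "u k \<in> L2_space M" for k unfolding u_def by (intro L2_space_diff f)
  have [measurable]: "u k \<in> borel_measurable M" for k unfolding u_def by measurable
  have nu: "L2_norm M (u k) \<le> (1/2) ^ k" for k
    using r(2)[of k "r (Suc k)" "r k"] strict_mono_less_eq[OF r(1), of k "Suc k"] by (simp add: u_def L2_dist_norm)
  have nn: "(\<integral>\<^sup>+x. ennreal (2 ^ k * (norm (u k x))\<^sup>2) \<partial>M) \<le> ennreal ((1/2) ^ k)" for k
  proof -
    have "(\<integral>\<^sup>+x. ennreal (2 ^ k * (norm (u k x))\<^sup>2) \<partial>M) = ennreal (LINT x|M. 2 ^ k * (norm (u k x))\<^sup>2)"
      using uL by (intro nn_integral_eq_integral) (auto simp: L2_space_def)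
    also have "(LINT x|M. 2 ^ k * (norm (u k x))\<^sup>2) = 2 ^ k * (L2_norm M (u k))\<^sup>2"
      by (simp add: L2_norm_sq)
    also have "\<dots> \<le> 2 ^ k * ((1/2) ^ k)\<^sup>2"
      by (intro mult_left_mono power_mono nu) auto
    also have "\<dots> = (1/2) ^ k" by (simp add: power2_eq_square power_divide)
    finally show ?thesis by (simp add: ennreal_leI)
  qed
  have "(\<integral>\<^sup>+x. (\<Sum>k. ennreal (2 ^ k * (norm (u k x))\<^sup>2)) \<partial>M) = (\<Sum>k. \<integral>\<^sup>+x. ennreal (2 ^ k * (norm (u k x))\<^sup>2) \<partial>M)"
    by (rule nn_integral_suminf) measurable
  also have "\<dots> \<le> (\<Sum>k. ennreal ((1/2) ^ k))" by (intro suminf_le nn) auto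
  also have "\<dots> = ennreal (\<Sum>k. (1/2) ^ k)"
    by (rule suminf_ennreal2) (auto intro: summable_geometric)
  also have "\<dots> < \<infinity>" by simp
  finally have "AE x in M. (\<Sum>k. ennreal (2 ^ k * (norm (u k x))\<^sup>2)) \<noteq> \<infinity>"
    by (intro nn_integral_PInf_AE) auto
  hence conv: "AE x in M. convergent (\<lambda>k. f (r k) x)"
  proof eventually_elim
    case (elim x)
    hence s: "summable (\<lambda>k. 2 ^ k * (norm (u k x))\<^sup>2)"
      by (intro summable_suminf_not_top) auto
    have "summable (\<lambda>k. ((1/2) ^ k + 2 ^ k * (norm (u k x))\<^sup>2) / 2)"
      by (intro summable_divide summable_add s summable_geometric) auto
    hence "summable (\<lambda>k. u k x)"
    proof (rule summable_comparison_test[rotated], intro exI allI impI)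
      fix k
      \<comment> \<open>The termwise form of the estimate: 2 |u| \<le> 2^(-k) + 2^k |u|^2, from a
        square divided by p = 2^k.\<close>
      define p :: real where "p = 2 ^ k"
      have p: "p > 0" "(1/2) ^ k = 1 / p" by (auto simp: p_def power_divide)
      have "0 \<le> (1 - p * norm (u k x))\<^sup>2 / p" using p by simp
      also have "\<dots> = 1 / p - 2 * norm (u k x) + p * (norm (u k x))\<^sup>2"
        using p by (simp add: power2_eq_square field_simps)
      finally show "norm (u k x) \<le> ((1/2) ^ k + 2 ^ k * (norm (u k x))\<^sup>2) / 2" 
        unfolding p(2) p_def[symmetric] by simp
    qed
    hence "convergent (\<lambda>n. \<Sum>k<n. u k x)" by (simp add: summable_iff_convergent)
    moreover have "(\<Sum>k<n. u k x) = f (r n) x - f (r 0) x" for n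
      unfolding u_def by (rule sum_lessThan_telescope)
    ultimately have "convergent (\<lambda>n. (f (r n) x - f (r 0) x) + f (r 0) x)"
      by (intro convergent_add convergent_const) simp
    thus ?case by simp
  qed
  define h where "h = (\<lambda>x. lim (\<lambda>k. f (r k) x))"
  have [measurable]: "h \<in> borel_measurable M" unfolding h_def by measurable
  have lim: "AE x in M. (\<lambda>k. f (r k) x) \<longlonglongrightarrow> h x"
    using conv by eventually_elim (simp add: h_def convergent_LIMSEQ_iff)
  \<comment> \<open>With m fixed, the differences f (r j) - f m have norm at most 2^(-k) for large j
    and converge almost everywhere to h - f m; Fatou passes the bound to the limit.\<close>
  have key: "(\<lambda>x. h x - f m x) \<in> L2_space M \<and> L2_norm M (\<lambda>x. h x - f m x) \<le> (1/2) ^ k" if "m \<ge> r k" for m k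
  proof -
    have "AE x in M. (\<lambda>j. f (r j) x - f m x) \<longlonglongrightarrow> h x - f m x"
      using lim by eventually_elim (intro tendsto_intros)
    moreover have "\<forall>\<^sub>F j in sequentially. L2_norm M (\<lambda>x. f (r j) x - f m x) \<le> (1/2) ^ k"
    proof (rule eventually_sequentiallyI[of k])
      fix j assume "k \<le> j"
      hence "r k \<le> r j" using strict_mono_less_eq[OF r(1)] by simp
      thus "L2_norm M (\<lambda>x. f (r j) x - f m x) \<le> (1/2) ^ k"
        using r(2)[of k "r j" m] that by (simp add: L2_dist_norm)
    qed
    ultimately show ?thesis
      using L2_norm_le_Fatou[of "\<lambda>j x. f (r j) x - f m x" M "\<lambda>x. h x - f m x" "(1/2) ^ k"]
      by (auto intro!: L2_space_diff[OF f f])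
  qed
  have "h \<in> L2_space M"
    using L2_space_add[OF conjunct1[OF key[of 0 "r 0"]] f[of "r 0"]] by simp
  moreover have "(\<lambda>n. L2_dist M (f n) h) \<longlonglongrightarrow> 0"
  proof (rule LIMSEQ_I)
    fix e :: real assume "e > 0"
    then obtain k where k: "(1/2) ^ k < e" using real_arch_pow_inv[of e "1/2"] by auto
    have "norm (L2_dist M (f n) h - 0) < e" if "n \<ge> r k" for n
      using key[OF that] k by (simp add: L2_dist_commute[of M "f n"]) (simp add: L2_dist_norm)
    thus "\<exists>N. \<forall>n\<ge>N. norm (L2_dist M (f n) h - 0) < e" by blast
  qed
  ultimately show ?thesis using that by blast
qed

section \<open>Beta integrals and Gauss's summation theorem\<close>

lemma Re_pos_notin_nonpos_Ints: "Re z > 0 \<Longrightarrow> (z::complex) \<notin> \<int>\<^sub>\<le>\<^sub>0"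
  by (auto elim!: nonpos_Ints_cases)

text \<open>Unlike \<open>powr\<close>, whose value at base 0 is special, this form of \<open>x\<^sup>z\<close> is covered by the measurability prover; it is used for \<open>x > 0\<close> only.\<close>

definition rpow :: "real \<Rightarrow> complex \<Rightarrow> complex" where
  "rpow x z = exp (z * of_real (ln x))"

lemma rpow_nonzero [simp]: "rpow x z \<noteq> 0"
  and rpow_0 [simp]: "rpow x 0 = 1"
  and rpow_add: "rpow x (z + w) = rpow x z * rpow x w"
  and rpow_diff: "rpow x (z - w) = rpow x z / rpow x w"
  and rpow_minus: "rpow x (- z) = 1 / rpow x z"
  by (simp_all add: rpow_def distrib_right left_diff_distrib exp_add exp_diff exp_minus inverse_eq_divide)

lemma powr_eq_rpow: "0 < x \<Longrightarrow> of_real x powr z = rpow x z"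
  by (simp add: powr_def rpow_def Ln_of_real)

lemma norm_rpow: "0 < x \<Longrightarrow> norm (rpow x z) = x powr Re z"
  by (simp add: rpow_def powr_def)

lemma rpow_of_real: "0 < x \<Longrightarrow> rpow x (of_real r) = of_real (x powr r)"
  by (simp add: rpow_def powr_def exp_of_real flip: of_real_mult)

lemma rpow_mult: "0 < x \<Longrightarrow> 0 < y \<Longrightarrow> rpow (x * y) z = rpow x z * rpow y z"
  by (simp add: rpow_def ln_mult distrib_left exp_add)

lemma rpow_1: "0 < x \<Longrightarrow> rpow x 1 = of_real x"
  using rpow_of_real[of x 1] by simp

lemma rpow_of_nat: "0 < x \<Longrightarrow> rpow x (of_nat n) = of_real x ^ n"
  by (induction n) (simp_all add: rpow_add rpow_1)

lemma rpow_measurable [measurable]: "f \<in> borel_measurable M \<Longrightarrow> (\<lambda>x. rpow (f x) z) \<in> borel_measurable M"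
  unfolding rpow_def by measurable

text \<open>Euler's integral after the substitution t -> u t. The integrand is rewritten with
  \<open>rpow\<close>, which makes it Borel measurable, so that integrability passes from Lebesgue
  to Borel measure.\<close>

lemma Gamma_integral_scaled:
  fixes z :: complex and u :: real
  assumes "Re z > 0" "u > 0"
  shows "set_integrable lborel {0<..} (\<lambda>t. rpow t (z - 1) * of_real (exp (- (u * t))))"
    and "(LINT t:{0<..}|lborel. rpow t (z - 1) * of_real (exp (- (u * t)))) = Gamma z * rpow u (- z)"
proof -
  have int: "set_integrable lborel {0<..} (\<lambda>t. rpow t (z - 1) * of_real (exp (- (u * t))))" if "u > 0" for u
  proof -
    have "set_integrable lebesgue {0<..} (\<lambda>t. of_real t powr (z - 1) / of_real (exp (u * t)))"
      using absolutely_integrable_Gamma_integral[OF assms(1) that] .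
    also have "?this \<longleftrightarrow> set_integrable lebesgue {0<..} (\<lambda>t. rpow t (z - 1) * of_real (exp (- (u * t))))"
      by (intro set_integrable_cong) (auto simp: powr_eq_rpow exp_minus divide_inverse)
    finally show ?thesis
      unfolding set_integrable_def by (subst (asm) integrable_completion) measurable
  qed
  show "set_integrable lborel {0<..} (\<lambda>t. rpow t (z - 1) * of_real (exp (- (u * t))))"
    using int[OF assms(2)] .
  define f where "f = (\<lambda>t. indicator {0<..} t *\<^sub>R (rpow t (z - 1) * of_real (exp (- t))))"
  have "(LINT t|lborel. f t) = Gamma z"
  proof -
    have "(LINT t:{0<..}|lborel. rpow t (z - 1) * of_real (exp (- t))) = integral {0<..} (\<lambda>t. rpow t (z - 1) * of_real (exp (- t)))"
      using int[of 1] by (intro set_borel_integral_eq_integral) simp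
    also have "\<dots> = integral {0<..} (\<lambda>t. of_real t powr (z - 1) / of_real (exp t))"
      by (intro integral_cong) (auto simp: powr_eq_rpow exp_minus divide_inverse)
    also have "\<dots> = Gamma z" using Gamma_integral_complex'[OF assms(1)] by (rule integral_unique)
    finally show ?thesis by (simp add: f_def set_lebesgue_integral_def)
  qed
  also have "(LINT t|lborel. f t) = \<bar>u\<bar> *\<^sub>R (LINT t|lborel. f (0 + u * t))"
    using assms by (intro lborel_integral_real_affine) auto
  also have "(\<lambda>t. f (0 + u * t)) = (\<lambda>t. rpow u (z - 1) * (indicator {0<..} t *\<^sub>R (rpow t (z - 1) * of_real (exp (- (u * t))))))"
    using assms by (auto simp: f_def fun_eq_iff indicator_def rpow_mult zero_less_mult_iff)
  also have "(LINT t|lborel. rpow u (z - 1) * (indicator {0<..} t *\<^sub>R (rpow t (z - 1) * of_real (exp (- (u * t)))))) =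
      rpow u (z - 1) * (LINT t:{0<..}|lborel. rpow t (z - 1) * of_real (exp (- (u * t))))"
    unfolding set_lebesgue_integral_def by (simp only: integral_mult_right_zero)
  also have "\<bar>u\<bar> *\<^sub>R (rpow u (z - 1) * (LINT t:{0<..}|lborel. rpow t (z - 1) * of_real (exp (- (u * t)))))
    = rpow u z * (LINT t:{0<..}|lborel. rpow t (z - 1) * of_real (exp (- (u * t))))"
    using assms rpow_add[of u "z - 1" 1] by (simp add: scaleR_conv_of_real rpow_1)
  finally show "(LINT t:{0<..}|lborel. rpow t (z - 1) * of_real (exp (- (u * t)))) = Gamma z * rpow u (- z)"
    by (simp add: rpow_minus field_simps)
qed

lemma Gamma_integral_scaled_real:
  fixes r u :: real
  assumes "r > 0" "u > 0"
  shows "set_integrable lborel {0<..} (\<lambda>t. t powr (r - 1) * exp (- (u * t)))"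
    and "(LINT t:{0<..}|lborel. t powr (r - 1) * exp (- (u * t))) = Gamma r * u powr (- r)"
proof -
  have eq: "indicator {0<..} t *\<^sub>R (rpow t (of_real r - 1) * complex_of_real (exp (- (u * t)))) =
    complex_of_real (indicator {0<..} t *\<^sub>R (t powr (r - 1) * exp (- (u * t))))" for t
    using rpow_of_real[of t "r - 1"] by (simp add: indicator_def)
  show "set_integrable lborel {0<..} (\<lambda>t. t powr (r - 1) * exp (- (u * t)))"
    using Gamma_integral_scaled(1)[of "of_real r" u] assms
    unfolding set_integrable_def eq complex_of_real_integrable_eq by simp
  have "complex_of_real (LINT t:{0<..}|lborel. t powr (r - 1) * exp (- (u * t))) = of_real (Gamma r * u powr (- r))"
    using Gamma_integral_scaled(2)[of "of_real r" u] rpow_of_real[of u "-r"] assms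
    unfolding set_lebesgue_integral_def eq integral_complex_of_real by (simp add: Gamma_complex_of_real)
  thus "(LINT t:{0<..}|lborel. t powr (r - 1) * exp (- (u * t))) = Gamma r * u powr (- r)"
    by (simp only: of_real_eq_iff)
qed

text \<open>Gamma(p + q) (1 + x)^(-p-q) is the integral over y of y^(p+q-1) exp(-y (1 + x)), which
  makes the left side a double integral. Integrating in x first gives Gamma p times the Gamma
  integral for q. The norms obey the same computation with real parts, which justifies
  Fubini.\<close>

theorem Beta_integral_half_line:
  fixes p q :: complex
  assumes p: "Re p > 0" and q: "Re q > 0"
  shows "set_integrable lborel {0<..} (\<lambda>x. rpow x (p - 1) * rpow (1 + x) (- (p + q)))"
    and "(LINT x:{0<..}|lborel. rpow x (p - 1) * rpow (1 + x) (- (p + q))) = Beta p q"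
proof -
  define f where "f = (\<lambda>y x. (indicator {0<..} y *\<^sub>R (rpow y (p + q - 1) * of_real (exp (- y)))) *
     (indicator {0<..} x *\<^sub>R (rpow x (p - 1) * of_real (exp (- (y * x))))))"
  have inner_x: "integrable lborel (f y)" "(LINT x|lborel. f y x) = Gamma p * (indicator {0<..} y *\<^sub>R (rpow y (q - 1) * of_real (exp (- (1 * y)))))"
    "(LINT x|lborel. norm (f y x)) = Gamma (Re p) * (indicator {0<..} y *\<^sub>R (y powr (Re q - 1) * exp (- (1 * y))))"
    for y
  proof -
    show "integrable lborel (f y)"
    proof (cases "0 < y")
      case True
      thus ?thesis using Gamma_integral_scaled(1)[OF p True] unfolding f_def set_integrable_def by (intro integrable_mult_right)
    qed (simp add: f_def)
    show "(LINT x|lborel. f y x) = Gamma p * (indicator {0<..} y *\<^sub>R (rpow y (q - 1) * of_real (exp (- (1 * y)))))"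
    proof (cases "0 < y")
      case True
      have "(LINT x|lborel. f y x) = (rpow y (p + q - 1) * of_real (exp (- y))) * (Gamma p * rpow y (- p))"
        using Gamma_integral_scaled(2)[OF p True] True unfolding f_def set_lebesgue_integral_def
        by (simp only: integral_mult_right_zero) simp
      also have "rpow y (p + q - 1) = rpow y p * rpow y (q - 1)" by (simp flip: rpow_add add: add_diff_eq)
      finally show ?thesis using True by (simp add: rpow_minus)
    qed (simp add: f_def)
    show "(LINT x|lborel. norm (f y x)) = Gamma (Re p) * (indicator {0<..} y *\<^sub>R (y powr (Re q - 1) * exp (- (1 * y))))"
    proof (cases "0 < y")
      case True
      have "norm (f y x) = (y powr (Re p + Re q - 1) * exp (- y)) * (indicator {0<..} x *\<^sub>R (x powr (Re p - 1) * exp (- (y * x))))" for x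
        using True by (simp add: f_def norm_mult norm_rpow indicator_def)
      hence "(LINT x|lborel. norm (f y x)) = (y powr (Re p + Re q - 1) * exp (- y)) * (Gamma (Re p) * y powr (- Re p))"
        using Gamma_integral_scaled_real(2)[OF p True] True unfolding set_lebesgue_integral_def by simp
      also have "y powr (Re p + Re q - 1) = y powr Re p * y powr (Re q - 1)" by (simp flip: powr_add add: add_diff_eq)
      finally show ?thesis using True by (simp add: powr_minus field_simps)
    qed (simp add: f_def)
  qed
  have inner_y: "(LINT y|lborel. f y x) = Gamma (p + q) * (indicator {0<..} x *\<^sub>R (rpow x (p - 1) * rpow (1 + x) (- (p + q))))" for x
  proof (cases "0 < x")
    case True
    have "f y x = rpow x (p - 1) * (indicator {0<..} y *\<^sub>R (rpow y (p + q - 1) * of_real (exp (- ((1 + x) * y)))))" for y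
      using True by (simp add: f_def indicator_def algebra_simps exp_add[symmetric] flip: of_real_mult)
    hence "(LINT y|lborel. f y x) = rpow x (p - 1) * (LINT y:{0<..}|lborel. rpow y (p + q - 1) * of_real (exp (- ((1 + x) * y))))"
      unfolding set_lebesgue_integral_def by (simp only: mult_scaleR_right[symmetric] integral_mult_right_zero)
    also have "\<dots> = rpow x (p - 1) * (Gamma (p + q) * rpow (1 + x) (- (p + q)))"
      using Gamma_integral_scaled(2)[of "p + q" "1 + x"] p q True by simp
    finally show ?thesis using True by simp
  qed (simp add: f_def)
  have meas: "(\<lambda>(y, x). f y x) \<in> borel_measurable (lborel \<Otimes>\<^sub>M lborel)"
    unfolding f_def by measurable
  have "integrable (lborel \<Otimes>\<^sub>M lborel) (\<lambda>(y, x). f y x)"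
  proof (rule lborel_pair.Fubini_integrable[OF meas])
    show "integrable lborel (\<lambda>y. LINT x|lborel. norm (case (y, x) of (y, x) \<Rightarrow> f y x))"
      using Gamma_integral_scaled_real(1)[OF q zero_less_one] unfolding set_integrable_def
      by (simp only: prod.case inner_x) (rule integrable_mult_right)
  qed (simp add: inner_x)
  note I = this
  have ne: "Gamma (p + q) \<noteq> 0" using p q
    by (simp add: Gamma_eq_zero_iff Re_pos_notin_nonpos_Ints)
  have "integrable lborel (\<lambda>x. LINT y|lborel. f y x)"
    using lborel_pair.integrable_snd[OF I] by simp
  thus "set_integrable lborel {0<..} (\<lambda>x. rpow x (p - 1) * rpow (1 + x) (- (p + q)))"
  proof -
    assume "integrable lborel (\<lambda>x. LINT y|lborel. f y x)"
    hence "integrable lborel (\<lambda>x. (1 / Gamma (p + q)) * (LINT y|lborel. f y x))" by (rule integrable_mult_right)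
    moreover have "(1 / Gamma (p + q)) * (Gamma (p + q) * w) = w" for w using ne by simp
    ultimately show ?thesis unfolding inner_y set_integrable_def by (simp only:)
  qed
  have "Gamma (p + q) * (LINT x:{0<..}|lborel. rpow x (p - 1) * rpow (1 + x) (- (p + q))) = (LINT x|lborel. LINT y|lborel. f y x)"
    unfolding inner_y set_lebesgue_integral_def by (simp only: integral_mult_right_zero)
  also have "\<dots> = (LINT y|lborel. LINT x|lborel. f y x)"
    using lborel_pair.Fubini_integral[OF I] by simp
  also have "\<dots> = Gamma p * Gamma q"
    using Gamma_integral_scaled(2)[OF q zero_less_one] unfolding inner_x set_lebesgue_integral_def
    by (simp only: integral_mult_right_zero) (simp add: rpow_def)
  finally show "(LINT x:{0<..}|lborel. rpow x (p - 1) * rpow (1 + x) (- (p + q))) = Beta p q"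
    using ne by (simp add: Beta_def field_simps)
qed

text \<open>The modulus of the kernel is the kernel for the real parts. These are the L1 norms on
  which termwise integration rests.\<close>

lemma Beta_integral_half_line_norm:
  fixes p q :: complex
  assumes p: "Re p > 0" and q: "Re q > 0"
  shows "(LINT x:{0<..}|lborel. norm (rpow x (p - 1) * rpow (1 + x) (- (p + q)))) = Beta (Re p) (Re q)"
proof -
  have eq: "indicator {0<..} x *\<^sub>R (rpow x (of_real (Re p) - 1) * rpow (1 + x) (- (of_real (Re p) + of_real (Re q)))) =
     complex_of_real (indicator {0<..} x *\<^sub>R norm (rpow x (p - 1) * rpow (1 + x) (- (p + q))))" for x
    using rpow_of_real[of x "Re p - 1"] rpow_of_real[of "1 + x" "- (Re p + Re q)"] by (simp add: indicator_def norm_mult norm_rpow)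
  have "complex_of_real (LINT x:{0<..}|lborel. norm (rpow x (p - 1) * rpow (1 + x) (- (p + q)))) = of_real (Beta (Re p) (Re q))"
    using Beta_integral_half_line(2)[of "of_real (Re p)" "of_real (Re q)"] p q
    unfolding set_lebesgue_integral_def eq integral_complex_of_real by (simp add: Beta_complex_of_real)
  thus ?thesis by (simp only: of_real_eq_iff)
qed

section \<open>Growth of Pochhammer symbols and of the Gauss coefficients\<close>

lemma Gamma_shift_asymp_complex:
  fixes z :: complex
  assumes "z \<notin> \<int>\<^sub>\<le>\<^sub>0"
  shows "(\<lambda>n. Gamma (z + of_nat n) / (fact (n - 1) * rpow (real n) z)) \<longlonglongrightarrow> 1"
proof -
  have ne: "Gamma z \<noteq> 0" using assms by (simp add: Gamma_eq_zero_iff)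
  have "(\<lambda>n. Gamma z / Gamma_series' z n) \<longlonglongrightarrow> Gamma z / Gamma z"
    using ne by (intro tendsto_intros Gamma_series'_LIMSEQ) auto
  moreover have "Gamma z / Gamma_series' z n = Gamma (z + of_nat n) / (fact (n - 1) * rpow (real n) z)" if "n > 0" for n
    using that ne pochhammer_Gamma[OF assms, of n] by (simp add: Gamma_series'_def rpow_def)
  ultimately show ?thesis using ne
    by (auto intro: Lim_transform_eventually eventually_mono[OF eventually_gt_at_top[of 0]])
qed

text \<open>Up to n! and a power of n, the Pochhammer symbol is the reciprocal of Euler's sequence
  for Gamma; in modulus the phase of n^z drops out.\<close>

lemma pochhammer_asymp:
  fixes z :: complex
  assumes "z \<notin> \<int>\<^sub>\<le>\<^sub>0"
  shows "(\<lambda>n. norm (pochhammer z n) / (fact n * real n powr (Re z - 1))) \<longlonglongrightarrow> 1 / norm (Gamma z)"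
proof -
  have ne: "Gamma z \<noteq> 0" using assms by (simp add: Gamma_eq_zero_iff)
  have "(\<lambda>n. norm (1 / Gamma_series' z n)) \<longlonglongrightarrow> norm (1 / Gamma z)"
    using ne by (intro tendsto_intros Gamma_series'_LIMSEQ) auto
  moreover have "norm (1 / Gamma_series' z n) = norm (pochhammer z n) / (fact n * real n powr (Re z - 1))" if n: "n > 0" for n
  proof -
    obtain m where m: "n = Suc m" using gr0_implies_Suc[OF n] by blast
    have "norm (exp (z * of_real (ln (real n)))) = real n powr Re z"
      using norm_rpow[of "real n" z] n by (simp add: rpow_def)
    moreover have "fact n * real n powr (Re z - 1) = fact (n - 1) * real n powr Re z"
      using n by (simp add: m powr_diff)
    ultimately show ?thesis
      by (simp only: Gamma_series'_def norm_divide norm_mult norm_fact norm_one) simp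
  qed
  ultimately show ?thesis using ne
    by (auto simp: norm_divide intro: Lim_transform_eventually eventually_mono[OF eventually_gt_at_top[of 0]])
qed

lemma pochhammer_upper:
  fixes z :: complex
  assumes "z \<notin> \<int>\<^sub>\<le>\<^sub>0"
  obtains K where "K > 0" "\<And>n. n > 0 \<Longrightarrow> norm (pochhammer z n) \<le> K * (fact n * real n powr (Re z - 1))"
proof -
  obtain K where K: "K > 0" "\<And>n. norm (norm (pochhammer z n) / (fact n * real n powr (Re z - 1))) \<le> K"
    using convergent_imp_Bseq[OF convergentI[OF pochhammer_asymp[OF assms]]] by (auto simp: Bseq_def)
  show ?thesis
  proof (rule that[OF K(1)])
    fix n :: nat assume "n > 0"
    thus "norm (pochhammer z n) \<le> K * (fact n * real n powr (Re z - 1))" using K(2)[of n] by (simp add: field_simps)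
  qed
qed

lemma pochhammer_lower:
  fixes z :: complex
  assumes "z \<notin> \<int>\<^sub>\<le>\<^sub>0"
  obtains K where "K > 0" "\<And>n. n > 0 \<Longrightarrow> fact n * real n powr (Re z - 1) \<le> K * norm (pochhammer z n)"
proof -
  have ne: "Gamma z \<noteq> 0" using assms by (simp add: Gamma_eq_zero_iff)
  have nz: "pochhammer z n \<noteq> 0" for n using assms pochhammer_eq_0_imp_nonpos_Int by blast
  have "(\<lambda>n. inverse (norm (pochhammer z n) / (fact n * real n powr (Re z - 1)))) \<longlonglongrightarrow> inverse (1 / norm (Gamma z))"
    using ne by (intro tendsto_inverse pochhammer_asymp assms) auto
  from BseqE[OF convergent_imp_Bseq[OF convergentI[OF this]]] obtain K where K: "K > 0" "\<And>n. norm (inverse (norm (pochhammer z n) / (fact n * real n powr (Re z - 1)))) \<le> K"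
    by metis
  show ?thesis
  proof (rule that[OF K(1)])
    fix n :: nat assume "n > 0"
    thus "fact n * real n powr (Re z - 1) \<le> K * norm (pochhammer z n)" using K(2)[of n] nz[of n] by (simp add: field_simps)
  qed
qed

definition gauss_coeff :: "complex \<Rightarrow> complex \<Rightarrow> complex \<Rightarrow> nat \<Rightarrow> complex" where
  "gauss_coeff A B C k = pochhammer A k * pochhammer B k / (pochhammer C k * fact k)"

text \<open>Each Pochhammer symbol is of order n! n^(Re z - 1); the factorials cancel and the
  exponents add up to Re(A + B - C) - 1.\<close>

lemma gauss_coeff_bound:
  assumes "Re A > 0" "Re B > 0" "Re C > 0"
  obtains K where "K > 0" "\<And>n. n > 0 \<Longrightarrow> norm (gauss_coeff A B C n) \<le> K * real n powr (Re A + Re B - Re C - 1)"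
proof -
  obtain K1 where K1: "K1 > 0" "\<And>n. n > 0 \<Longrightarrow> norm (pochhammer A n) \<le> K1 * (fact n * real n powr (Re A - 1))"
    using pochhammer_upper[OF Re_pos_notin_nonpos_Ints[OF assms(1)]] by blast
  obtain K2 where K2: "K2 > 0" "\<And>n. n > 0 \<Longrightarrow> norm (pochhammer B n) \<le> K2 * (fact n * real n powr (Re B - 1))"
    using pochhammer_upper[OF Re_pos_notin_nonpos_Ints[OF assms(2)]] by blast
  obtain K3 where K3: "K3 > 0" "\<And>n. n > 0 \<Longrightarrow> fact n * real n powr (Re C - 1) \<le> K3 * norm (pochhammer C n)"
    using pochhammer_lower[OF Re_pos_notin_nonpos_Ints[OF assms(3)]] by blast
  show ?thesis
  proof (rule that[of "K1 * K2 * K3"])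
    show "K1 * K2 * K3 > 0" using K1 K2 K3 by simp
    fix n :: nat assume n: "n > 0"
    have Cpos: "norm (pochhammer C n) > 0" using pochhammer_eq_0_imp_nonpos_Int[of C n] Re_pos_notin_nonpos_Ints[OF assms(3)] by auto
    have L: "0 < fact n * real n powr (Re C - 1) / K3" using n K3 by simp
    have "norm (gauss_coeff A B C n) = norm (pochhammer A n) * norm (pochhammer B n) / (norm (pochhammer C n) * fact n)"
      by (simp add: gauss_coeff_def norm_mult norm_divide norm_fact)
    also have "\<dots> \<le> (K1 * (fact n * real n powr (Re A - 1))) * (K2 * (fact n * real n powr (Re B - 1))) / ((fact n * real n powr (Re C - 1) / K3) * fact n)"
      using K1 K2 K3(1) K3(2)[OF n] n L
      by (intro frac_le mult_mono mult_right_mono mult_pos_pos) (auto simp: field_simps)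
    also have "\<dots> = K1 * K2 * K3 * real n powr (Re A + Re B - Re C - 1)"
      using n K3(1) by (simp add: powr_diff powr_add field_simps)
    finally show "norm (gauss_coeff A B C n) \<le> K1 * K2 * K3 * real n powr (Re A + Re B - Re C - 1)" .
  qed
qed

text \<open>With r = Re(C - A - B) > 0 the terms are O(n^(-1-r)). The second claim disposes of the
  boundary term when \<open>gauss_contiguous\<close> telescopes.\<close>

lemma summable_gauss_coeff:
  assumes "Re A > 0" "Re B > 0" "Re (C - A - B) > 0"
  shows "summable (\<lambda>n. norm (gauss_coeff A B C n))" "(\<lambda>n. of_nat n * gauss_coeff A B C n) \<longlonglongrightarrow> 0"
proof -
  have "Re C > 0" using assms by simp
  then obtain K where K: "K > 0" "\<And>n. n > 0 \<Longrightarrow> norm (gauss_coeff A B C n) \<le> K * real n powr (Re A + Re B - Re C - 1)"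
    using gauss_coeff_bound[OF assms(1,2)] by blast
  have "summable (\<lambda>n. K * real n powr (Re A + Re B - Re C - 1))"
    using assms by (intro summable_mult) (simp add: summable_real_powr_iff)
  thus "summable (\<lambda>n. norm (gauss_coeff A B C n))"
    by (rule summable_comparison_test_ev[rotated])
       (use K in \<open>auto intro!: eventually_mono[OF eventually_gt_at_top[of 0]]\<close>)
  show "(\<lambda>n. of_nat n * gauss_coeff A B C n) \<longlonglongrightarrow> 0"
  proof (rule Lim_null_comparison)
    define r where "r = Re (C - A - B)"
    have r: "r > 0" using assms(3) by (simp add: r_def)
    show "\<forall>\<^sub>F n in sequentially. norm (of_nat n * gauss_coeff A B C n) \<le> K * real n powr (- r)"
    proof (rule eventually_mono[OF eventually_gt_at_top[of 0]])
      fix n :: nat assume n: "0 < n"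
      have "norm (of_nat n * gauss_coeff A B C n) \<le> real n * (K * real n powr (Re A + Re B - Re C - 1))"
        using K(2)[OF n] by (simp add: norm_mult mult_left_mono)
      also have "\<dots> = K * (real n powr 1 * real n powr (Re A + Re B - Re C - 1))" using n by simp
      also have "real n powr 1 * real n powr (Re A + Re B - Re C - 1) = real n powr (- r)"
        unfolding powr_add[symmetric] by (simp add: r_def algebra_simps)
      finally show "norm (of_nat n * gauss_coeff A B C n) \<le> K * real n powr (- r)" .
    qed
    have "(\<lambda>n. real n powr (- r)) \<longlonglongrightarrow> 0" using r by real_asymp
    thus "(\<lambda>n. K * real n powr (- r)) \<longlonglongrightarrow> 0" by (rule tendsto_mult_right_zero)
  qed
qed

lemma gauss_coeff_Suc:
  assumes "Re C > 0"
  shows "gauss_coeff A B C (Suc k) * ((C + of_nat k) * of_nat (Suc k)) = gauss_coeff A B C k * ((A + of_nat k) * (B + of_nat k))"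
proof -
  have "C + of_nat k \<noteq> 0" using assms by (auto simp: complex_eq_iff)
  moreover have "pochhammer C k \<noteq> 0" using assms pochhammer_eq_0_imp_nonpos_Int Re_pos_notin_nonpos_Ints by blast
  moreover have "of_nat (Suc k) \<noteq> (0::complex)" by (rule of_nat_neq_0)
  ultimately show ?thesis
    by (simp add: gauss_coeff_def pochhammer_Suc fact_Suc divide_simps del: of_nat_Suc)
qed

lemma gauss_coeff_plus1:
  assumes "Re C > 0"
  shows "gauss_coeff A B (C + 1) k * (C + of_nat k) = gauss_coeff A B C k * C"
proof -
  have nz: "C + of_nat k \<noteq> 0" "C \<noteq> 0" using assms by (auto simp: complex_eq_iff)
  have "pochhammer C k \<noteq> 0" "pochhammer (C + 1) k \<noteq> 0" 
    using assms pochhammer_eq_0_imp_nonpos_Int Re_pos_notin_nonpos_Ints[of C] Re_pos_notin_nonpos_Ints[of "C + 1"] by fastforce+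
  moreover have "pochhammer (C + 1) k = pochhammer C k * (C + of_nat k) / C"
    using pochhammer_rec[of C k] pochhammer_Suc[of C k] nz by (simp add: field_simps)
  ultimately show ?thesis using nz
    by (simp add: gauss_coeff_def)
qed

text \<open>The difference of the two sides telescopes: its k-th term is u k - u (k + 1), where u k
  is C k times the k-th coefficient; u is 0 at k = 0 and tends to 0.\<close>

lemma gauss_contiguous:
  assumes "Re A > 0" "Re B > 0" "Re (C - A - B) > 0"
  shows "C * (C - A - B) * (\<Sum>k. gauss_coeff A B C k) = (C - A) * (C - B) * (\<Sum>k. gauss_coeff A B (C + 1) k)"
proof -
  have C: "Re C > 0" using assms by simp
  have s: "summable (gauss_coeff A B C)" "summable (gauss_coeff A B (C + 1))"
    using summable_gauss_coeff(1)[OF assms] summable_gauss_coeff(1)[of A B "C + 1"] assms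
    by (auto intro: summable_norm_cancel)
  define u where "u = (\<lambda>k. C * (of_nat k * gauss_coeff A B C k))"
  have tel: "C * (C - A - B) * gauss_coeff A B C k - (C - A) * (C - B) * gauss_coeff A B (C + 1) k = u k - u (Suc k)" for k
  proof -
    have nz: "C + of_nat k \<noteq> 0" using C by (auto simp: complex_eq_iff)
    have 1: "gauss_coeff A B (C + 1) k = gauss_coeff A B C k * C / (C + of_nat k)"
      using gauss_coeff_plus1[OF C, of A B k] nz by (simp add: field_simps)
    have 2: "of_nat (Suc k) * gauss_coeff A B C (Suc k) = gauss_coeff A B C k * ((A + of_nat k) * (B + of_nat k)) / (C + of_nat k)"
      using gauss_coeff_Suc[OF C, of A B k] nz by (simp add: field_simps)
    show ?thesis unfolding u_def 1 2 using nz by (simp add: divide_simps) (simp add: algebra_simps)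
  qed
  have "u \<longlonglongrightarrow> C * 0" unfolding u_def by (intro tendsto_mult tendsto_const summable_gauss_coeff(2) assms)
  hence "(\<lambda>k. u k - u (Suc k)) sums (u 0 - 0)" by (intro telescope_sums') simp
  hence "(\<Sum>k. C * (C - A - B) * gauss_coeff A B C k - (C - A) * (C - B) * gauss_coeff A B (C + 1) k) = 0"
    unfolding tel by (simp add: sums_iff u_def)
  also have "(\<Sum>k. C * (C - A - B) * gauss_coeff A B C k - (C - A) * (C - B) * gauss_coeff A B (C + 1) k)
     = C * (C - A - B) * (\<Sum>k. gauss_coeff A B C k) - (C - A) * (C - B) * (\<Sum>k. gauss_coeff A B (C + 1) k)"
    using s by (subst suminf_diff[symmetric]) (auto intro: summable_mult simp: suminf_mult)
  finally show ?thesis by simp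
qed

text \<open>The contiguous relation raises C by 1 without changing the quotient H of the two sides,
  so H is constant along C + n. As n grows, the series tends to its first term 1 and the four Gamma
  factors balance, hence H = 1.\<close>

theorem Gauss_summation:
  assumes "Re A > 0" "Re B > 0" "Re (C - A - B) > 0"
  shows "(\<Sum>k. gauss_coeff A B C k) = Gamma C * Gamma (C - A - B) / (Gamma (C - A) * Gamma (C - B))"
proof -
  define S where "S = (\<lambda>n. \<Sum>k. gauss_coeff A B (C + of_nat n) k)"
  define H where "H = (\<lambda>n. S n * (Gamma (C - A + of_nat n) * Gamma (C - B + of_nat n)) / (Gamma (C + of_nat n) * Gamma (C - A - B + of_nat n)))"
  have pos: "Re C > 0" "Re (C - A) > 0" "Re (C - B) > 0" using assms by auto
  have G1: "Gamma (z + of_nat (Suc n)) = (z + of_nat n) * Gamma (z + of_nat n)" if "Re z > 0" for z :: complex and n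
    using Gamma_plus1[of "z + of_nat n"] Re_pos_notin_nonpos_Ints[of "z + of_nat n"] that by (simp add: add_ac)
  have Gnz: "Gamma (z + of_nat n) \<noteq> 0" "z + of_nat n \<noteq> 0" if "Re z > 0" for z :: complex and n
  proof -
    show "Gamma (z + of_nat n) \<noteq> 0" using Re_pos_notin_nonpos_Ints[of "z + of_nat n"] that by (simp add: Gamma_eq_zero_iff)
    show "z + of_nat n \<noteq> 0" using that by (auto simp: complex_eq_iff)
  qed
  have HS: "H (Suc n) = H n" for n
  proof -
    have "(C + of_nat n) * (C - A - B + of_nat n) * S n = (C - A + of_nat n) * (C - B + of_nat n) * S (Suc n)"
      using gauss_contiguous[of A B "C + of_nat n"] assms unfolding S_def by (simp add: algebra_simps)
    hence S: "S n = (C - A + of_nat n) * (C - B + of_nat n) * S (Suc n) / ((C + of_nat n) * (C - A - B + of_nat n))"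
    proof -
      assume eq: "(C + of_nat n) * (C - A - B + of_nat n) * S n = (C - A + of_nat n) * (C - B + of_nat n) * S (Suc n)"
      have nz: "(C + of_nat n) * (C - A - B + of_nat n) \<noteq> 0"
        using Gnz(2)[OF pos(1), of n] Gnz(2)[OF assms(3), of n] by simp
      show ?thesis unfolding nonzero_eq_divide_eq[OF nz] eq[symmetric] by (rule mult.commute)
    qed
    show ?thesis unfolding H_def G1[OF pos(1)] G1[OF pos(2)] G1[OF pos(3)] G1[OF assms(3)] S
      by (simp add: field_simps)
  qed
  have Hc: "H n = H 0" for n by (induction n) (auto simp: HS)
  have "H \<longlonglongrightarrow> 1"
  proof -
    define g where "g = (\<lambda>(z::complex) n. Gamma (z + of_nat n) / (fact (n - 1) * rpow (real n) z))"
    have g: "g z \<longlonglongrightarrow> 1" if "Re z > 0" for z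
      unfolding g_def by (rule Gamma_shift_asymp_complex[OF Re_pos_notin_nonpos_Ints[OF that]])
    have Slim: "S \<longlonglongrightarrow> 1"
    proof -
      define M where "M = (\<Sum>k. norm (gauss_coeff A B C k))"
      have sm: "summable (\<lambda>k. norm (gauss_coeff A B C k))" by (rule summable_gauss_coeff(1)[OF assms])
      have bnd: "norm (S n - 1) \<le> norm C / norm (C + of_nat n) * M" for n
      proof -
        have sn: "summable (\<lambda>k. norm (gauss_coeff A B (C + of_nat n) k))"
          using assms by (intro summable_gauss_coeff(1)) auto
        \<comment> \<open>Write (C + n)_(k+1) as (C + n) (C + n + 1)_k. The first factor yields the
          decay |C| / |C + n|; the others are at least as large in modulus as those of (C +
          1)_k.\<close>
        have le: "norm (gauss_coeff A B (C + of_nat n) (Suc k)) \<le> norm C / norm (C + of_nat n) * norm (gauss_coeff A B C (Suc k))" for k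
        proof -
          have f: "norm (C + of_nat j) \<le> norm (C + of_nat n + of_nat j)" for j
          proof -
            have "(Re C + real j)\<^sup>2 \<le> (Re C + real n + real j)\<^sup>2" using pos(1) by (intro power_mono) auto
            thus ?thesis by (simp add: cmod_def)
          qed
          have p: "norm (pochhammer (C + of_nat n) (Suc k)) * norm C \<ge> norm (pochhammer C (Suc k)) * norm (C + of_nat n)"
          proof -
            have "norm (pochhammer (C + 1) k) \<le> norm (pochhammer (C + of_nat n + 1) k)"
              unfolding pochhammer_prod prod_norm[symmetric]
              using f[of "Suc _"] by (intro prod_mono) (auto simp: add_ac)
            thus ?thesis unfolding pochhammer_rec norm_mult
              by (simp add: mult_ac mult_left_mono)
          qed
          have z: "norm (pochhammer C (Suc k)) > 0" "norm (pochhammer (C + of_nat n) (Suc k)) > 0" "norm (C + of_nat n) > 0"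
          proof -
            show "norm (pochhammer C (Suc k)) > 0" "norm (pochhammer (C + of_nat n) (Suc k)) > 0"
              using pochhammer_eq_0_imp_nonpos_Int[of C "Suc k"] pochhammer_eq_0_imp_nonpos_Int[of "C + of_nat n" "Suc k"]
                Re_pos_notin_nonpos_Ints[OF pos(1)] Re_pos_notin_nonpos_Ints[of "C + of_nat n"] pos(1) 
              by (auto simp del: pochhammer_Suc)
            show "norm (C + of_nat n) > 0" using pos(1) by (auto simp: complex_eq_iff)
          qed
          have "1 / norm (pochhammer (C + of_nat n) (Suc k)) \<le> norm C / norm (C + of_nat n) / norm (pochhammer C (Suc k))"
            using p z by (simp add: field_simps)
          from mult_left_mono[OF this, of "norm (pochhammer A (Suc k) * pochhammer B (Suc k) / fact (Suc k))"]
          show ?thesis by (simp add: gauss_coeff_def norm_mult norm_divide field_simps del: pochhammer_Suc fact_Suc)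
        qed
        have "S n = gauss_coeff A B (C + of_nat n) 0 + (\<Sum>k. gauss_coeff A B (C + of_nat n) (Suc k))"
          unfolding S_def using suminf_split_head[OF summable_norm_cancel[OF sn]] by simp
        hence "S n - 1 = (\<Sum>k. gauss_coeff A B (C + of_nat n) (Suc k))" by (simp add: gauss_coeff_def)
        also have "norm \<dots> \<le> (\<Sum>k. norm (gauss_coeff A B (C + of_nat n) (Suc k)))"
          using sn summable_Suc_iff[of "\<lambda>k. norm (gauss_coeff A B (C + of_nat n) k)"] by (intro summable_norm) blast
        also have "\<dots> \<le> (\<Sum>k. norm C / norm (C + of_nat n) * norm (gauss_coeff A B C (Suc k)))"
          using sn sm summable_Suc_iff[of "\<lambda>k. norm (gauss_coeff A B (C + of_nat n) k)"]
            summable_Suc_iff[of "\<lambda>k. norm (gauss_coeff A B C k)"]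
          by (intro suminf_le le summable_mult) blast+
        also have "\<dots> = norm C / norm (C + of_nat n) * (\<Sum>k. norm (gauss_coeff A B C (Suc k)))"
          using sm summable_Suc_iff[of "\<lambda>k. norm (gauss_coeff A B C k)"] by (intro suminf_mult) blast
        also have "\<dots> \<le> norm C / norm (C + of_nat n) * M"
          unfolding M_def using suminf_split_head[OF sm] by (intro mult_left_mono) auto
        finally show ?thesis .
      qed
      have "(\<lambda>n. norm C / norm (C + of_nat n) * M) \<longlonglongrightarrow> 0"
      proof (rule Lim_null_comparison)
        show "\<forall>\<^sub>F n in sequentially. norm (norm C / norm (C + of_nat n) * M) \<le> norm C * \<bar>M\<bar> * (1 / real n)"
        proof (rule eventually_mono[OF eventually_gt_at_top[of 0]])
          fix n :: nat assume "0 < n"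
          moreover have "real n \<le> norm (C + of_nat n)"
            using complex_Re_le_cmod[of "C + of_nat n"] pos(1) by simp
          ultimately have "1 / norm (C + of_nat n) \<le> 1 / real n" by (intro divide_left_mono) (auto simp: zero_less_mult_iff)
          from mult_left_mono[OF this, of "norm C * \<bar>M\<bar>"]
          show "norm (norm C / norm (C + of_nat n) * M) \<le> norm C * \<bar>M\<bar> * (1 / real n)"
            by (simp add: abs_mult)
        qed
        show "(\<lambda>n. norm C * \<bar>M\<bar> * (1 / real n)) \<longlonglongrightarrow> 0" by (rule tendsto_mult_right_zero[OF lim_1_over_n])
      qed
      hence "(\<lambda>n. S n - 1) \<longlonglongrightarrow> 0" using bnd by (intro Lim_null_comparison[where f="\<lambda>n. S n - 1"]) auto
      thus ?thesis by (simp add: LIM_zero_iff)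
    qed
    have "(\<lambda>n. S n * (g (C - A) n * g (C - B) n) / (g C n * g (C - A - B) n)) \<longlonglongrightarrow> 1 * (1 * 1) / (1 * 1)"
      by (intro tendsto_mult tendsto_divide Slim g pos assms) auto
    moreover have "S n * (g (C - A) n * g (C - B) n) / (g C n * g (C - A - B) n) = H n" if "n > 0" for n
    proof -
      \<comment> \<open>The exponents agree, (C - A) + (C - B) = C + (C - A - B), so the powers of n
        cancel.\<close>
      have e: "rpow (real n) (C - A) * rpow (real n) (C - B) = rpow (real n) C * rpow (real n) (C - A - B)"
        by (simp flip: rpow_add)
      have "S n * (g (C - A) n * g (C - B) n) / (g C n * g (C - A - B) n) =
        S n * (Gamma (C - A + of_nat n) * Gamma (C - B + of_nat n)) / (Gamma (C + of_nat n) * Gamma (C - A - B + of_nat n))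
         * ((rpow (real n) C * rpow (real n) (C - A - B)) / (rpow (real n) (C - A) * rpow (real n) (C - B)))"
        by (simp add: g_def field_simps)
      also have "\<dots> = H n" unfolding e H_def by simp
      finally show ?thesis .
    qed
    ultimately show ?thesis
      by (auto intro: Lim_transform_eventually eventually_mono[OF eventually_gt_at_top[of 0]])
  qed
  hence "H 0 = 1" using Hc LIMSEQ_unique tendsto_const by (metis (no_types, lifting) LIMSEQ_const_iff ext)
  thus ?thesis using Gnz(1)[OF pos(1), of 0] Gnz(1)[OF pos(2), of 0] Gnz(1)[OF pos(3), of 0] Gnz(1)[OF assms(3), of 0]
    by (simp add: H_def S_def field_simps)
qed

section \<open>Euler's integral and the analytic continuation\<close>

lemma binomial_series_complex:
  fixes A w :: complex
  assumes "norm w < 1"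
  shows "(\<lambda>k. pochhammer A k / fact k * w ^ k) sums exp (- A * Ln (1 - w))"
proof -
  have "(\<lambda>k. ((- A) gchoose k) * (- w) ^ k) sums (1 + (- w)) powr (- A)"
    using assms by (intro gen_binomial_complex) simp
  moreover have "((- A) gchoose k) * (- w) ^ k = pochhammer A k / fact k * w ^ k" for k
  proof -
    have "(- w) ^ k = (- 1) ^ k * w ^ k" by (metis mult_minus1 power_mult_distrib)
    moreover have "(- 1) ^ k * (- 1) ^ k = (1 :: complex)" by (simp flip: power_mult_distrib)
    ultimately show ?thesis by (simp add: gbinomial_pochhammer mult_ac)
  qed
  moreover have "1 - w \<noteq> 0" using assms by auto
  hence "(1 + (- w)) powr (- A) = exp (- A * Ln (1 - w))" by (simp add: powr_def)
  ultimately show ?thesis by simp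
qed

lemma summable_binomial_series:
  fixes A :: complex and r :: real
  assumes "0 \<le> r" "r < 1"
  shows "summable (\<lambda>k. norm (pochhammer A k / fact k) * r ^ k)"
proof -
  obtain t where t: "r < t" "t < 1" using assms dense by blast
  have "summable (\<lambda>k. norm (pochhammer A k / fact k * (of_real r) ^ k))"
  proof (rule powser_insidea)
    show "summable (\<lambda>k. pochhammer A k / fact k * (of_real t) ^ k)"
      using binomial_series_complex[of "of_real t" A] t assms by (auto simp: sums_iff)
    show "norm (of_real r :: complex) < norm (of_real t :: complex)" using assms t by simp
  qed
  thus ?thesis using assms by (simp add: norm_mult norm_power norm_divide norm_fact)
qed

text \<open>The L1 norm of the k-th term is |d k| times the beta function at the real parts of P k
  and Q k, so \<open>sm\<close> is the condition for integrating termwise. Both expansions of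
  Euler's integral and the transform itself have this shape, with k entering either P or Q.\<close>

lemma Beta_series_half_line:
  fixes d P Q :: "nat \<Rightarrow> complex"
  assumes P: "\<And>k. Re (P k) > 0" and Q: "\<And>k. Re (Q k) > 0"
    and sm: "summable (\<lambda>k. norm (d k) * Beta (Re (P k)) (Re (Q k)))"
    and sums: "\<And>x. x > 0 \<Longrightarrow> (\<lambda>k. d k * (rpow x (P k - 1) * rpow (1 + x) (- (P k + Q k)))) sums g x"
    and abs: "\<And>x. x > 0 \<Longrightarrow> summable (\<lambda>k. norm (d k * (rpow x (P k - 1) * rpow (1 + x) (- (P k + Q k)))))"
  shows "set_integrable lborel {0<..} g"
    and "(LINT x:{0<..}|lborel. g x) = (\<Sum>k. d k * Beta (P k) (Q k))"
proof -
  define f where "f = (\<lambda>k x. d k * (indicator {0<..} x *\<^sub>R (rpow x (P k - 1) * rpow (1 + x) (- (P k + Q k)))))"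
  have int: "integrable lborel (f k)" for k
    using Beta_integral_half_line(1)[OF P Q, of k k] unfolding f_def set_integrable_def by (intro integrable_mult_right)
  have fn: "norm (f k x) = norm (d k) * (indicator {0<..} x *\<^sub>R norm (rpow x (P k - 1) * rpow (1 + x) (- (P k + Q k))))" for k x
    by (simp add: f_def norm_mult)
  have "(LINT x|lborel. norm (f k x)) = norm (d k) * Beta (Re (P k)) (Re (Q k))" for k
    using Beta_integral_half_line_norm[OF P Q, of k k] unfolding fn set_lebesgue_integral_def
    by (simp only: integral_mult_right_zero)
  hence s1: "summable (\<lambda>k. LINT x|lborel. norm (f k x))" using sm by simp
  have s2: "AE x in lborel. summable (\<lambda>k. norm (f k x))"
  proof (rule AE_I2)
    fix x show "summable (\<lambda>k. norm (f k x))" using abs[of x] by (cases "x > 0") (auto simp: f_def)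
  qed
  have g: "(\<Sum>k. f k x) = indicator {0<..} x *\<^sub>R g x" for x
    using sums[of x] by (cases "x > 0") (auto simp: f_def sums_iff)
  show "set_integrable lborel {0<..} g"
    using integrable_suminf[OF int s2 s1] unfolding g set_integrable_def .
  have "(LINT x|lborel. f k x) = d k * Beta (P k) (Q k)" for k
    using Beta_integral_half_line(2)[OF P Q, of k k] unfolding f_def set_lebesgue_integral_def
    by (simp only: integral_mult_right_zero)
  thus "(LINT x:{0<..}|lborel. g x) = (\<Sum>k. d k * Beta (P k) (Q k))"
    using integral_suminf[OF int s2 s1] unfolding g set_lebesgue_integral_def by simp
qed

lemma Beta_plus_nat_left:
  fixes p q :: complex
  assumes "Re p > 0" "Re q > 0"
  shows "Beta (p + of_nat k) q = Beta p q * (pochhammer p k / pochhammer (p + q) k)"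
proof -
  have n: "p \<notin> \<int>\<^sub>\<le>\<^sub>0" "p + q \<notin> \<int>\<^sub>\<le>\<^sub>0" using assms by (auto intro!: Re_pos_notin_nonpos_Ints)
  have 1: "Gamma (p + of_nat k) = Gamma p * pochhammer p k" "Gamma (p + q + of_nat k) = Gamma (p + q) * pochhammer (p + q) k"
    using pochhammer_Gamma[OF n(1), of k] pochhammer_Gamma[OF n(2), of k] n by (auto simp: Gamma_eq_zero_iff)
  have 2: "p + of_nat k + q = p + q + of_nat k" by simp
  show ?thesis unfolding Beta_def 2 1 by simp
qed

lemma Beta_real_nonneg: "0 < p \<Longrightarrow> 0 < q \<Longrightarrow> 0 \<le> Beta p (q :: real)"
  by (auto simp: Beta_def intro!: divide_nonneg_pos mult_nonneg_nonneg less_imp_le[OF Gamma_real_pos] Gamma_real_pos)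

lemma Beta_plus_nat_le:
  fixes p q :: real
  assumes "p > 0" "q > 0"
  shows "Beta (p + real k) q \<le> Beta p q"
proof (induction k)
  case (Suc k)
  have n: "p + real k > 0" "q > 0" using assms by auto
  have "Beta (p + real k + 1) q = Beta (p + real k) q * ((p + real k) / (p + real k + q))"
    using Beta_plus1_left[of "p + real k" q] n pos_notin_nonpos_Ints[OF n(1)] by (simp add: field_simps)
  also have "\<dots> \<le> Beta (p + real k) q * 1"
    using n by (intro mult_left_mono) (auto intro!: Beta_real_nonneg)
  finally show ?case using Suc by (simp add: add_ac)
qed simp

text \<open>Euler's integrand t^(p-1) (1 - t)^(q-1) (1 - zt)^(-A) after the substitution t = y / (1
  + y), Jacobian included; this makes it a beta kernel on the half-line times one factor that
  depends on z.\<close>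

definition euler_kernel :: "complex \<Rightarrow> complex \<Rightarrow> complex \<Rightarrow> complex \<Rightarrow> real \<Rightarrow> complex" where
  "euler_kernel A p q z y = rpow y (p - 1) * rpow (1 + y) (- (p + q)) * exp (- A * Ln (1 - z * of_real (y / (1 + y))))"

lemma gauss_series_eq: "gauss_series A B C z = (\<Sum>k. gauss_coeff A B C k * z ^ k)"
  by (simp add: gauss_series_def eval_fps_def gauss_coeff_def)

text \<open>The k-th term of the binomial series of (1 - zt)^(-A) contributes t^k, which raises p to
  p + k; the quotient of beta values is then (p)_k / (p + q)_k.\<close>

lemma euler_integral_disk:
  assumes p: "Re p > 0" and q: "Re q > 0" and z: "norm z < 1"
  shows "(LINT y:{0<..}|lborel. euler_kernel A p q z y) = Beta p q * gauss_series A p (p + q) z"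
proof -
  define d where "d = (\<lambda>k. pochhammer A k / fact k * z ^ k)"
  have e: "d k * (rpow y (p + of_nat k - 1) * rpow (1 + y) (- (p + of_nat k + q))) =
     rpow y (p - 1) * rpow (1 + y) (- (p + q)) * (pochhammer A k / fact k * (z * of_real (y / (1 + y))) ^ k)" if "y > 0" for y k
  proof -
    have "rpow y (p + of_nat k - 1) = rpow y (p - 1) * of_real y ^ k"
      using rpow_add[of y "p - 1" "of_nat k"] rpow_of_nat[OF that] by (simp add: algebra_simps)
    moreover have "rpow (1 + y) (- (p + of_nat k + q)) = rpow (1 + y) (- (p + q)) / of_real (1 + y) ^ k"
      using rpow_diff[of "1 + y" "- (p + q)" "of_nat k"] rpow_of_nat[of "1 + y" k] that by (simp add: algebra_simps)
    ultimately show ?thesis by (simp add: d_def power_mult_distrib power_divide)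
  qed
  have small: "norm (z * of_real (y / (1 + y))) < 1" if "y > 0" for y
  proof -
    have "norm (z * of_real (y / (1 + y))) \<le> norm z * 1"
      unfolding norm_mult norm_of_real using that by (intro mult_left_mono) auto
    thus ?thesis using z by simp
  qed
  have bs: "summable (\<lambda>k. norm (d k) * Beta (Re (p + of_nat k)) (Re q))"
  proof (rule summable_comparison_test')
    show "summable (\<lambda>k. (norm (pochhammer A k / fact k) * norm z ^ k) * Beta (Re p) (Re q))"
      by (intro summable_mult2 summable_binomial_series z) simp
    fix k :: nat
    have "0 \<le> Beta (Re p + real k) (Re q)"
      using p q by (auto intro!: Beta_real_nonneg)
    thus "norm (norm (d k) * Beta (Re (p + of_nat k)) (Re q)) \<le> (norm (pochhammer A k / fact k) * norm z ^ k) * Beta (Re p) (Re q)"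
      using mult_left_mono[OF Beta_plus_nat_le[OF p q, of k], of "norm (d k)"] by (simp add: d_def norm_mult norm_power norm_divide)
  qed
  have "(LINT y:{0<..}|lborel. euler_kernel A p q z y) = (\<Sum>k. d k * Beta (p + of_nat k) q)"
  proof (rule Beta_series_half_line(2)[where P="\<lambda>k. p + of_nat k" and Q="\<lambda>_. q", OF _ q bs])
    fix y :: real assume y: "y > 0"
    show "(\<lambda>k. d k * (rpow y (p + of_nat k - 1) * rpow (1 + y) (- (p + of_nat k + q)))) sums euler_kernel A p q z y"
      unfolding e[OF y] euler_kernel_def by (intro sums_mult binomial_series_complex small y)
    show "summable (\<lambda>k. norm (d k * (rpow y (p + of_nat k - 1) * rpow (1 + y) (- (p + of_nat k + q)))))"
      unfolding e[OF y] using summable_mult[OF summable_binomial_series[OF _ small[OF y], of A], of "norm (rpow y (p - 1) * rpow (1 + y) (- (p + q)))"]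
      by (simp add: norm_mult norm_power norm_divide mult_ac)
  qed (use p in auto)
  also have "\<dots> = (\<Sum>k. Beta p q * (gauss_coeff A p (p + q) k * z ^ k))"
    unfolding Beta_plus_nat_left[OF p q] by (simp add: d_def gauss_coeff_def mult_ac)
  also have "\<dots> = Beta p q * gauss_series A p (p + q) z"
    unfolding gauss_series_eq
  proof (rule suminf_mult)
    have "summable (\<lambda>k. d k * Beta (p + of_nat k) q)"
    proof (rule summable_norm_cancel, rule summable_comparison_test'[OF bs])
      fix k :: nat
      have "norm (Beta (p + of_nat k) q) \<le> Beta (Re (p + of_nat k)) (Re q)"
      proof -
        have P: "Re (p + of_nat k) > 0" using p by simp
        show ?thesis
          unfolding Beta_integral_half_line(2)[OF P q, symmetric] Beta_integral_half_line_norm[OF P q, symmetric]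
          unfolding set_lebesgue_integral_def by (rule order.trans[OF integral_norm_bound]) simp
      qed
      thus "norm (norm (d k * Beta (p + of_nat k) q)) \<le> norm (d k) * Beta (Re (p + of_nat k)) (Re q)"
        by (simp add: norm_mult mult_left_mono)
    qed
    moreover have "Beta p q \<noteq> 0" using p q by (simp add: Beta_def Gamma_eq_zero_iff Re_pos_notin_nonpos_Ints)
    moreover have "d k * Beta (p + of_nat k) q = Beta p q * (gauss_coeff A p (p + q) k * z ^ k)" for k
      unfolding Beta_plus_nat_left[OF p q] by (simp add: d_def gauss_coeff_def mult_ac)
    ultimately show "summable (\<lambda>k. gauss_coeff A p (p + q) k * z ^ k)" by (simp add: summable_cmult_iff)
  qed
  finally show ?thesis .
qed

lemma summable_gauss_power:
  assumes "Re A > 0" "Re B > 0" "Re C > 0" "0 \<le> u" "u < 1"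
  shows "summable (\<lambda>k. norm (gauss_coeff A B C k) * u ^ k)"
proof -
  obtain K where K: "K > 0" "\<And>n. n > 0 \<Longrightarrow> norm (gauss_coeff A B C n) \<le> K * real n powr (Re A + Re B - Re C - 1)"
    using gauss_coeff_bound[OF assms(1-3)] by blast
  define r where "r = Re A + Re B - Re C - 1"
  have s: "summable (\<lambda>k. real k powr r * u ^ k)"
  proof (cases "u = 0")
    case True
    have "(\<lambda>k. real k powr r * u ^ k) = (\<lambda>k. if k = 0 then real k powr r else 0)" using True by (auto simp: fun_eq_iff)
    thus ?thesis by simp
  next
    case False
    hence u: "0 < u" using assms by simp
    \<comment> \<open>Since u = t * t, one factor t^k absorbs the power of k and the other remains
      as a convergent geometric series.\<close>
    define t where "t = sqrt u"
    have t: "0 < t" "t < 1" "u = t * t" using u assms by (auto simp: t_def)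
    have "(\<lambda>k. real k powr r * t ^ k) \<longlonglongrightarrow> 0"
      using t by real_asymp
    hence "\<forall>\<^sub>F k in sequentially. norm (real k powr r * t ^ k) < 1"
      using tendstoD[OF \<open>_ \<longlonglongrightarrow> 0\<close>, of 1] by (simp only: dist_norm diff_zero zero_less_one)
    hence "\<forall>\<^sub>F k in sequentially. norm (real k powr r * u ^ k) \<le> t ^ k"
    proof eventually_elim
      case (elim k)
      have "norm (real k powr r * u ^ k) = norm (real k powr r * t ^ k) * t ^ k"
        using t by (simp add: power_mult_distrib abs_mult)
      also have "\<dots> \<le> 1 * t ^ k" using elim t by (intro mult_right_mono) auto
      finally show ?case by simp
    qed
    thus ?thesis using t by (intro summable_comparison_test_ev[OF _ summable_geometric]) auto
  qed
  show ?thesis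
  proof (rule summable_comparison_test_ev[OF _ summable_mult[OF s, of K]])
    show "\<forall>\<^sub>F n in sequentially. norm (norm (gauss_coeff A B C n) * u ^ n) \<le> K * (real n powr r * u ^ n)"
      using eventually_gt_at_top[of 0]
    proof eventually_elim
      case (elim n)
      thus ?case using mult_right_mono[OF K(2)[OF elim], of "u ^ n"] assms by (simp add: r_def mult_ac)
    qed
  qed
qed

text \<open>This is Pfaff's transformation. For x > 1 the Gauss series at -x diverges, but 1 + x y /
  (1 + y) = (1 + x) (1 - u / (1 + y)) with u = x / (1 + x) < 1. Expanding in u / (1 + y) raises q
  instead of p, so q takes the place of p in the numerator of the coefficients.\<close>

lemma euler_integral_negative:
  assumes p: "Re p > 0" and q: "Re q > 0" and A: "Re A > 0" and x: "x > 0"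
  shows "(LINT y:{0<..}|lborel. euler_kernel A p q (of_real (- x)) y) =
     Beta p q * (rpow (1 + x) (- A) * (\<Sum>k. gauss_coeff A q (p + q) k * of_real (x / (1 + x)) ^ k))"
proof -
  define u where "u = x / (1 + x)"
  have u: "0 \<le> u" "u < 1" using x by (auto simp: u_def)
  define d where "d = (\<lambda>k. rpow (1 + x) (- A) * (pochhammer A k / fact k * of_real u ^ k))"
  have e: "d k * (rpow y (p - 1) * rpow (1 + y) (- (p + (q + of_nat k)))) =
     rpow y (p - 1) * rpow (1 + y) (- (p + q)) * rpow (1 + x) (- A) * (pochhammer A k / fact k * of_real (u / (1 + y)) ^ k)" if "y > 0" for y k
  proof -
    have "rpow (1 + y) (- (p + (q + of_nat k))) = rpow (1 + y) (- (p + q)) / of_real (1 + y) ^ k"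
      using rpow_diff[of "1 + y" "- (p + q)" "of_nat k"] rpow_of_nat[of "1 + y" k] that by (simp add: algebra_simps)
    thus ?thesis by (simp add: d_def power_divide)
  qed
  have small: "u / (1 + y) < 1" "0 \<le> u / (1 + y)" if "y > 0" for y
    using u that by (auto simp: field_simps)
  have ker: "euler_kernel A p q (of_real (- x)) y = rpow y (p - 1) * rpow (1 + y) (- (p + q)) * rpow (1 + x) (- A) * exp (- A * Ln (1 - of_real (u / (1 + y))))"
    if y: "y > 0" for y
  proof -
    have pos: "0 < 1 - u / (1 + y)" using small[OF y] by simp
    have 1: "1 - of_real (- x) * of_real (y / (1 + y)) = complex_of_real ((1 + x) * (1 - u / (1 + y)))"
    proof -
      have "1 - (- x) * (y / (1 + y)) = (1 + x) * (1 - u / (1 + y))"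
      proof -
        have "1 + x \<noteq> 0" "1 + y \<noteq> 0" using x y by auto
        thus ?thesis by (simp add: u_def divide_simps) (simp add: algebra_simps)
      qed
      thus ?thesis by (metis of_real_1 of_real_diff of_real_mult)
    qed
    have 2: "exp (- A * Ln (of_real t)) = rpow t (- A)" if "t > 0" for t
      using that by (simp add: rpow_def Ln_of_real)
    have "1 - of_real (u / (1 + y)) = complex_of_real (1 - u / (1 + y))" by simp
    moreover have "(1 + x) * (1 - u / (1 + y)) > 0" using pos x by simp
    ultimately show ?thesis unfolding euler_kernel_def 1 using pos x
      by (simp only: 2 rpow_mult add_pos_pos zero_less_one mult.assoc)
  qed
  have B: "Beta p (q + of_nat k) = Beta p q * (pochhammer q k / pochhammer (p + q) k)" for k
    using Beta_plus_nat_left[OF q p, of k] by (simp add: Beta_commute add.commute)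
  have bs: "summable (\<lambda>k. norm (d k) * Beta (Re p) (Re (q + of_nat k)))"
  proof (rule summable_comparison_test')
    show "summable (\<lambda>k. norm (rpow (1 + x) (- A)) * ((norm (pochhammer A k / fact k) * u ^ k) * Beta (Re q) (Re p)))"
      by (intro summable_mult summable_mult2 summable_binomial_series u)
    fix k :: nat
    have "0 \<le> Beta (Re q + real k) (Re p)"
      using p q by (auto intro!: Beta_real_nonneg)
    thus "norm (norm (d k) * Beta (Re p) (Re (q + of_nat k))) \<le> norm (rpow (1 + x) (- A)) * ((norm (pochhammer A k / fact k) * u ^ k) * Beta (Re q) (Re p))"
      using mult_left_mono[OF Beta_plus_nat_le[OF q p, of k], of "norm (d k)"] u
      by (simp add: d_def norm_mult norm_power norm_divide Beta_commute[of "Re p"] mult.assoc)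
  qed
  have "(LINT y:{0<..}|lborel. euler_kernel A p q (of_real (- x)) y) = (\<Sum>k. d k * Beta p (q + of_nat k))"
  proof (rule Beta_series_half_line(2)[where P="\<lambda>_. p" and Q="\<lambda>k. q + of_nat k", OF p _ bs])
    fix y :: real assume y: "y > 0"
    show "(\<lambda>k. d k * (rpow y (p - 1) * rpow (1 + y) (- (p + (q + of_nat k))))) sums euler_kernel A p q (of_real (- x)) y"
      unfolding e[OF y] ker[OF y]
    proof (intro sums_mult binomial_series_complex)
      show "norm (complex_of_real (u / (1 + y))) < 1" unfolding norm_of_real using small[OF y] by (simp del: abs_divide)
    qed
    show "summable (\<lambda>k. norm (d k * (rpow y (p - 1) * rpow (1 + y) (- (p + (q + of_nat k))))))"
      unfolding e[OF y] norm_mult[of "rpow y (p - 1) * rpow (1 + y) (- (p + q)) * rpow (1 + x) (- A)"]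
      using summable_binomial_series[OF small(2)[OF y] small(1)[OF y], of A] small(2)[OF y]
      by (intro summable_mult) (simp add: norm_mult norm_power norm_divide norm_fact del: of_real_divide abs_divide)
  qed (use q in auto)
  also have "\<dots> = (\<Sum>k. (Beta p q * rpow (1 + x) (- A)) * (gauss_coeff A q (p + q) k * of_real u ^ k))"
    unfolding B by (simp add: d_def gauss_coeff_def mult_ac)
  also have "\<dots> = (Beta p q * rpow (1 + x) (- A)) * (\<Sum>k. gauss_coeff A q (p + q) k * of_real u ^ k)"
  proof (rule suminf_mult, rule summable_norm_cancel)
    show "summable (\<lambda>k. norm (gauss_coeff A q (p + q) k * of_real u ^ k))"
      using summable_gauss_power[OF A q _ u, of "p + q"] p q u by (simp add: norm_mult norm_power)
  qed
  finally show ?thesis by (simp add: u_def mult.assoc)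
qed

section \<open>The slit plane and the holomorphy of Euler's integral\<close>

lemma open_slit_plane: "open slit_plane"
proof -
  have "complex_of_real ` {1..} = \<real> \<inter> {z. Re z \<ge> 1}"
    by (auto simp: complex_eq_iff elim!: Reals_cases)
  thus ?thesis unfolding slit_plane_def
    by (auto intro!: closed_Int closed_complex_Reals closed_halfspace_Re_ge simp: open_Compl)
qed

text \<open>If 1 - zt were a real r \<le> 0, then z = (1 - r) / t would be real and at least 1. So
  the logarithm in the kernel never meets its cut.\<close>

lemma one_minus_slit:
  assumes "z \<in> slit_plane" "0 \<le> t" "t \<le> 1"
  shows "1 - z * of_real t \<notin> \<real>\<^sub>\<le>\<^sub>0"
proof
  assume "1 - z * of_real t \<in> \<real>\<^sub>\<le>\<^sub>0"
  then obtain r where r: "r \<le> 0" "1 - z * of_real t = of_real r" by (auto elim: nonpos_Reals_cases)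
  hence zt: "z * of_real t = of_real (1 - r)" by (simp add: algebra_simps)
  hence "t \<noteq> 0" using r by auto
  hence "t > 0" using assms by simp
  hence "z = of_real ((1 - r) / t)" using zt by (simp add: field_simps)
  moreover have "(1 - r) / t \<ge> 1" using r assms \<open>t > 0\<close> by simp
  ultimately have "z \<in> complex_of_real ` {1..}" by (intro image_eqI[of _ _ "(1 - r) / t"]) auto
  thus False using assms(1) by (simp add: slit_plane_def)
qed

lemma connected_slit_plane: "connected slit_plane"
proof (rule starlike_imp_connected)
  have "closed_segment 0 z \<subseteq> slit_plane" if z: "z \<in> slit_plane" for z
  proof
    fix w assume "w \<in> closed_segment 0 z"
    then obtain t where t: "0 \<le> t" "t \<le> 1" "w = of_real t * z"
      by (auto simp: in_segment scaleR_conv_of_real)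
    show "w \<in> slit_plane"
    proof (rule ccontr)
      assume "w \<notin> slit_plane"
      then obtain r where "1 \<le> r" "of_real t * z = of_real r" using t by (auto simp: slit_plane_def)
      hence "1 - z * of_real t = of_real (1 - r)" "1 - r \<le> 0" by (auto simp: mult.commute)
      hence "1 - z * of_real t \<in> \<real>\<^sub>\<le>\<^sub>0" by (simp only: nonpos_Reals_of_real_iff)
      thus False using one_minus_slit[OF z t(1,2)] by simp
    qed
  qed
  moreover have "0 \<in> slit_plane" by (auto simp: slit_plane_def)
  ultimately show "starlike slit_plane" unfolding starlike_def by blast
qed

lemma ball_subset_slit_plane: "ball 0 1 \<subseteq> slit_plane"
  by (auto simp: slit_plane_def)

lemma euler_kernel_measurable [measurable]: "euler_kernel A p q z \<in> borel_measurable borel"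
  unfolding euler_kernel_def by measurable

text \<open>On the compact pieces [1/(n+1), n+1] differentiation under the integral applies. Since t
  = y / (1 + y) stays in the compact interval [0, 1], the factor depending on z is bounded uniformly
  for z in a compact set; the pieces therefore converge locally uniformly, at the rate of the tail
  of the beta kernel.\<close>

lemma euler_integral_holomorphic:
  fixes A p q :: complex
  assumes p: "Re p > 0" and q: "Re q > 0"
  defines "F \<equiv> \<lambda>z. LINT y:{0<..}|lborel. euler_kernel A p q z y"
  shows "F holomorphic_on slit_plane"
proof -
  define \<phi> where "\<phi> = (\<lambda>y. rpow y (p - 1) * rpow (1 + y) (- (p + q)))"
  define E where "E = (\<lambda>z t. exp (- A * Ln (1 - z * complex_of_real t)))"
  have ker: "euler_kernel A p q z y = \<phi> y * E z (y / (1 + y))" for z y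
    by (simp add: euler_kernel_def \<phi>_def E_def)
  have phi_int: "set_integrable lborel {0<..} \<phi>" unfolding \<phi>_def by (rule Beta_integral_half_line(1)[OF p q])
  have [measurable]: "\<phi> \<in> borel_measurable borel" unfolding \<phi>_def by measurable
  have bound: "\<exists>M. \<forall>z\<in>K. \<forall>y>0. norm (euler_kernel A p q z y) \<le> M * norm (\<phi> y)" if K: "compact K" "K \<subseteq> slit_plane" for K
  proof -
    have "continuous_on (K \<times> {0..1::real}) (\<lambda>(z, t). E z t)"
      unfolding E_def case_prod_beta
    proof (intro continuous_on_exp continuous_on_mult continuous_on_const continuous_on_Ln')
      show "continuous_on (K \<times> {0..1}) (\<lambda>x. 1 - fst x * complex_of_real (snd x))"
        by (intro continuous_intros)
      fix x assume "x \<in> K \<times> {0..1::real}"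
      thus "1 - fst x * complex_of_real (snd x) \<notin> \<real>\<^sub>\<le>\<^sub>0"
        using K(2) by (intro one_minus_slit) auto
    qed
    hence "compact ((\<lambda>(z, t). E z t) ` (K \<times> {0..1}))"
      using K(1) by (intro compact_continuous_image compact_Times compact_Icc)
    hence "\<exists>M. \<forall>w\<in>(\<lambda>(z, t). E z t) ` (K \<times> {0..1}). norm w \<le> M"
      using compact_imp_bounded bounded_iff by metis
    then obtain M where M: "\<forall>w\<in>(\<lambda>(z, t). E z t) ` (K \<times> {0..1}). norm w \<le> M" ..
    have "norm (euler_kernel A p q z y) \<le> M * norm (\<phi> y)" if "z \<in> K" "y > 0" for z y
    proof -
      have "(z, y / (1 + y)) \<in> K \<times> {0..1}" using that by auto
      hence "norm (case (z, y / (1 + y)) of (z, t) \<Rightarrow> E z t) \<le> M" using M by blast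
      hence "norm (E z (y / (1 + y))) \<le> M" by simp
      from mult_right_mono[OF this, of "norm (\<phi> y)"]
      show ?thesis unfolding ker norm_mult by (simp add: mult.commute)
    qed
    thus ?thesis by blast
  qed
  define B where "B = (\<lambda>n::nat. {1 / (real n + 1)..real n + 1})"
  have B0: "B n \<subseteq> {0<..}" for n by (auto simp: B_def intro: less_le_trans[rotated])
  have Bs: "B n \<in> sets borel" for n by (simp add: B_def)
  define Fn where "Fn = (\<lambda>n z. integral (B n) (euler_kernel A p q z))"
  define tail where "tail = (\<lambda>n. LINT y|lborel. (indicator {0<..} y - indicator (B n) y) * norm (\<phi> y))"
  have tail: "tail \<longlonglongrightarrow> 0"
  proof -
    have "(\<lambda>n. LINT y|lborel. (indicator {0<..} y - indicator (B n) y) * norm (\<phi> y)) \<longlonglongrightarrow> (LINT (y::real)|lborel. (0::real))"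
    proof (rule integral_dominated_convergence[where w="\<lambda>y. norm (indicator {0<..} y *\<^sub>R \<phi> y)"])
      show "integrable lborel (\<lambda>y. norm (indicator {0<..} y *\<^sub>R \<phi> y))"
        using phi_int unfolding set_integrable_def by (rule integrable_norm)
      show "(\<lambda>y. (indicator {0<..} y - indicator (B n) y) * norm (\<phi> y)) \<in> borel_measurable lborel" for n
        using Bs[of n] by measurable
      show "AE y in lborel. (\<lambda>n. (indicator {0<..} y - indicator (B n) y) * norm (\<phi> y)) \<longlonglongrightarrow> 0"
      proof (rule AE_I2, rule tendsto_eventually)
        fix y :: real
        show "\<forall>\<^sub>F n in sequentially. (indicator {0<..} y - indicator (B n) y) * norm (\<phi> y) = 0"
        proof (cases "y > 0")
          case True
          obtain N :: nat where N: "max y (1 / y) \<le> real N" using real_arch_simple by blast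
          have "y \<in> B n" if "n \<ge> N" for n
          proof -
            have "y \<le> real n + 1" "1 / y \<le> real n + 1" using N that by auto
            moreover from this(2) True have "1 / (real n + 1) \<le> y" by (simp add: field_simps)
            ultimately show ?thesis by (simp add: B_def)
          qed
          thus ?thesis using True by (intro eventually_sequentiallyI[of N]) auto
        next
          case False
          hence "y \<notin> B n" for n using B0[of n] by auto
          thus ?thesis using False by simp
        qed
      qed
      show "AE y in lborel. norm ((indicator {0<..} y - indicator (B n) y) * norm (\<phi> y)) \<le> norm (indicator {0<..} y *\<^sub>R \<phi> y)" for n
        using B0[of n] by (auto simp: indicator_def)
    qed simp
    thus ?thesis by (simp add: tail_def)
  qed
  have close: "norm (Fn n z - F z) \<le> M * tail n"
    if M: "\<forall>y>0. norm (euler_kernel A p q z y) \<le> M * norm (\<phi> y)" for n z M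
  proof -
    have I: "set_integrable lborel {0<..} (euler_kernel A p q z)"
    proof (rule set_integrable_bound[OF set_integrable_mult_right[OF phi_int, of "of_real M"]])
      show "AE x in lborel. x \<in> {0<..} \<longrightarrow> norm (euler_kernel A p q z x) \<le> norm (of_real M * \<phi> x)"
      proof (rule AE_I2, rule impI)
        fix x :: real assume "x \<in> {0<..}"
        hence "norm (euler_kernel A p q z x) \<le> M * norm (\<phi> x)" using M by simp
        also have "\<dots> \<le> \<bar>M\<bar> * norm (\<phi> x)" by (intro mult_right_mono) auto
        finally show "norm (euler_kernel A p q z x) \<le> norm (of_real M * \<phi> x)" by (simp add: norm_mult)
      qed
    qed (simp add: set_borel_measurable_def)
    have IB: "set_integrable lborel (B n) (euler_kernel A p q z)"
      by (rule set_integrable_subset[OF I]) (use Bs[of n] B0 in auto)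
    have "Fn n z = (LINT y:B n|lborel. euler_kernel A p q z y)"
      unfolding Fn_def using set_borel_integral_eq_integral(2)[OF IB] by simp
    hence "F z - Fn n z = (LINT y|lborel. indicator {0<..} y *\<^sub>R euler_kernel A p q z y - indicator (B n) y *\<^sub>R euler_kernel A p q z y)"
      using I IB unfolding F_def set_lebesgue_integral_def set_integrable_def by simp
    also have "norm \<dots> \<le> (LINT y|lborel. M * ((indicator {0<..} y - indicator (B n) y) * norm (\<phi> y)))"
    proof (rule order.trans[OF integral_norm_bound], rule integral_mono)
      show "integrable lborel (\<lambda>y. norm (indicator {0<..} y *\<^sub>R euler_kernel A p q z y - indicator (B n) y *\<^sub>R euler_kernel A p q z y))"
        using I IB unfolding set_integrable_def by (intro integrable_norm Bochner_Integration.integrable_diff)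
      have "set_integrable lborel (B n) \<phi>" by (rule set_integrable_subset[OF phi_int]) (use Bs[of n] B0 in auto)
      hence "integrable lborel (\<lambda>y. norm (indicator {0<..} y *\<^sub>R \<phi> y) - norm (indicator (B n) y *\<^sub>R \<phi> y))"
        using phi_int unfolding set_integrable_def by (intro integrable_norm Bochner_Integration.integrable_diff)
      hence "integrable lborel (\<lambda>y. (indicator {0<..} y - indicator (B n) y) * norm (\<phi> y))"
        by (simp add: left_diff_distrib)
      thus "integrable lborel (\<lambda>y. M * ((indicator {0<..} y - indicator (B n) y) * norm (\<phi> y)))"
        by (rule integrable_mult_right)
      fix y
      show "norm (indicator {0<..} y *\<^sub>R euler_kernel A p q z y - indicator (B n) y *\<^sub>R euler_kernel A p q z y)
           \<le> M * ((indicator {0<..} y - indicator (B n) y) * norm (\<phi> y))"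
        using M B0[of n] by (auto simp: indicator_def)
    qed
    also have "\<dots> = M * tail n" by (simp add: tail_def)
    finally show ?thesis by (simp add: norm_minus_commute)
  qed
  show ?thesis
  proof (rule holomorphic_uniform_sequence[OF open_slit_plane])
    show "Fn n holomorphic_on slit_plane" for n
    proof (subst holomorphic_on_open[OF open_slit_plane], intro ballI)
      fix z0 assume "z0 \<in> slit_plane"
      then obtain e where e: "e > 0" "ball z0 e \<subseteq> slit_plane" using open_slit_plane openE by blast
      have cB: "B n = cbox (1 / (real n + 1)) (real n + 1)" by (simp add: B_def)
      have "Fn n holomorphic_on ball z0 e"
        unfolding Fn_def cB
      proof (rule leibniz_rule_holomorphic[where fx="\<lambda>z y. \<phi> y * (E z (y / (1 + y)) * (A * of_real (y / (1 + y)) / (1 - z * of_real (y / (1 + y)))))"])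
        fix z y assume zy: "z \<in> ball z0 e" "y \<in> cbox (1 / (real n + 1)) (real n + 1)"
        hence y: "y > 0" using B0[of n] cB by auto
        have t: "1 - z * of_real (y / (1 + y)) \<notin> \<real>\<^sub>\<le>\<^sub>0" using y zy e by (intro one_minus_slit) auto
        hence "1 - z * of_real (y / (1 + y)) \<noteq> 0" by auto
        with t show "((\<lambda>z. euler_kernel A p q z y) has_field_derivative \<phi> y * (E z (y / (1 + y)) * (A * of_real (y / (1 + y)) / (1 - z * of_real (y / (1 + y)))))) (at z within ball z0 e)"
          unfolding ker E_def
          by (auto intro!: derivative_eq_intros simp del: of_real_divide simp: divide_simps)
      next
        have cphi: "continuous_on {0<..} \<phi>" unfolding \<phi>_def rpow_def by (intro continuous_intros) auto
        have sub: "cbox (1 / (real n + 1)) (real n + 1) \<subseteq> {0<..}" using B0[of n] cB by simp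
        {
          fix z assume z: "z \<in> ball z0 e"
          have "continuous_on (cbox (1 / (real n + 1)) (real n + 1)) (euler_kernel A p q z)"
          proof -
            let ?B = "cbox (1 / (real n + 1)) (real n + 1)"
            have "continuous_on ?B (\<lambda>y. complex_of_real (y / (1 + y)))"
            proof (intro continuous_intros ballI)
              fix y assume "y \<in> ?B"
              hence "y > 0" using sub by auto
              thus "1 + y \<noteq> 0" by simp
            qed
            hence c1: "continuous_on ?B (\<lambda>y. 1 - z * complex_of_real (y / (1 + y)))"
              by (intro continuous_on_diff continuous_on_mult continuous_on_const)
            show ?thesis unfolding ker E_def
            proof (intro continuous_on_exp continuous_on_mult continuous_on_const continuous_on_Ln' c1 continuous_on_subset[OF cphi sub])
              fix y assume "y \<in> ?B"
              hence "y > 0" using sub by auto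
              thus "1 - z * complex_of_real (y / (1 + y)) \<notin> \<real>\<^sub>\<le>\<^sub>0" using z e by (intro one_minus_slit) auto
            qed
          qed
          thus "euler_kernel A p q z integrable_on cbox (1 / (real n + 1)) (real n + 1)"
            by (rule integrable_continuous)
        }
        have nz: "1 - z * of_real (y / (1 + y)) \<notin> \<real>\<^sub>\<le>\<^sub>0" "1 - z * of_real (y / (1 + y)) \<noteq> 0" if "z \<in> ball z0 e" "y \<in> cbox (1 / (real n + 1)) (real n + 1)" for z y
        proof -
          have "y > 0" using that sub by auto
          thus "1 - z * of_real (y / (1 + y)) \<notin> \<real>\<^sub>\<le>\<^sub>0" using that e by (intro one_minus_slit) auto
          thus "1 - z * of_real (y / (1 + y)) \<noteq> 0" by auto
        qed
        have pos: "y > 0" if "y \<in> cbox (1 / (real n + 1)) (real n + 1)" for y using that sub by auto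
        show "continuous_on (ball z0 e \<times> cbox (1 / (real n + 1)) (real n + 1)) (\<lambda>(z, y). \<phi> y * (E z (y / (1 + y)) * (A * of_real (y / (1 + y)) / (1 - z * of_real (y / (1 + y))))))"
        proof -
          let ?S = "ball z0 e \<times> cbox (1 / (real n + 1)) (real n + 1)"
          have ct: "continuous_on ?S (\<lambda>x. complex_of_real (snd x / (1 + snd x)))"
          proof (intro continuous_intros ballI)
            fix x assume "x \<in> ?S"
            hence "snd x > 0" using pos by auto
            thus "1 + snd x \<noteq> 0" by simp
          qed
          have c1: "continuous_on ?S (\<lambda>x. 1 - fst x * complex_of_real (snd x / (1 + snd x)))"
            by (intro continuous_on_diff continuous_on_mult continuous_on_const continuous_on_fst continuous_on_id ct)
          have cE: "continuous_on ?S (\<lambda>x. exp (- A * Ln (1 - fst x * complex_of_real (snd x / (1 + snd x)))))"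
          proof (intro continuous_on_exp continuous_on_mult continuous_on_const continuous_on_Ln' c1)
            fix x assume "x \<in> ?S"
            thus "1 - fst x * complex_of_real (snd x / (1 + snd x)) \<notin> \<real>\<^sub>\<le>\<^sub>0"
              using nz(1)[of "fst x" "snd x"] by auto
          qed
          have cp: "continuous_on ?S (\<lambda>x. \<phi> (snd x))"
          proof (rule continuous_on_compose2[OF cphi])
            show "continuous_on ?S snd" by (intro continuous_on_snd continuous_on_id)
            show "snd ` ?S \<subseteq> {0<..}" using pos by auto
          qed
          show ?thesis unfolding case_prod_beta E_def
          proof (intro continuous_on_mult continuous_on_divide continuous_on_const ct c1 cE cp ballI)
            fix x assume "x \<in> ?S"
            thus "1 - fst x * complex_of_real (snd x / (1 + snd x)) \<noteq> 0"
              using nz(2)[of "fst x" "snd x"] by auto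
          qed
        qed
      qed auto
      hence "(Fn n) field_differentiable (at z0)"
        using e holomorphic_on_imp_differentiable_at[OF _ open_ball, of "Fn n" z0 e z0] by simp
      thus "\<exists>f'. (Fn n has_field_derivative f') (at z0)" by (simp add: field_differentiable_def)
    qed
  next
    fix z0 assume "z0 \<in> slit_plane"
    then obtain d where d: "d > 0" "cball z0 d \<subseteq> slit_plane" using open_slit_plane open_contains_cball by blast
    obtain M where M: "\<forall>z\<in>cball z0 d. \<forall>y>0. norm (euler_kernel A p q z y) \<le> M * norm (\<phi> y)"
      using bound[OF compact_cball d(2)] by blast
    have lim: "(\<lambda>n. M * tail n) \<longlonglongrightarrow> 0" using tail by (rule tendsto_mult_right_zero)
    have "uniform_limit (cball z0 d) Fn F sequentially"
    proof (rule uniform_limitI)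
      fix e :: real assume "e > 0"
      hence "\<forall>\<^sub>F n in sequentially. M * tail n < e" using lim by (simp add: order_tendstoD(2))
      thus "\<forall>\<^sub>F n in sequentially. \<forall>z\<in>cball z0 d. dist (Fn n z) (F z) < e"
      proof eventually_elim
        case (elim n)
        show ?case
        proof
          fix z assume "z \<in> cball z0 d"
          hence "norm (Fn n z - F z) \<le> M * tail n" using M by (intro close) blast
          thus "dist (Fn n z) (F z) < e" using elim by (simp add: dist_norm)
        qed
      qed
    qed
    thus "\<exists>d>0. cball z0 d \<subseteq> slit_plane \<and> uniform_limit (cball z0 d) Fn F sequentially" using d by blast
  qed
qed

text \<open>Euler's integral shows that a continuation exists, and the identity theorem on the
  connected slit plane that it is unique; together they resolve the definite description in
  \<open>hyp2F1\<close>.\<close>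

lemma hyp2F1_eq_euler:
  fixes A p q z :: complex
  assumes p: "Re p > 0" and q: "Re q > 0" and z: "z \<in> slit_plane"
  shows "hyp2F1 A p (p + q) z = (LINT y:{0<..}|lborel. euler_kernel A p q z y) / Beta p q"
proof -
  define F where "F = (\<lambda>z. (LINT y:{0<..}|lborel. euler_kernel A p q z y) / Beta p q)"
  have nz: "Beta p q \<noteq> 0" using p q by (simp add: Beta_def Gamma_eq_zero_iff Re_pos_notin_nonpos_Ints)
  have hol: "F holomorphic_on slit_plane" unfolding F_def
    using euler_integral_holomorphic[OF p q] nz by (intro holomorphic_intros) auto
  have disk: "F u = gauss_series A p (p + q) u" if "u \<in> ball 0 1" for u
    using euler_integral_disk[OF p q, of u A] that nz by (simp add: F_def)
  have uniq: "G w = F w" if G: "G holomorphic_on slit_plane" "\<forall>u\<in>ball 0 1. G u = gauss_series A p (p + q) u" and w: "w \<in> slit_plane" for G w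
  proof -
    have "(\<lambda>z. G z - F z) w = 0"
    proof (rule analytic_continuation[where f="\<lambda>z. G z - F z" and S=slit_plane and U="ball 0 1" and \<xi>=0 and w=w])
      show "(\<lambda>z. G z - F z) holomorphic_on slit_plane" by (intro holomorphic_intros G hol)
      show "0 \<in> slit_plane" using ball_subset_slit_plane by auto
      show "0 islimpt ball (0::complex) 1" by (rule open_imp_islimpt) auto
    qed (use open_slit_plane connected_slit_plane ball_subset_slit_plane w disk G in auto)
    thus ?thesis by simp
  qed
  show ?thesis
  proof (cases "z \<in> ball 0 1")
    case True
    thus ?thesis using disk[OF True] by (simp add: hyp2F1_def F_def)
  next
    case False
    have "(THE w. \<exists>F. F holomorphic_on slit_plane \<and> (\<forall>u\<in>ball 0 1. F u = gauss_series A p (p + q) u) \<and> F z = w) = F z"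
    proof (rule the_equality)
      show "\<exists>Fa. Fa holomorphic_on slit_plane \<and> (\<forall>u\<in>ball 0 1. Fa u = gauss_series A p (p + q) u) \<and> Fa z = F z"
        using hol disk by blast
    qed (use uniq z in blast)
    thus ?thesis using False z by (simp add: hyp2F1_def F_def)
  qed
qed

theorem hyp2F1_negative:
  fixes A p q :: complex
  assumes "Re p > 0" "Re q > 0" "Re A > 0" "x > 0"
  shows "hyp2F1 A p (p + q) (of_real (- x)) = rpow (1 + x) (- A) * (\<Sum>k. gauss_coeff A q (p + q) k * of_real (x / (1 + x)) ^ k)"
proof -
  have "of_real (- x) \<in> slit_plane" using assms(4) by (auto simp: slit_plane_def complex_eq_iff)
  moreover have "Beta p q \<noteq> 0" using assms by (simp add: Beta_def Gamma_eq_zero_iff Re_pos_notin_nonpos_Ints)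
  ultimately show ?thesis
    using hyp2F1_eq_euler[OF assms(1,2), of "of_real (- x)" A] euler_integral_negative[OF assms] by simp
qed

section \<open>The transform of polynomials\<close>

text \<open>The transform of \<open>(1 - z)\<^sup>n\<close>.\<close>

definition J_basis :: "real \<Rightarrow> real \<Rightarrow> real \<Rightarrow> nat \<Rightarrow> real \<Rightarrow> real" where
  "J_basis a b c n s = (\<Prod>k<n. (a + real k)\<^sup>2 + s\<^sup>2) / (Gamma (a + b + real n) * Gamma (a + c + real n))"

lemma norm_Gamma_plus_nat:
  assumes "0 < a"
  shows "(norm (Gamma (Complex (a + real n) s)))\<^sup>2 = (\<Prod>k<n. (a + real k)\<^sup>2 + s\<^sup>2) * (norm (Gamma (Complex a s)))\<^sup>2"
proof (induction n)
  case (Suc n)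
  have "Gamma (Complex (a + real (Suc n)) s) = Complex (a + real n) s * Gamma (Complex (a + real n) s)"
    using Gamma_Complex_plus1[of "a + real n" s] assms by (simp add: add_ac)
  thus ?case using Suc by (simp add: norm_mult power_mult_distrib cmod_power2)
qed simp

text \<open>After Pfaff's transformation every term of the integrand is a beta kernel with
  parameters b + c + k and q = a + n + is. The symbol (b + c)_k from the beta value cancels the one
  in the coefficient, and what remains is the series with parameters (b + is, c + is; a + b + c + n
  + is) at 1, summed by Gauss's theorem. Its excess C - A - B is the conjugate of q, so the Gamma
  factors combine to |Gamma q|^2.\<close>

lemma J_basis_integral:
  fixes a b c s :: real
  assumes pos: "0 < a" "0 < b" "0 < c"
  shows "set_integrable lborel {0<..} (J_integrand a b c (\<lambda>z. (1 - z) ^ n) s)"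
    and "J_integral a b c (\<lambda>z. (1 - z) ^ n) s = of_real (J_basis a b c n s)"
proof -
  define A where "A = Complex b s"
  define B where "B = Complex c s"
  define p where "p = Complex b (- s)"
  define q where "q = Complex (a + real n) s"
  define d where "d = gauss_coeff A B (of_real (b + c))"
  define P where "P = (\<lambda>k::nat. complex_of_real (b + c) + of_nat k)"
  have pq: "p + B = of_real (b + c)" by (simp add: p_def B_def complex_eq_iff)
  have Re: "Re A > 0" "Re B > 0" "Re p > 0" "Re q > 0" "Re (complex_of_real (b + c)) > 0" "\<And>k. Re (P k) > 0"
    using pos by (auto simp: A_def B_def p_def q_def P_def)
  have integrand: "J_integrand a b c (\<lambda>z. (1 - z) ^ n) s x = (\<Sum>k. d k * (rpow x (P k - 1) * rpow (1 + x) (- (P k + q))))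
     \<and> summable (\<lambda>k. norm (d k * (rpow x (P k - 1) * rpow (1 + x) (- (P k + q)))))" if x: "x > 0" for x
  proof -
    define u where "u = x / (1 + x)"
    have u: "0 \<le> u" "u < 1" using x by (auto simp: u_def)
    have x1: "1 + x > 0" using x by simp
    have h: "hyp2F1 (of_real b + \<i> * of_real s) (of_real b - \<i> * of_real s) (of_real (b + c)) (of_real (- x))
        = rpow (1 + x) (- A) * (\<Sum>k. d k * of_real u ^ k)"
    proof -
      have e: "of_real b + \<i> * of_real s = A" "of_real b - \<i> * of_real s = p" by (simp_all add: A_def p_def complex_eq_iff)
      show ?thesis unfolding e using hyp2F1_negative[OF Re(3,2,1) x] unfolding pq d_def u_def .
    qed
    define V where "V = rpow x (of_real (b + c - 1)) * rpow (1 + x) (- (of_real (a + c + real n) + A))"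
    have sm: "summable (\<lambda>k. norm (d k) * u ^ k)" unfolding d_def by (rule summable_gauss_power[OF Re(1,2,5) u])
    have summand: "d k * (rpow x (P k - 1) * rpow (1 + x) (- (P k + q))) = V * (d k * of_real u ^ k)" for k
    proof -
      have "P k - 1 = of_real (b + c - 1) + of_nat k" by (simp add: P_def)
      moreover have "- (P k + q) = - (of_real (a + c + real n) + A) - of_nat k"
        by (simp add: P_def q_def A_def complex_eq_iff)
      ultimately show ?thesis
        unfolding V_def by (simp only: rpow_add rpow_diff rpow_of_nat[OF x] rpow_of_nat[OF x1] u_def of_real_divide power_divide) simp
    qed
    have "J_integrand a b c (\<lambda>z. (1 - z) ^ n) s x = V * (\<Sum>k. d k * of_real u ^ k)"
    proof -
      have "1 - of_real (x / (x + 1)) = complex_of_real (1 / (1 + x))"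
      proof -
        have "1 - x / (x + 1) = 1 / (1 + x)" using x by (simp add: field_simps)
        thus ?thesis by (metis of_real_1 of_real_diff)
      qed
      hence 1: "(1 - complex_of_real (x / (x + 1))) ^ n = rpow (1 + x) (- of_nat n)"
        unfolding rpow_minus rpow_of_nat[OF x1] by (simp add: power_divide)
      have 2: "complex_of_real ((1 + x) powr r) = rpow (1 + x) (of_real r)" "complex_of_real (x powr r) = rpow x (of_real r)" for r
        using rpow_of_real[OF x] rpow_of_real[OF x1] by simp_all
      \<comment> \<open>Collects the exponents of 1 + x from the two powers of the integrand, from
        (1 - z)^n and from Pfaff's transformation.\<close>
      have 3: "- (of_real (a + c + real n) + A) = of_real (- a - b) + (- of_nat n) + (- A) + of_real (b - c)"
        by simp
      show ?thesis unfolding J_integrand_def 1 h of_real_mult 2 V_def 3 rpow_add by (simp only: mult_ac)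
    qed
    also have "\<dots> = (\<Sum>k. V * (d k * of_real u ^ k))"
    proof (rule suminf_mult[symmetric], rule summable_norm_cancel)
      show "summable (\<lambda>k. norm (d k * of_real u ^ k))" using sm u by (simp add: norm_mult norm_power)
    qed
    finally have "J_integrand a b c (\<lambda>z. (1 - z) ^ n) s x = (\<Sum>k. d k * (rpow x (P k - 1) * rpow (1 + x) (- (P k + q))))"
      unfolding summand .
    moreover have "summable (\<lambda>k. norm (d k * (rpow x (P k - 1) * rpow (1 + x) (- (P k + q)))))"
      unfolding summand norm_mult[of V] using sm u by (intro summable_mult) (simp add: norm_mult norm_power)
    ultimately show ?thesis by blast
  qed
  have Beta_P: "Beta (P k) q = Beta (of_real (b + c)) q * (pochhammer (of_real (b + c)) k / pochhammer (of_real (b + c) + q) k)" for k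
    unfolding P_def by (rule Beta_plus_nat_left) (use Re in auto)
  \<comment> \<open>With Re q in place of q the terms are, up to a constant, the moduli of another
    Gauss series at 1, whose excess has real part a + n > 0.\<close>
  have bs: "summable (\<lambda>k. norm (d k) * Beta (Re (P k)) (Re q))"
  proof -
    have q': "Re (of_real (Re q) :: complex) > 0" using Re(4) by simp
    have eq: "d k * (pochhammer (of_real (b + c)) k / pochhammer (of_real (b + c) + of_real (Re q)) k)
        = gauss_coeff A B (of_real (b + c) + of_real (Re q)) k" for k
    proof -
      have "pochhammer (complex_of_real (b + c)) k \<noteq> 0"
        using pochhammer_eq_0_imp_nonpos_Int Re_pos_notin_nonpos_Ints[OF Re(5)] by blast
      thus ?thesis by (simp add: d_def gauss_coeff_def)
    qed
    have "summable (\<lambda>k. norm (gauss_coeff A B (of_real (b + c) + of_real (Re q)) k))"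
      using pos by (intro summable_gauss_coeff(1) Re) (auto simp: A_def B_def q_def)
    hence "summable (\<lambda>k. norm (Beta (of_real (b + c)) (complex_of_real (Re q))) * norm (gauss_coeff A B (of_real (b + c) + of_real (Re q)) k))"
      by (rule summable_mult)
    also have "(\<lambda>k. norm (Beta (of_real (b + c)) (complex_of_real (Re q))) * norm (gauss_coeff A B (of_real (b + c) + of_real (Re q)) k))
       = (\<lambda>k. norm (d k) * Beta (Re (P k)) (Re q))"
    proof
      fix k
      have "complex_of_real (Beta (Re (P k)) (Re q)) = Beta (of_real (b + c) + of_nat k) (of_real (Re q))"
        by (simp add: P_def Beta_complex_of_real[symmetric])
      also have "\<dots> = Beta (of_real (b + c)) (of_real (Re q)) * (pochhammer (of_real (b + c)) k / pochhammer (of_real (b + c) + of_real (Re q)) k)"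
        by (rule Beta_plus_nat_left[OF Re(5) q'])
      finally have "d k * complex_of_real (Beta (Re (P k)) (Re q)) = Beta (of_real (b + c)) (of_real (Re q)) * gauss_coeff A B (of_real (b + c) + of_real (Re q)) k"
        unfolding eq[symmetric] by simp
      hence "norm (d k * complex_of_real (Beta (Re (P k)) (Re q))) = norm (Beta (of_real (b + c)) (complex_of_real (Re q))) * norm (gauss_coeff A B (of_real (b + c) + of_real (Re q)) k)"
        by (simp only: norm_mult)
      moreover have "Beta (Re (P k)) (Re q) \<ge> 0"
        using Re(4) Re(6)[of k] by (auto intro!: Beta_real_nonneg)
      ultimately show "norm (Beta (of_real (b + c)) (complex_of_real (Re q))) * norm (gauss_coeff A B (of_real (b + c) + of_real (Re q)) k) = norm (d k) * Beta (Re (P k)) (Re q)"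
        by (simp add: norm_mult)
    qed
    finally show ?thesis .
  qed
  have series: "(\<lambda>k. d k * (rpow x (P k - 1) * rpow (1 + x) (- (P k + q)))) sums J_integrand a b c (\<lambda>z. (1 - z) ^ n) s x"
    if "x > 0" for x
    using integrand[OF that] by (auto simp: sums_iff intro: summable_norm_cancel)
  note main = Beta_series_half_line[where P=P and Q="\<lambda>_. q", OF Re(6) Re(4) bs series conjunct2[OF integrand]]
  show "set_integrable lborel {0<..} (J_integrand a b c (\<lambda>z. (1 - z) ^ n) s)"
    by (rule main(1))
  have "(LINT x:{0<..}|lborel. J_integrand a b c (\<lambda>z. (1 - z) ^ n) s x) = (\<Sum>k. d k * Beta (P k) q)"
    by (rule main(2))
  also have "\<dots> = (\<Sum>k. Beta (of_real (b + c)) q * gauss_coeff A B (of_real (b + c) + q) k)"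
  proof -
    have "pochhammer (complex_of_real (b + c)) k \<noteq> 0" for k
      using pochhammer_eq_0_imp_nonpos_Int Re_pos_notin_nonpos_Ints[OF Re(5)] by blast
    thus ?thesis unfolding Beta_P by (simp add: d_def gauss_coeff_def mult_ac)
  qed
  also have "\<dots> = Beta (of_real (b + c)) q * (\<Sum>k. gauss_coeff A B (of_real (b + c) + q) k)"
  proof (rule suminf_mult, rule summable_norm_cancel, rule summable_gauss_coeff(1))
    show "0 < Re (of_real (b + c) + q - A - B)" using pos by (simp add: A_def B_def q_def)
  qed (use Re in auto)
  also have "(\<Sum>k. gauss_coeff A B (of_real (b + c) + q) k) = Gamma (of_real (b + c) + q) * Gamma (of_real (b + c) + q - A - B) / (Gamma (of_real (b + c) + q - A) * Gamma (of_real (b + c) + q - B))"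
  proof (rule Gauss_summation)
    show "0 < Re (of_real (b + c) + q - A - B)" using pos by (simp add: A_def B_def q_def)
  qed (use Re in auto)
  also have "of_real (b + c) + q - A - B = cnj q" by (simp add: A_def B_def q_def complex_eq_iff)
  also have "of_real (b + c) + q - A = of_real (a + c + real n)" by (simp add: A_def B_def q_def complex_eq_iff)
  also have "of_real (b + c) + q - B = of_real (a + b + real n)" by (simp add: A_def B_def q_def complex_eq_iff)
  also have "Beta (of_real (b + c)) q * (Gamma (of_real (b + c) + q) * Gamma (cnj q) / (Gamma (of_real (a + c + real n)) * Gamma (of_real (a + b + real n))))
      = of_real (Gamma (b + c)) * (Gamma q * Gamma (cnj q)) / (of_real (Gamma (a + c + real n)) * of_real (Gamma (a + b + real n)))"
  proof -
    have "Gamma (of_real (b + c) + q) \<noteq> 0" using Re(4,5) by (simp add: Gamma_eq_zero_iff Re_pos_notin_nonpos_Ints)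
    thus ?thesis by (simp add: Beta_def Gamma_complex_of_real del: of_real_add)
  qed
  also have "Gamma q * Gamma (cnj q) = of_real ((norm (Gamma q))\<^sup>2)" by (simp only: complex_norm_square cnj_Gamma)
  also have "(norm (Gamma q))\<^sup>2 = (\<Prod>k<n. (a + real k)\<^sup>2 + s\<^sup>2) * (norm (Gamma (Complex a s)))\<^sup>2"
    unfolding q_def by (rule norm_Gamma_plus_nat[OF pos(1)])
  finally have val: "(LINT x:{0<..}|lborel. J_integrand a b c (\<lambda>z. (1 - z) ^ n) s x) =
     of_real (Gamma (b + c)) * of_real ((\<Prod>k<n. (a + real k)\<^sup>2 + s\<^sup>2) * (norm (Gamma (Complex a s)))\<^sup>2) / (of_real (Gamma (a + c + real n)) * of_real (Gamma (a + b + real n)))" .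
  have "norm (Gamma (Complex a s)) \<noteq> 0" using Complex_notin_nonpos_Ints[OF pos(1)] by (simp add: Gamma_eq_zero_iff)
  moreover have "0 < Gamma (b + c)" using pos by (intro Gamma_real_pos) simp
  hence "Gamma (b + c) \<noteq> 0" by simp
  moreover have "of_real a + \<i> * of_real s = Complex a s" by (simp add: complex_eq_iff)
  ultimately show "J_integral a b c (\<lambda>z. (1 - z) ^ n) s = of_real (J_basis a b c n s)"
    unfolding J_integral_def val J_basis_def by (simp add: mult_ac)
qed

text \<open>The image of z^n, from z^n = (1 - (1 - z))^n. In the usual notation it is S_n(s^2; a, b,
  c) / (Gamma(a + b + n) Gamma(a + c + n)), with S_n the continuous dual Hahn polynomial.\<close>

definition dual_hahn :: "real \<Rightarrow> real \<Rightarrow> real \<Rightarrow> nat \<Rightarrow> real \<Rightarrow> real" where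
  "dual_hahn a b c n s = (\<Sum>k\<le>n. (-1) ^ k * real (n choose k) * J_basis a b c k s)"

lemma J_integrand_poly:
  "J_integrand a b c (poly p) s x = (\<Sum>n\<le>degree p. coeff p n * (\<Sum>k\<le>n. of_real ((-1) ^ k * real (n choose k)) * J_integrand a b c (\<lambda>z. (1 - z) ^ k) s x))"
proof -
  have zn: "z ^ n = (\<Sum>k\<le>n. of_real ((-1) ^ k * real (n choose k)) * (1 - z) ^ k)" for z :: complex and n
  proof -
    have pm: "(- (1 - z)) ^ k = (- 1) ^ k * (1 - z) ^ k" for k by (rule power_minus)
    have "(- (1 - z) + 1) ^ n = (\<Sum>k\<le>n. of_nat (n choose k) * (- (1 - z)) ^ k * 1 ^ (n - k))"
      by (rule binomial_ring)
    also have "\<dots> = (\<Sum>k\<le>n. of_real ((-1) ^ k * real (n choose k)) * (1 - z) ^ k)"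
      unfolding pm by (intro sum.cong refl) simp
    finally show ?thesis by simp
  qed
  have *: "poly p z = (\<Sum>n\<le>degree p. coeff p n * (\<Sum>k\<le>n. of_real ((-1) ^ k * real (n choose k)) * (1 - z) ^ k))" for z
    unfolding poly_altdef by (intro sum.cong refl arg_cong2[where f="(*)"] zn)
  have "J_integrand a b c g s x = J_integrand a b c (\<lambda>_. 1) s x * g (of_real (x / (x + 1)))" for g
    by (simp add: J_integrand_def mult_ac)
  note ** = this
  show ?thesis
    unfolding **[of "poly p"] **[of "\<lambda>z. (1 - z) ^ _"] *
    by (simp add: sum_distrib_left mult_ac)
qed

lemma
  assumes pos: "0 < a" "0 < b" "0 < c"
  shows set_integrable_J_poly: "set_integrable lborel {0<..} (J_integrand a b c (poly p) s)"
    and J_integral_poly: "J_integral a b c (poly p) s = (\<Sum>n\<le>degree p. coeff p n * of_real (dual_hahn a b c n s))"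
proof -
  let ?I = "\<lambda>k. J_integrand a b c (\<lambda>z. (1 - z) ^ k) s"
  have int: "set_integrable lborel {0<..} (?I k)" for k by (rule J_basis_integral(1)[OF pos])
  have e: "indicator {0<..} x *\<^sub>R J_integrand a b c (poly p) s x =
     (\<Sum>n\<le>degree p. coeff p n * (\<Sum>k\<le>n. of_real ((-1) ^ k * real (n choose k)) * (indicator {0<..} x *\<^sub>R ?I k x)))" for x
    unfolding J_integrand_poly by (auto simp: indicator_def)
  have i2: "integrable lborel (\<lambda>x. indicator {0<..} x *\<^sub>R ?I k x)" for k using int[of k] by (simp add: set_integrable_def)
  show "set_integrable lborel {0<..} (J_integrand a b c (poly p) s)"
    unfolding set_integrable_def e
    by (intro Bochner_Integration.integrable_sum integrable_mult_right i2)
  have "(LINT x:{0<..}|lborel. J_integrand a b c (poly p) s x) =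
     (\<Sum>n\<le>degree p. coeff p n * (\<Sum>k\<le>n. of_real ((-1) ^ k * real (n choose k)) * (LINT x:{0<..}|lborel. ?I k x)))"
    unfolding set_lebesgue_integral_def e
    by (subst Bochner_Integration.integral_sum integral_mult_right_zero | intro Bochner_Integration.integrable_sum integrable_mult_right i2 sum.cong refl arg_cong2[where f="(*)"])+
  hence "J_integral a b c (poly p) s = (\<Sum>n\<le>degree p. coeff p n * (\<Sum>k\<le>n. of_real ((-1) ^ k * real (n choose k)) * J_integral a b c (\<lambda>z. (1 - z) ^ k) s))"
    unfolding J_integral_def by (simp add: sum_distrib_left mult_ac)
  thus "J_integral a b c (poly p) s = (\<Sum>n\<le>degree p. coeff p n * of_real (dual_hahn a b c n s))"
    unfolding J_basis_integral(2)[OF pos] dual_hahn_def by simp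
qed

section \<open>Orthogonality of the continuous dual Hahn polynomials\<close>

lemma spectral_measure_eq:
  "spectral_measure a b c = density (restrict_space lborel {0..}) (\<lambda>s. ennreal (hahn_weight a b c s / (2 * pi)))"
proof -
  have e: "of_real x + \<i> * of_real s = Complex x s" "2 * \<i> * of_real s = Complex 0 (2 * s)" for x s :: real
    by (simp_all add: complex_eq_iff)
  show ?thesis unfolding spectral_measure_def hahn_weight_def e by simp
qed

lemma sets_spectral_measure: "sets (spectral_measure a b c) = sets (restrict_space borel {0..})"
  by (simp add: spectral_measure_eq cong: sets_restrict_space_cong)

lemma borel_measurable_spectral:
  "f \<in> borel_measurable (borel :: real measure) \<Longrightarrow> f \<in> borel_measurable (spectral_measure a b c)"
  by (simp add: spectral_measure_eq measurable_restrict_space1)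

lemma spectral_integral:
  fixes h :: "real \<Rightarrow> 'b :: {banach, second_countable_topology}"
  assumes pos: "0 < a" "0 < b" "0 < c" and h: "h \<in> borel_measurable (spectral_measure a b c)"
  shows "integrable (spectral_measure a b c) h \<longleftrightarrow> integrable lborel (\<lambda>s. indicator {0..} s *\<^sub>R ((hahn_weight a b c s / (2 * pi)) *\<^sub>R h s))"
    and "(LINT s|spectral_measure a b c. h s) = (LINT s|lborel. indicator {0..} s *\<^sub>R ((hahn_weight a b c s / (2 * pi)) *\<^sub>R h s))"
proof -
  have h': "h \<in> borel_measurable (restrict_space lborel {0..})" using h by (simp add: spectral_measure_eq)
  have w: "(\<lambda>s. hahn_weight a b c s / (2 * pi)) \<in> borel_measurable (restrict_space lborel {0..})"
    using borel_measurable_continuous_onI[OF continuous_hahn_weight[OF pos]] by (intro measurable_restrict_space1) simp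
  have nn: "AE s in restrict_space lborel {0..}. 0 \<le> hahn_weight a b c s / (2 * pi)"
    by (simp add: hahn_weight_nonneg)
  show "integrable (spectral_measure a b c) h \<longleftrightarrow> integrable lborel (\<lambda>s. indicator {0..} s *\<^sub>R ((hahn_weight a b c s / (2 * pi)) *\<^sub>R h s))"
    unfolding spectral_measure_eq integrable_density[OF h' w nn]
    by (subst integrable_restrict_space) auto
  show "(LINT s|spectral_measure a b c. h s) = (LINT s|lborel. indicator {0..} s *\<^sub>R ((hahn_weight a b c s / (2 * pi)) *\<^sub>R h s))"
    unfolding spectral_measure_eq integral_density[OF h' w nn]
    by (subst integral_restrict_space) auto
qed

lemma integral_even_half:
  fixes g :: "real \<Rightarrow> real"
  assumes int: "integrable lborel g" and even: "\<And>s. g (- s) = g s"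
  shows "(LINT s|lborel. indicator {0..} s *\<^sub>R g s) = (LINT s|lborel. g s) / 2"
proof -
  have [measurable]: "g \<in> borel_measurable borel" using int by (simp add: integrable_iff_bounded)
  have i: "integrable lborel (\<lambda>s. indicator S s *\<^sub>R g s)" if "S \<in> sets borel" for S
    using integrable_mult_indicator[of S lborel g] int that by simp
  have "(LINT s|lborel. indicator {..<0} s *\<^sub>R g s) = \<bar>-1\<bar> *\<^sub>R (LINT s|lborel. indicator {..<0} (0 + (-1) * s) *\<^sub>R g (0 + (-1) * s))"
    by (rule lborel_integral_real_affine) simp
  also have "\<dots> = (LINT s|lborel. indicator {0<..} s *\<^sub>R g s)"
    by (simp add: even indicator_def)
  also have "\<dots> = (LINT s|lborel. indicator {0..} s *\<^sub>R g s)"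
  proof (rule integral_cong_AE)
    show "AE s in lborel. indicator {0<..} s *\<^sub>R g s = indicator {0..} s *\<^sub>R g s"
      using AE_lborel_singleton[of 0] by eventually_elim (auto simp: indicator_def)
  qed measurable
  finally have neg: "(LINT s|lborel. indicator {..<0} s *\<^sub>R g s) = (LINT s|lborel. indicator {0..} s *\<^sub>R g s)" .
  have "(LINT s|lborel. g s) = (LINT s|lborel. indicator {0..} s *\<^sub>R g s + indicator {..<0} s *\<^sub>R g s)"
    by (intro Bochner_Integration.integral_cong) (auto simp: indicator_def)
  also have "\<dots> = (LINT s|lborel. indicator {0..} s *\<^sub>R g s) + (LINT s|lborel. indicator {..<0} s *\<^sub>R g s)"
    by (intro Bochner_Integration.integral_add i) auto
  finally show ?thesis unfolding neg by simp
qed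

text \<open>In the variable s^2 this is (a + is)_n (a - is)_n, monic of degree n; multiplying the
  weight by it raises \<open>a\<close> by n.\<close>

definition shift_poly :: "real \<Rightarrow> nat \<Rightarrow> real poly" where
  "shift_poly a n = (\<Prod>k<n. [:(a + real k)\<^sup>2, 1:])"

lemma poly_shift_poly: "poly (shift_poly a n) (s\<^sup>2) = (\<Prod>k<n. (a + real k)\<^sup>2 + s\<^sup>2)"
  by (simp add: shift_poly_def poly_prod)

lemma degree_shift_poly: "degree (shift_poly a n) = n" and lead_shift_poly: "coeff (shift_poly a n) n = 1"
proof -
  have "lead_coeff (shift_poly a n) = 1 \<and> degree (shift_poly a n) = n"
  proof (induction n)
    case (Suc n)
    have S: "shift_poly a (Suc n) = shift_poly a n * [:(a + real n)\<^sup>2, 1:]" by (simp add: shift_poly_def)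
    have c: "coeff (shift_poly a n) n = 1" using conjunct1[OF Suc, unfolded conjunct2[OF Suc]] .
    hence "shift_poly a n \<noteq> 0" by auto
    hence "degree (shift_poly a (Suc n)) = Suc n" unfolding S using Suc by (subst degree_mult_eq) auto
    moreover have "lead_coeff (shift_poly a (Suc n)) = 1" unfolding S lead_coeff_mult using Suc c by simp
    ultimately show ?case by simp
  qed (simp add: shift_poly_def)
  thus "degree (shift_poly a n) = n" "coeff (shift_poly a n) n = 1" by auto
qed

lemma shift_poly_hahn_weight: "0 < a \<Longrightarrow> poly (shift_poly a n) (s\<^sup>2) * hahn_weight a b c s = hahn_weight (a + real n) b c s"
proof (induction n)
  case (Suc n)
  have "hahn_weight (a + real (Suc n)) b c s = ((a + real n)\<^sup>2 + s\<^sup>2) * hahn_weight (a + real n) b c s"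
    using hahn_weight_plus1[of "a + real n" b c s] Suc.prems by (simp add: add_ac)
  moreover have "poly (shift_poly a (Suc n)) (s\<^sup>2) = ((a + real n)\<^sup>2 + s\<^sup>2) * poly (shift_poly a n) (s\<^sup>2)"
    by (simp add: shift_poly_def algebra_simps)
  ultimately show ?case using Suc by (simp add: mult.assoc)
qed (simp add: shift_poly_def)

text \<open>One polynomial of each degree spans, because a multiple of \<open>B n\<close> removes
  the top coefficient. Put as an induction principle for linear properties, it serves integrability,
  orthogonality and completeness, with \<open>shift_poly a\<close>, \<open>shift_poly b\<close> and
  \<open>hahn_poly\<close> as bases.\<close>

lemma poly_as_shift_poly:
  fixes P :: "real poly \<Rightarrow> bool"
  assumes basis: "\<And>k. k \<le> n \<Longrightarrow> P (B k)" and B: "\<And>k. k \<le> n \<Longrightarrow> degree (B k) = k \<and> coeff (B k) k \<noteq> 0"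
    and add: "\<And>f g. P f \<Longrightarrow> P g \<Longrightarrow> P (f + g)" and smult: "\<And>r f. P f \<Longrightarrow> P (smult r f)"
    and f: "degree f \<le> n"
  shows "P f"
  using basis B f
proof (induction n arbitrary: f)
  case 0
  have "f = smult (coeff f 0 / coeff (B 0) 0) (B 0)"
  proof (rule poly_eqI)
    fix i show "coeff f i = coeff (smult (coeff f 0 / coeff (B 0) 0) (B 0)) i"
      using 0(2)[of 0] 0(3) by (cases "i = 0") (auto simp: coeff_eq_0)
  qed
  moreover have "P (smult (coeff f 0 / coeff (B 0) 0) (B 0))" by (intro smult 0(1)) simp
  ultimately show ?case by (rule ssubst)
next
  case (Suc n)
  define r where "r = coeff f (Suc n) / coeff (B (Suc n)) (Suc n)"
  have B: "degree (B (Suc n)) = Suc n" "coeff (B (Suc n)) (Suc n) \<noteq> 0" using Suc.prems(2)[of "Suc n"] by auto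
  have "degree (f - smult r (B (Suc n))) \<le> n"
  proof (rule degree_le, intro allI impI)
    fix i assume "n < i"
    show "coeff (f - smult r (B (Suc n))) i = 0"
    proof (cases "i = Suc n")
      case False
      hence "degree f < i" "degree (B (Suc n)) < i" using \<open>n < i\<close> Suc.prems(3) B by auto
      thus ?thesis by (simp add: coeff_eq_0)
    qed (use B in \<open>simp add: r_def\<close>)
  qed
  hence 1: "P (f - smult r (B (Suc n)))"
    by (rule Suc.IH[rotated 2]) (use Suc.prems(1,2) le_SucI in blast)+
  have "P (smult r (B (Suc n)))" by (intro smult Suc.prems(1)) simp
  from add[OF 1 this] show ?case by (simp only: diff_add_cancel)
qed

lemma integrable_poly_hahn_weight:
  assumes pos: "0 < a" "0 < b" "0 < c"
  shows "integrable lborel (\<lambda>s. poly f (s\<^sup>2) * hahn_weight a b c s)"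
proof (rule poly_as_shift_poly[where n="degree f" and B="shift_poly a" and P="\<lambda>f. integrable lborel (\<lambda>s. poly f (s\<^sup>2) * hahn_weight a b c s)"])
  fix k show "integrable lborel (\<lambda>s. poly (shift_poly a k) (s\<^sup>2) * hahn_weight a b c s)"
    unfolding shift_poly_hahn_weight[OF pos(1)] using pos by (intro integrable_hahn_weight) auto
qed (auto simp: degree_shift_poly lead_shift_poly distrib_right mult.assoc)

text \<open>In 4 pi one factor 2 pi normalises the measure and a factor 2 passes from the half-line
  to the line, so this is the integral of f(s^2) against \<open>spectral_measure\<close>.\<close>

definition hahn_functional :: "real \<Rightarrow> real \<Rightarrow> real \<Rightarrow> real poly \<Rightarrow> real" where
  "hahn_functional a b c f = (LINT s|lborel. poly f (s\<^sup>2) * hahn_weight a b c s) / (4 * pi)"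

lemma hahn_functional_add:
  assumes "0 < a" "0 < b" "0 < c"
  shows "hahn_functional a b c (f + g) = hahn_functional a b c f + hahn_functional a b c g"
  using integrable_poly_hahn_weight[OF assms] by (simp add: hahn_functional_def distrib_right add_divide_distrib)

lemma hahn_functional_smult: "hahn_functional a b c (smult r f) = r * hahn_functional a b c f"
  by (simp add: hahn_functional_def mult.assoc)

lemma hahn_functional_sum:
  assumes "0 < a" "0 < b" "0 < c" and "finite A"
  shows "hahn_functional a b c (\<Sum>i\<in>A. f i) = (\<Sum>i\<in>A. hahn_functional a b c (f i))"
  using assms(4) by (induction A rule: finite_induct) (auto simp: hahn_functional_add[OF assms(1-3)] hahn_functional_def[of a b c 0])

text \<open>The two factors raise \<open>a\<close> by k and \<open>b\<close> by m, so the value is a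
  total mass. Taking the second family with \<open>b\<close> makes Gamma(a + b + k + m) the only
  factor in which k and m meet.\<close>

lemma hahn_functional_shift:
  assumes pos: "0 < a" "0 < b" "0 < c"
  shows "hahn_functional a b c (shift_poly a k * shift_poly b m) =
     Gamma (a + b + real k + real m) * Gamma (a + c + real k) * Gamma (b + c + real m)"
proof -
  have "poly (shift_poly a k * shift_poly b m) (s\<^sup>2) * hahn_weight a b c s = hahn_weight (a + real k) (b + real m) c s" for s
  proof -
    have "poly (shift_poly a k * shift_poly b m) (s\<^sup>2) * hahn_weight a b c s = poly (shift_poly b m) (s\<^sup>2) * hahn_weight b (a + real k) c s"
      using shift_poly_hahn_weight[OF pos(1), of k s b c] by (simp add: mult_ac hahn_weight_commute(1)[of b "a + real k"])
    also have "\<dots> = hahn_weight (a + real k) (b + real m) c s"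
      using shift_poly_hahn_weight[OF pos(2), of m s "a + real k" c] by (simp add: hahn_weight_commute(1)[of "b + real m" "a + real k"])
    finally show ?thesis .
  qed
  hence "hahn_functional a b c (shift_poly a k * shift_poly b m) = hahn_integral (a + real k) (b + real m) c / (4 * pi)"
    by (simp add: hahn_functional_def hahn_integral_def)
  also have "\<dots> = Gamma (a + real k + (b + real m)) * Gamma (a + real k + c) * Gamma (b + real m + c)"
    using pos by (subst hahn_integral_eq) auto
  finally show ?thesis by (simp add: add_ac)
qed

text \<open>The n-th finite difference of the rising factorial, by Pascal's rule and (x)_m - (x +
  1)_m = -m (x + 1)_(m-1). For n > m the product contains a factor 0, so the truncated subtraction m
  - n is harmless.\<close>

lemma pochhammer_difference:
  fixes x :: real
  shows "(\<Sum>k\<le>n. (-1) ^ k * real (n choose k) * pochhammer (x + real k) m) =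
     (-1) ^ n * (\<Prod>i<n. real m - real i) * pochhammer (x + real n) (m - n)"
proof (induction n arbitrary: x)
  case (Suc n)
  define f where "f = (\<lambda>k. (-1) ^ k * pochhammer (x + real k) m)"
  have "(\<Sum>k\<le>Suc n. (-1) ^ k * real (Suc n choose k) * pochhammer (x + real k) m) = (\<Sum>k\<le>Suc n. real (Suc n choose k) * f k)"
    by (simp add: f_def mult_ac)
  also have "\<dots> = f 0 + (\<Sum>k\<le>n. real (Suc n choose Suc k) * f (Suc k))"
    by (subst sum.atMost_Suc_shift) simp
  also have "\<dots> = (f 0 + (\<Sum>k\<le>n. real (n choose Suc k) * f (Suc k))) + (\<Sum>k\<le>n. real (n choose k) * f (Suc k))"
    by (simp add: distrib_right sum.distrib)
  also have "f 0 + (\<Sum>k\<le>n. real (n choose Suc k) * f (Suc k)) = (\<Sum>k\<le>Suc n. real (n choose k) * f k)"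
    by (subst sum.atMost_Suc_shift) simp
  also have "\<dots> = (\<Sum>k\<le>n. real (n choose k) * f k)" by simp
  also have "\<dots> = (\<Sum>k\<le>n. (-1) ^ k * real (n choose k) * pochhammer (x + real k) m)"
    by (simp add: f_def mult_ac)
  also have "(\<Sum>k\<le>n. real (n choose k) * f (Suc k)) = - (\<Sum>k\<le>n. (-1) ^ k * real (n choose k) * pochhammer (x + 1 + real k) m)"
    by (simp add: f_def mult_ac sum_negf[symmetric] add_ac)
  finally have *: "(\<Sum>k\<le>Suc n. (-1) ^ k * real (Suc n choose k) * pochhammer (x + real k) m) =
    (-1) ^ n * (\<Prod>i<n. real m - real i) * (pochhammer (x + real n) (m - n) - pochhammer (x + 1 + real n) (m - n))"
    unfolding Suc.IH by (simp add: right_diff_distrib)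
  show ?case
  proof (cases "n < m")
    case True
    then obtain j where j: "m - n = Suc j" by (metis Suc_diff_Suc)
    hence j': "m - Suc n = j" "real m - real n = real (Suc j)" using True by (auto simp: of_nat_diff)
    have "pochhammer (x + real n) (Suc j) - pochhammer (x + real n + 1) (Suc j) = - real (Suc j) * pochhammer (x + real n + 1) j"
      unfolding pochhammer_rec[of "x + real n" j] pochhammer_Suc[of "x + real n + 1" j] by (simp add: algebra_simps)
    hence d: "pochhammer (x + real n) (m - n) - pochhammer (x + 1 + real n) (m - n) = - (real m - real n) * pochhammer (x + real (Suc n)) (m - Suc n)"
      unfolding j j' by (simp add: add_ac)
    show ?thesis unfolding * d by (simp add: algebra_simps)
  next
    case False
    hence "m - n = 0" by simp
    moreover have "(\<Prod>i<Suc n. real m - real i) = 0" using False by (auto intro!: bexI[of _ m])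
    ultimately show ?thesis unfolding * by simp
  qed
qed simp

definition hahn_poly :: "real \<Rightarrow> real \<Rightarrow> real \<Rightarrow> nat \<Rightarrow> real poly" where
  "hahn_poly a b c n = (\<Sum>k\<le>n. smult ((-1) ^ k * real (n choose k) / (Gamma (a + b + real k) * Gamma (a + c + real k))) (shift_poly a k))"

lemma dual_hahn_poly: "dual_hahn a b c n s = poly (hahn_poly a b c n) (s\<^sup>2)"
  by (simp add: dual_hahn_def hahn_poly_def J_basis_def poly_sum poly_shift_poly)

lemma degree_hahn_poly_le: "degree (hahn_poly a b c n) \<le> n"
  unfolding hahn_poly_def
  by (intro degree_sum_le) (auto intro: order.trans[OF degree_smult_le] simp: degree_shift_poly)

lemma lead_hahn_poly: "coeff (hahn_poly a b c n) n = (-1) ^ n / (Gamma (a + b + real n) * Gamma (a + c + real n))"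
proof -
  have "coeff (hahn_poly a b c n) n = (\<Sum>k\<le>n. if k = n then (-1) ^ n / (Gamma (a + b + real n) * Gamma (a + c + real n)) else 0)"
    unfolding hahn_poly_def coeff_sum
  proof (intro sum.cong refl)
    fix k assume "k \<in> {..n}"
    thus "coeff (smult ((-1) ^ k * real (n choose k) / (Gamma (a + b + real k) * Gamma (a + c + real k))) (shift_poly a k)) n =
      (if k = n then (-1) ^ n / (Gamma (a + b + real n) * Gamma (a + c + real n)) else 0)"
      using lead_shift_poly[of a n] by (auto simp: coeff_eq_0 degree_shift_poly)
  qed
  thus ?thesis by simp
qed

lemma lead_hahn_poly_nonzero:
  assumes "0 < a" "0 < b" "0 < c"
  shows "coeff (hahn_poly a b c n) n \<noteq> 0" "degree (hahn_poly a b c n) = n"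
proof -
  have "Gamma (a + b + real n) > 0" "Gamma (a + c + real n) > 0" using assms by (auto intro!: Gamma_real_pos)
  thus 1: "coeff (hahn_poly a b c n) n \<noteq> 0" by (simp add: lead_hahn_poly)
  show "degree (hahn_poly a b c n) = n"
    using le_degree[OF 1] degree_hahn_poly_le[of a b c n] by simp
qed

text \<open>Gamma(a + c + k) cancels against the coefficient, and Gamma(a + b + k + m) / Gamma(a + b
  + k) is the rising factorial (a + b + k)_m; the sum over k is then the difference evaluated in
  \<open>pochhammer_difference\<close>.\<close>

lemma hahn_functional_hahn_shift:
  assumes pos: "0 < a" "0 < b" "0 < c"
  shows "hahn_functional a b c (hahn_poly a b c n * shift_poly b m) =
     Gamma (b + c + real m) * ((-1) ^ n * (\<Prod>i<n. real m - real i) * pochhammer (a + b + real n) (m - n))"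
proof -
  have "hahn_functional a b c (hahn_poly a b c n * shift_poly b m) =
    (\<Sum>k\<le>n. (-1) ^ k * real (n choose k) / (Gamma (a + b + real k) * Gamma (a + c + real k)) * hahn_functional a b c (shift_poly a k * shift_poly b m))"
    unfolding hahn_poly_def sum_distrib_right mult_smult_left
    by (subst hahn_functional_sum[OF pos]) (simp_all add: hahn_functional_smult)
  also have "\<dots> = (\<Sum>k\<le>n. Gamma (b + c + real m) * ((-1) ^ k * real (n choose k) * pochhammer (a + b + real k) m))"
  proof (intro sum.cong refl)
    fix k
    have g: "Gamma (a + b + real k) > 0" "Gamma (a + c + real k) > 0" using pos by (auto intro!: Gamma_real_pos)
    have "pochhammer (a + b + real k) m = Gamma (a + b + real k + real m) / Gamma (a + b + real k)"
      using pos by (intro pochhammer_Gamma pos_notin_nonpos_Ints) auto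
    thus "(-1) ^ k * real (n choose k) / (Gamma (a + b + real k) * Gamma (a + c + real k)) * hahn_functional a b c (shift_poly a k * shift_poly b m)
      = Gamma (b + c + real m) * ((-1) ^ k * real (n choose k) * pochhammer (a + b + real k) m)"
      using g unfolding hahn_functional_shift[OF pos] by simp
  qed
  also have "\<dots> = Gamma (b + c + real m) * ((-1) ^ n * (\<Prod>i<n. real m - real i) * pochhammer (a + b + real n) (m - n))"
    unfolding sum_distrib_left[symmetric] pochhammer_difference ..
  finally show ?thesis .
qed

text \<open>The squared norm of \<open>z\<^sup>n\<close> in the disk space.\<close>

definition disk_moment :: "real \<Rightarrow> real \<Rightarrow> real \<Rightarrow> nat \<Rightarrow> real" where
  "disk_moment a b c n = fact n * Gamma (b + c + real n) / (Gamma (a + b + real n) * Gamma (a + c + real n))"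

lemma hahn_functional_orthogonal_lower:
  assumes pos: "0 < a" "0 < b" "0 < c" and deg: "degree f < n"
  shows "hahn_functional a b c (hahn_poly a b c n * f) = 0"
proof (rule poly_as_shift_poly[where n="degree f" and B="shift_poly b" and P="\<lambda>f. hahn_functional a b c (hahn_poly a b c n * f) = 0"])
  fix k assume "k \<le> degree f"
  hence "(\<Prod>i<n. real k - real i) = 0" using deg by (auto intro!: bexI[of _ k])
  thus "hahn_functional a b c (hahn_poly a b c n * shift_poly b k) = 0"
    by (simp add: hahn_functional_hahn_shift[OF pos])
qed (auto simp: degree_shift_poly lead_shift_poly distrib_left hahn_functional_add[OF pos] hahn_functional_smult)

text \<open>Off the diagonal the factor of lower degree is annihilated by the other. On the diagonal
  one factor may be replaced by its leading coefficient l times \<open>shift_poly b n\<close>,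
  because the remainder r does not contribute; the sign of l cancels that of the difference.\<close>

lemma hahn_functional_orthogonal:
  assumes pos: "0 < a" "0 < b" "0 < c"
  shows "hahn_functional a b c (hahn_poly a b c n * hahn_poly a b c m) = (if n = m then disk_moment a b c n else 0)"
proof (cases "n = m")
  case False
  have "hahn_functional a b c (hahn_poly a b c n * hahn_poly a b c m) = 0"
  proof (cases "m < n")
    case True
    thus ?thesis using hahn_functional_orthogonal_lower[OF pos] lead_hahn_poly_nonzero(2)[OF pos] by simp
  next
    case F2: False
    hence "n < m" using False by simp
    thus ?thesis using hahn_functional_orthogonal_lower[OF pos, of "hahn_poly a b c n" m] lead_hahn_poly_nonzero(2)[OF pos]
      by (simp add: mult.commute)
  qed
  thus ?thesis using False by simp
next
  case True
  define l where "l = coeff (hahn_poly a b c n) n"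
  define r where "r = hahn_poly a b c n - smult l (shift_poly b n)"
  have fp: "(\<Prod>i<n. real n - real i) = fact n"
  proof -
    have "(\<Prod>i<n. real n - real i) = (\<Prod>i<n. real (Suc i))"
      by (rule prod.reindex_bij_witness[of _ "\<lambda>i. n - Suc i" "\<lambda>i. n - Suc i"]) (auto simp: of_nat_diff)
    also have "\<dots> = fact n" by (simp add: fact_prod_Suc atLeast0LessThan)
    finally show ?thesis .
  qed
  have base: "hahn_functional a b c (hahn_poly a b c n * shift_poly b n) = Gamma (b + c + real n) * ((-1) ^ n * fact n)"
    by (simp add: hahn_functional_hahn_shift[OF pos] fp)
  have "hahn_functional a b c (hahn_poly a b c n * r) = 0"
  proof (cases n)
    \<comment> \<open>No polynomial has degree below 0, so the orthogonality to lower degrees says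
      nothing here; instead r itself is zero.\<close>
    case 0
    hence "r = 0" unfolding r_def l_def using degree_hahn_poly_le[of a b c 0]
      by (intro poly_eqI) (auto simp: shift_poly_def coeff_eq_0 coeff_pCons split: nat.splits)
    thus ?thesis by (simp add: hahn_functional_def)
  next
    case (Suc j)
    have "degree r \<le> j"
    proof (rule degree_le, intro allI impI)
      fix i assume "j < i"
      show "coeff r i = 0"
      proof (cases "i = n")
        case False
        hence "n < i" using \<open>j < i\<close> Suc by simp
        thus ?thesis by (simp add: r_def coeff_eq_0 lead_hahn_poly_nonzero(2)[OF pos] degree_shift_poly)
      qed (simp add: r_def l_def lead_shift_poly)
    qed
    thus ?thesis using Suc by (intro hahn_functional_orthogonal_lower pos) auto
  qed
  moreover have "hahn_poly a b c n = r + smult l (shift_poly b n)" by (simp add: r_def)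
  ultimately have "hahn_functional a b c (hahn_poly a b c n * hahn_poly a b c n) = l * (Gamma (b + c + real n) * ((-1) ^ n * fact n))"
    using hahn_functional_add[OF pos, of "hahn_poly a b c n * r" "smult l (hahn_poly a b c n * shift_poly b n)"]
    by (metis add_0 base distrib_left hahn_functional_smult mult_smult_right)
  also have "\<dots> = disk_moment a b c n"
    by (simp add: l_def lead_hahn_poly disk_moment_def flip: power_mult_distrib)
  finally show ?thesis using True by simp
qed

lemma spectral_integral_poly:
  assumes pos: "0 < a" "0 < b" "0 < c"
  shows "integrable (spectral_measure a b c) (\<lambda>s. poly f (s\<^sup>2))"
    and "(LINT s|spectral_measure a b c. poly f (s\<^sup>2)) = hahn_functional a b c f"
proof -
  have m: "(\<lambda>s. poly f (s\<^sup>2)) \<in> borel_measurable (spectral_measure a b c)"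
    by (intro borel_measurable_spectral borel_measurable_continuous_onI continuous_intros)
  have i: "integrable lborel (\<lambda>s. (1 / (2 * pi)) * (poly f (s\<^sup>2) * hahn_weight a b c s))"
    by (intro integrable_mult_right integrable_poly_hahn_weight pos)
  have e: "(hahn_weight a b c s / (2 * pi)) *\<^sub>R poly f (s\<^sup>2) = (1 / (2 * pi)) * (poly f (s\<^sup>2) * hahn_weight a b c s)" for s by simp
  show "integrable (spectral_measure a b c) (\<lambda>s. poly f (s\<^sup>2))"
    unfolding spectral_integral(1)[OF pos m] e using integrable_mult_indicator[OF _ i, of "{0..}"] by simp
  have "(LINT s|spectral_measure a b c. poly f (s\<^sup>2)) = (LINT s|lborel. (1 / (2 * pi)) * (poly f (s\<^sup>2) * hahn_weight a b c s)) / 2"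
    unfolding spectral_integral(2)[OF pos m] e by (rule integral_even_half[OF i]) (simp add: hahn_weight_uminus)
  thus "(LINT s|spectral_measure a b c. poly f (s\<^sup>2)) = hahn_functional a b c f"
    by (simp add: hahn_functional_def)
qed

lemma
  assumes pos: "0 < a" "0 < b" "0 < c"
  shows dual_hahn_L2: "(\<lambda>s. complex_of_real (dual_hahn a b c n s)) \<in> L2_space (spectral_measure a b c)"
    and dual_hahn_orthogonal: "L2_inner (spectral_measure a b c) (\<lambda>s. of_real (dual_hahn a b c n s)) (\<lambda>s. of_real (dual_hahn a b c m s))
       = (if n = m then of_real (disk_moment a b c m) else 0)"
proof -
  have sq: "(norm (complex_of_real (dual_hahn a b c n s)))\<^sup>2 = poly (hahn_poly a b c n * hahn_poly a b c n) (s\<^sup>2)" for s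
    by (simp add: dual_hahn_poly power2_eq_square)
  have "(\<lambda>s. complex_of_real (dual_hahn a b c n s)) \<in> borel_measurable (spectral_measure a b c)"
    unfolding dual_hahn_poly by (intro borel_measurable_spectral borel_measurable_continuous_onI continuous_intros)
  thus "(\<lambda>s. complex_of_real (dual_hahn a b c n s)) \<in> L2_space (spectral_measure a b c)"
    by (rule L2_spaceI) (unfold sq, rule spectral_integral_poly(1)[OF pos])
  have "L2_inner (spectral_measure a b c) (\<lambda>s. of_real (dual_hahn a b c n s)) (\<lambda>s. of_real (dual_hahn a b c m s)) =
     (LINT s|spectral_measure a b c. complex_of_real (poly (hahn_poly a b c n * hahn_poly a b c m) (s\<^sup>2)))"
    by (simp add: L2_inner_def dual_hahn_poly)
  also have "\<dots> = of_real (hahn_functional a b c (hahn_poly a b c n * hahn_poly a b c m))"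
    unfolding integral_complex_of_real spectral_integral_poly(2)[OF pos] ..
  finally show "L2_inner (spectral_measure a b c) (\<lambda>s. of_real (dual_hahn a b c n s)) (\<lambda>s. of_real (dual_hahn a b c m s))
       = (if n = m then of_real (disk_moment a b c m) else 0)"
    unfolding hahn_functional_orthogonal[OF pos] by simp
qed

section \<open>Completeness of the continuous dual Hahn polynomials\<close>

text \<open>An integrable function with an exponential moment is determined by its moments: its Fourier
  transform vanishes near every point where all its derivatives vanish.\<close>

lemma Fourier_zero_of_moments_zero:
  fixes v :: "real \<Rightarrow> real"
  assumes e: "e > 0" and int: "integrable lborel (\<lambda>s. exp (e * \<bar>s\<bar>) * \<bar>v s\<bar>)"
    and meas [measurable]: "v \<in> borel_measurable borel"
    and moments: "\<And>n. (LINT s|lborel. s ^ n * v s) = 0"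
  shows "(LINT s|lborel. of_real (v s) * exp (\<i> * of_real (t * s))) = 0"
proof -
  \<comment> \<open>Half of the exponential moment absorbs the powers s^n, the other half pays for a
    step h with |h| \<le> \<delta> in the Fourier variable.\<close>
  define \<delta> where "\<delta> = e / 2"
  have \<delta>: "\<delta> > 0" using e by (simp add: \<delta>_def)
  have powexp: "\<bar>s\<bar> ^ n \<le> fact n / \<delta> ^ n * exp (\<delta> * \<bar>s\<bar>)" for s :: real and n
  proof -
    have "(\<delta> * \<bar>s\<bar>) ^ n / fact n \<le> exp (\<delta> * \<bar>s\<bar>)"
    proof -
      have "(\<Sum>k\<in>{n}. (\<delta> * \<bar>s\<bar>) ^ k / fact k) \<le> (\<Sum>k. (\<delta> * \<bar>s\<bar>) ^ k / fact k)"
        using summable_exp[of "\<delta> * \<bar>s\<bar>"] \<delta> by (intro sum_le_suminf) (auto simp: divide_inverse mult.commute)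
      thus ?thesis by (simp add: exp_def divide_inverse mult.commute scaleR_conv_of_real)
    qed
    thus ?thesis using \<delta> by (simp add: power_mult_distrib field_simps)
  qed
  have intpow: "integrable lborel (\<lambda>s. \<bar>s\<bar> ^ n * \<bar>v s\<bar> * exp (\<delta> * \<bar>s\<bar>))" for n
  proof (rule Bochner_Integration.integrable_bound)
    show "integrable lborel (\<lambda>s. fact n / \<delta> ^ n * (exp (e * \<bar>s\<bar>) * \<bar>v s\<bar>))"
      by (rule integrable_mult_right[OF int])
    have "\<bar>s\<bar> ^ n * \<bar>v s\<bar> * exp (\<delta> * \<bar>s\<bar>) \<le> fact n / \<delta> ^ n * (exp (e * \<bar>s\<bar>) * \<bar>v s\<bar>)" for s
    proof -
      have "\<bar>s\<bar> ^ n * (\<bar>v s\<bar> * exp (\<delta> * \<bar>s\<bar>)) \<le> (fact n / \<delta> ^ n * exp (\<delta> * \<bar>s\<bar>)) * (\<bar>v s\<bar> * exp (\<delta> * \<bar>s\<bar>))"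
        by (intro mult_right_mono powexp) auto
      also have "\<dots> = fact n / \<delta> ^ n * ((exp (\<delta> * \<bar>s\<bar>) * exp (\<delta> * \<bar>s\<bar>)) * \<bar>v s\<bar>)" by simp
      also have "exp (\<delta> * \<bar>s\<bar>) * exp (\<delta> * \<bar>s\<bar>) = exp (e * \<bar>s\<bar>)" by (simp add: \<delta>_def flip: exp_add)
      finally show ?thesis by (simp add: mult.assoc)
    qed
    thus "AE s in lborel. norm (\<bar>s\<bar> ^ n * \<bar>v s\<bar> * exp (\<delta> * \<bar>s\<bar>)) \<le> norm (fact n / \<delta> ^ n * (exp (e * \<bar>s\<bar>) * \<bar>v s\<bar>))"
      using \<delta> by (auto simp: abs_mult)
  qed measurable
  define E where "E = (\<lambda>t s. exp (\<i> * complex_of_real (t * s)))"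
  have normE: "norm (E t s) = 1" for t s by (simp add: E_def norm_exp_eq_Re)
  have [measurable]: "E t \<in> borel_measurable borel" for t unfolding E_def by measurable
  \<comment> \<open>Z t says that all derivatives of the Fourier transform vanish at t. Expanding
    exp (ihs) propagates this over steps of length up to \<delta>, so every t is reached from 0 in
    finitely many steps.\<close>
  define Z where "Z = (\<lambda>t. \<forall>n. (LINT s|lborel. of_real (s ^ n * v s) * E t s) = 0)"
  have step: "Z (t + h)" if Z: "Z t" and h: "\<bar>h\<bar> \<le> \<delta>" for t h
    unfolding Z_def
  proof
    fix n
    define f where "f = (\<lambda>k s. (\<i> * of_real h) ^ k / fact k * (of_real (s ^ (n + k) * v s) * E t s))"
    have nf: "norm (f k s) = (\<bar>h\<bar> * \<bar>s\<bar>) ^ k / fact k * (\<bar>s\<bar> ^ n * \<bar>v s\<bar>)" for k s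
      by (simp add: f_def norm_mult norm_divide norm_power normE power_add power_mult_distrib power_abs abs_mult)
    have If: "integrable lborel (f k)" for k
      unfolding f_def
    proof (intro integrable_mult_right Bochner_Integration.integrable_bound[OF intpow[of "n + k"]])
      show "AE s in lborel. norm (of_real (s ^ (n + k) * v s) * E t s) \<le> norm (\<bar>s\<bar> ^ (n + k) * \<bar>v s\<bar> * exp (\<delta> * \<bar>s\<bar>))"
      proof (rule AE_I2)
        fix s :: real
        have "1 \<le> exp (\<delta> * \<bar>s\<bar>)" using \<delta> by simp
        from mult_left_mono[OF this, of "\<bar>s\<bar> ^ (n + k) * \<bar>v s\<bar>"]
        show "norm (of_real (s ^ (n + k) * v s) * E t s) \<le> norm (\<bar>s\<bar> ^ (n + k) * \<bar>v s\<bar> * exp (\<delta> * \<bar>s\<bar>))"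
          by (simp add: norm_mult norm_power normE abs_mult power_abs)
      qed
    qed measurable
    have expsum: "(\<lambda>k. x ^ k / fact k) sums exp x" for x :: "'b :: {banach, real_normed_field}"
      using exp_converges[of x] by (simp add: scaleR_conv_of_real divide_inverse mult.commute)
    have fs: "(\<lambda>k. f k s) sums (of_real (s ^ n * v s) * E (t + h) s)" for s
    proof -
      have "(\<lambda>k. (of_real (s ^ n * v s) * E t s) * ((\<i> * of_real h * of_real s) ^ k / fact k)) sums
         ((of_real (s ^ n * v s) * E t s) * exp (\<i> * of_real h * of_real s))"
        by (intro sums_mult expsum)
      moreover have "E t s * exp (\<i> * of_real h * of_real s) = E (t + h) s"
        by (simp add: E_def algebra_simps flip: exp_add)
      hence "(of_real (s ^ n * v s) * E t s) * exp (\<i> * of_real h * of_real s) = of_real (s ^ n * v s) * E (t + h) s"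
        by (simp only: mult.assoc)
      moreover have "(of_real (s ^ n * v s) * E t s) * ((\<i> * of_real h * of_real s) ^ k / fact k) = f k s" for k
        by (simp add: f_def power_add power_mult_distrib mult_ac)
      ultimately show ?thesis by (simp only:)
    qed
    have absum: "(\<lambda>k. norm (f k s)) sums (exp (\<bar>h\<bar> * \<bar>s\<bar>) * (\<bar>s\<bar> ^ n * \<bar>v s\<bar>))" for s
      unfolding nf by (intro sums_mult2 expsum)
    have dom: "summable (\<lambda>k. LINT s|lborel. norm (f k s))"
    proof (rule bounded_imp_summable)
      show "0 \<le> (LINT s|lborel. norm (f k s))" for k by simp
      fix N
      have "(\<Sum>k\<le>N. LINT s|lborel. norm (f k s)) = (LINT s|lborel. (\<Sum>k\<le>N. norm (f k s)))"
        using If by (subst Bochner_Integration.integral_sum) auto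
      also have "\<dots> \<le> (LINT s|lborel. \<bar>s\<bar> ^ n * \<bar>v s\<bar> * exp (\<delta> * \<bar>s\<bar>))"
      proof (intro integral_mono intpow)
        show "integrable lborel (\<lambda>s. \<Sum>k\<le>N. norm (f k s))" using If by (intro Bochner_Integration.integrable_sum) auto
        fix s :: real
        have "(\<Sum>k\<le>N. norm (f k s)) \<le> (\<Sum>k. norm (f k s))"
          using absum[of s] by (intro sum_le_suminf) (auto simp: sums_iff)
        also have "\<dots> = exp (\<bar>h\<bar> * \<bar>s\<bar>) * (\<bar>s\<bar> ^ n * \<bar>v s\<bar>)" using absum[of s] by (simp add: sums_iff)
        also have "\<dots> \<le> exp (\<delta> * \<bar>s\<bar>) * (\<bar>s\<bar> ^ n * \<bar>v s\<bar>)"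
          using h by (intro mult_right_mono) (auto intro: mult_right_mono)
        finally show "(\<Sum>k\<le>N. norm (f k s)) \<le> \<bar>s\<bar> ^ n * \<bar>v s\<bar> * exp (\<delta> * \<bar>s\<bar>)" by (simp add: mult_ac)
      qed
      finally show "(\<Sum>k\<le>N. LINT s|lborel. norm (f k s)) \<le> (LINT s|lborel. \<bar>s\<bar> ^ n * \<bar>v s\<bar> * exp (\<delta> * \<bar>s\<bar>))" .
    qed
    have "(LINT s|lborel. of_real (s ^ n * v s) * E (t + h) s) = (LINT s|lborel. (\<Sum>k. f k s))"
      using fs by (simp add: sums_iff)
    also have "\<dots> = (\<Sum>k. LINT s|lborel. f k s)"
      using absum by (intro integral_suminf If dom AE_I2) (simp add: sums_iff)
    also have "(\<lambda>k. LINT s|lborel. f k s) = (\<lambda>k. 0)"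
      using Z unfolding f_def Z_def by (simp only: integral_mult_right_zero mult_zero_right)
    finally show "(LINT s|lborel. of_real (s ^ n * v s) * E (t + h) s) = 0" by simp
  qed
  have Z0: "Z 0"
  proof -
    have "of_real (s ^ n * v s) * E 0 s = complex_of_real (s ^ n * v s)" for n s by (simp add: E_def)
    thus ?thesis unfolding Z_def using moments by (simp only: integral_complex_of_real of_real_0) simp
  qed
  have "Z (real k * h)" if "\<bar>h\<bar> \<le> \<delta>" for k h
  proof (induction k)
    case (Suc k)
    have "real (Suc k) * h = real k * h + h" by (simp add: algebra_simps)
    thus ?case using step[OF Suc that] by simp
  qed (use Z0 in simp)
  moreover obtain k :: nat where k: "\<bar>t\<bar> / \<delta> < real k" using reals_Archimedean2 by blast
  have "real k > 0" using k \<delta> by (meson abs_ge_zero divide_nonneg_pos le_less_trans)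
  moreover have "\<bar>t / real k\<bar> \<le> \<delta>"
    using k \<delta> \<open>real k > 0\<close> by (simp add: field_simps)
  ultimately have "Z (real k * (t / real k))" by blast
  hence "Z t" using \<open>real k > 0\<close> by simp
  hence "(LINT s|lborel. of_real (s ^ 0 * v s) * E t s) = 0" unfolding Z_def by blast
  thus ?thesis by (simp add: E_def)
qed

text \<open>The positive and negative parts have the same integral m, because the transform vanishes
  at 0. If m > 0, division by m makes them probability densities with equal characteristic
  functions, and Levy's uniqueness theorem identifies them.\<close>

lemma Fourier_zero_imp_AE_zero:
  fixes v :: "real \<Rightarrow> real"
  assumes int: "integrable lborel v"
    and zero: "\<And>t. (LINT s|lborel. of_real (v s) * exp (\<i> * of_real (t * s))) = 0"
  shows "AE s in lborel. v s = 0"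
proof -
  have [measurable]: "v \<in> borel_measurable borel" using int by (simp add: integrable_iff_bounded)
  define P where "P = (\<lambda>s. max 0 (v s))"
  define N where "N = (\<lambda>s. max 0 (- v s))"
  have [measurable]: "P \<in> borel_measurable borel" "N \<in> borel_measurable borel" unfolding P_def N_def by measurable
  have Pi: "integrable lborel P" "integrable lborel N"
    unfolding P_def N_def by (rule Bochner_Integration.integrable_bound[OF int]; auto)+
  have vPN: "v s = P s - N s" for s by (auto simp: P_def N_def)
  define m where "m = (LINT s|lborel. P s)"
  have mN: "(LINT s|lborel. N s) = m"
  proof -
    have "(LINT s|lborel. v s) = 0" using zero[of 0] integral_complex_of_real[of lborel v] by simp
    thus ?thesis unfolding m_def using Pi by (simp add: vPN)
  qed
  have "m \<ge> 0" unfolding m_def by (intro integral_nonneg_AE) (auto simp: P_def)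
  show ?thesis
  proof (cases "m = 0")
    case True
    have "AE s in lborel. P s = 0" "AE s in lborel. N s = 0"
      using True mN Pi by (subst integral_nonneg_eq_0_iff_AE[symmetric]; auto simp: m_def P_def N_def)+
    thus ?thesis by eventually_elim (simp add: vPN)
  next
    case False
    hence m: "m > 0" using \<open>m \<ge> 0\<close> by simp
    define D :: "(real \<Rightarrow> real) \<Rightarrow> real measure" where "D = (\<lambda>f. density lborel (\<lambda>s. ennreal (f s / m)))"
    have D: "real_distribution (D f)" "\<And>t. char (D f) t = (LINT s|lborel. of_real (f s) * exp (\<i> * of_real (t * s))) / m"
      if f: "integrable lborel f" "\<And>s. f s \<ge> 0" "(LINT s|lborel. f s) = m" for f
    proof -
      have [measurable]: "f \<in> borel_measurable borel" using f(1) by (simp add: integrable_iff_bounded)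
      have "emeasure (D f) UNIV = (\<integral>\<^sup>+s. ennreal (f s / m) \<partial>lborel)"
        unfolding D_def by (subst emeasure_density) auto
      also have "\<dots> = ennreal (LINT s|lborel. f s / m)"
        using f m by (intro nn_integral_eq_integral) auto
      also have "\<dots> = 1" using f m by simp
      finally have "prob_space (D f)" by (intro prob_spaceI) (simp add: D_def)
      thus "real_distribution (D f)" by (auto simp: real_distribution_def real_distribution_axioms_def D_def)
      fix t
      have "char (D f) t = (LINT s|lborel. (f s / m) *\<^sub>R iexp (t * s))"
        unfolding char_def D_def using m f(2) by (subst integral_density) auto
      also have "\<dots> = (LINT s|lborel. (of_real (f s) * exp (\<i> * of_real (t * s))) / m)"
        by (simp add: scaleR_conv_of_real)
      finally show "char (D f) t = (LINT s|lborel. of_real (f s) * exp (\<i> * of_real (t * s))) / m" by simp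
    qed
    have PP: "real_distribution (D P)" "\<And>t. char (D P) t = (LINT s|lborel. of_real (P s) * exp (\<i> * of_real (t * s))) / m"
      using D[of P] Pi by (auto simp: m_def P_def)
    have NN: "real_distribution (D N)" "\<And>t. char (D N) t = (LINT s|lborel. of_real (N s) * exp (\<i> * of_real (t * s))) / m"
      using D[of N] Pi mN by (auto simp: N_def)
    have "char (D P) = char (D N)"
    proof
      fix t
      have i: "integrable lborel (\<lambda>s. of_real (f s) * exp (\<i> * of_real (t * s)))" if "integrable lborel f" for f :: "real \<Rightarrow> real"
      proof (rule Bochner_Integration.integrable_bound[OF that])
        have [measurable]: "f \<in> borel_measurable borel" using that by (simp add: integrable_iff_bounded)
        show "(\<lambda>s. of_real (f s) * exp (\<i> * of_real (t * s))) \<in> borel_measurable lborel" by measurable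
      qed (auto simp: norm_mult norm_exp_eq_Re)
      have "(LINT s|lborel. of_real (P s) * exp (\<i> * of_real (t * s))) - (LINT s|lborel. of_real (N s) * exp (\<i> * of_real (t * s)))
         = (LINT s|lborel. of_real (P s) * exp (\<i> * of_real (t * s)) - of_real (N s) * exp (\<i> * of_real (t * s)))"
        by (intro Bochner_Integration.integral_diff[symmetric] i Pi)
      also have "\<dots> = (LINT s|lborel. of_real (v s) * exp (\<i> * of_real (t * s)))"
        by (simp add: vPN left_diff_distrib)
      also have "\<dots> = 0" by (rule zero)
      finally show "char (D P) t = char (D N) t" unfolding PP(2) NN(2) by simp
    qed
    hence "D P = D N" by (intro Levy_uniqueness PP NN)
    hence "AE s in lborel. ennreal (P s / m) = ennreal (N s / m)"
      unfolding D_def by (subst (asm) sigma_finite_measure.density_unique_iff[OF sigma_finite_lborel]) auto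
    thus ?thesis
    proof eventually_elim
      case (elim s)
      hence "P s / m = N s / m" using m by (subst (asm) ennreal_inj) (auto simp: P_def N_def)
      thus ?case using m by (simp add: vPN)
    qed
  qed
qed

lemma hahn_weight_pos:
  assumes "0 < a" "0 < b" "0 < c" "s \<noteq> 0"
  shows "hahn_weight a b c s > 0"
proof -
  have "Gamma (Complex x s) \<noteq> 0" if "0 < x" for x
    using Complex_notin_nonpos_Ints[OF that] by (simp add: Gamma_eq_zero_iff)
  moreover have "Complex 0 (2 * s) \<notin> \<int>\<^sub>\<le>\<^sub>0"
    using assms(4) by (auto simp: complex_eq_iff elim!: nonpos_Ints_cases)
  hence "Gamma (Complex 0 (2 * s)) \<noteq> 0" by (simp add: Gamma_eq_zero_iff)
  ultimately show ?thesis using assms by (simp add: hahn_weight_def)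
qed

text \<open>The product of h and the weight is extended evenly to the line: odd moments vanish by
  symmetry and even ones by hypothesis. Its exponential moment comes from bounding exp (e |s|) |h|
  by h^2 + exp (2 e |s|), where the decay of the weight pays for the second term. The weight is
  positive off 0, so v = 0 forces h = 0.\<close>

lemma dual_hahn_complete_real:
  fixes h :: "real \<Rightarrow> real"
  assumes pos: "0 < a" "0 < b" "0 < c"
    and meas: "h \<in> borel_measurable (spectral_measure a b c)"
    and sq: "integrable (spectral_measure a b c) (\<lambda>s. (h s)\<^sup>2)"
    and orth: "\<And>f. (LINT s|spectral_measure a b c. h s * poly f (s\<^sup>2)) = 0"
  shows "AE s in spectral_measure a b c. h s = 0"
proof -
  let ?M = "spectral_measure a b c"
  \<comment> \<open>Measurability of h is known on the half-line only; cut off by the indicator it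
    becomes a Borel function on the line.\<close>
  define g where "g = (\<lambda>s. indicator {0..} s * h s)"
  have [measurable]: "g \<in> borel_measurable borel"
  proof -
    have "h \<in> borel_measurable (restrict_space borel {0..})" using meas measurable_cong_sets[OF sets_spectral_measure refl, of a b c borel] by auto
    thus ?thesis unfolding g_def by (subst (asm) borel_measurable_restrict_space_iff) (auto simp: mult.commute)
  qed
  have [measurable]: "hahn_weight a b c \<in> borel_measurable borel" using continuous_hahn_weight[OF pos] by (rule borel_measurable_continuous_onI)
  define v where "v = (\<lambda>s. g \<bar>s\<bar> * hahn_weight a b c s)"
  have [measurable]: "v \<in> borel_measurable borel" unfolding v_def by measurable
  have veven: "v (- s) = v s" for s by (simp add: v_def hahn_weight_uminus)
  have vind: "indicator {0..} s *\<^sub>R ((hahn_weight a b c s / (2 * pi)) *\<^sub>R (h s * k)) = indicator {0..} s *\<^sub>R ((1 / (2 * pi)) * (v s * k))" for s k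
    by (auto simp: v_def g_def indicator_def)
  \<comment> \<open>After the factor exp (2 e |s|) = exp (pi/8 |s|) the weight, of rate pi/4, still
    decays with rate pi/8.\<close>
  define e where "e = pi / 16"
  have even_int: "integrable lborel F" if "integrable lborel (\<lambda>s. indicator {0..} s *\<^sub>R F s)" "\<And>s. F (- s) = F s" "F \<in> borel_measurable borel" for F :: "real \<Rightarrow> real"
  proof -
    have "integrable lborel (\<lambda>s. indicator {0..} (- s) *\<^sub>R F (- s))"
      using lborel_integrable_real_affine[OF that(1), of "-1" 0] by simp
    hence "integrable lborel (\<lambda>s. \<bar>indicator {0..} s *\<^sub>R F s\<bar> + \<bar>indicator {0..} (- s) *\<^sub>R F (- s)\<bar>)"
      using that(1) by (intro Bochner_Integration.integrable_add integrable_abs)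
    thus ?thesis
      by (rule Bochner_Integration.integrable_bound) (use that(2,3) in \<open>auto simp: indicator_def\<close>)
  qed
  obtain C where C: "C > 0" "\<And>s. hahn_weight a b c s \<le> C * exp (- (pi / 4) * \<bar>s\<bar>)" using hahn_weight_decay[OF pos] by blast
  have vint: "integrable lborel (\<lambda>s. exp (e * \<bar>s\<bar>) * \<bar>v s\<bar>)"
  proof (rule even_int)
    have 1: "integrable lborel (\<lambda>s. indicator {0..} s *\<^sub>R ((hahn_weight a b c s / (2 * pi)) *\<^sub>R (h s)\<^sup>2))"
      using sq spectral_integral(1)[OF pos, of "\<lambda>s. (h s)\<^sup>2"] meas by simp
    have 2: "integrable lborel (\<lambda>s. C * exp (- (pi / 8) * \<bar>s\<bar>))"
      using integrable_exp_abs[of "pi/8"] by simp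
    show "integrable lborel (\<lambda>s. indicator {0..} s *\<^sub>R (exp (e * \<bar>s\<bar>) * \<bar>v s\<bar>))"
    proof (rule Bochner_Integration.integrable_bound)
      show "integrable lborel (\<lambda>s. 2 * pi * (indicator {0..} s *\<^sub>R ((hahn_weight a b c s / (2 * pi)) *\<^sub>R (h s)\<^sup>2)) + C * exp (- (pi / 8) * \<bar>s\<bar>))"
        by (rule Bochner_Integration.integrable_add[OF integrable_mult_right[OF 1] 2])
      have "exp (e * \<bar>s\<bar>) * \<bar>v s\<bar> \<le> hahn_weight a b c s * (h s)\<^sup>2 + C * exp (- (pi / 8) * \<bar>s\<bar>)" if "s \<ge> 0" for s
      proof -
        have "exp (e * \<bar>s\<bar>) * \<bar>v s\<bar> = hahn_weight a b c s * (exp (e * \<bar>s\<bar>) * \<bar>h s\<bar>)"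
          using that hahn_weight_nonneg[of a b c s] by (simp add: v_def g_def abs_mult)
        also have "\<dots> \<le> hahn_weight a b c s * ((h s)\<^sup>2 + exp (2 * e * \<bar>s\<bar>))"
        proof (intro mult_left_mono hahn_weight_nonneg)
          have "2 * (exp (e * \<bar>s\<bar>) * \<bar>h s\<bar>) \<le> (exp (e * \<bar>s\<bar>))\<^sup>2 + \<bar>h s\<bar>\<^sup>2" using sum_squares_bound[of "exp (e * \<bar>s\<bar>)" "\<bar>h s\<bar>"] by simp
          moreover have "(exp (e * \<bar>s\<bar>))\<^sup>2 = exp (2 * e * \<bar>s\<bar>)" by (simp flip: exp_double)
          moreover have "0 \<le> exp (e * \<bar>s\<bar>) * \<bar>h s\<bar>" by simp
          ultimately show "exp (e * \<bar>s\<bar>) * \<bar>h s\<bar> \<le> (h s)\<^sup>2 + exp (2 * e * \<bar>s\<bar>)" by (simp only: power2_abs)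
        qed
        also have "\<dots> = hahn_weight a b c s * (h s)\<^sup>2 + hahn_weight a b c s * exp (2 * e * \<bar>s\<bar>)" by (simp add: distrib_left)
        also have "hahn_weight a b c s * exp (2 * e * \<bar>s\<bar>) \<le> (C * exp (- (pi / 4) * \<bar>s\<bar>)) * exp (2 * e * \<bar>s\<bar>)"
          by (intro mult_right_mono C) auto
        also have "(C * exp (- (pi / 4) * \<bar>s\<bar>)) * exp (2 * e * \<bar>s\<bar>) = C * exp (- (pi / 8) * \<bar>s\<bar>)"
          by (simp add: e_def flip: exp_add)
        finally show ?thesis by simp
      qed
      thus "AE s in lborel. norm (indicator {0..} s *\<^sub>R (exp (e * \<bar>s\<bar>) * \<bar>v s\<bar>)) \<le> norm (2 * pi * (indicator {0..} s *\<^sub>R ((hahn_weight a b c s / (2 * pi)) *\<^sub>R (h s)\<^sup>2)) + C * exp (- (pi / 8) * \<bar>s\<bar>))"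
        using C(1) hahn_weight_nonneg[of a b c] by (intro AE_I2) (auto simp: indicator_def intro!: order.trans[OF _ abs_ge_self])
    qed measurable
  qed (auto simp: veven)
  have e: "e > 0" by (simp add: e_def)
  have vint0: "integrable lborel (\<lambda>s. s ^ n * v s)" for n
  proof -
    obtain K where K: "K > 0" "\<And>t. t \<ge> 0 \<Longrightarrow> (1 + t) ^ n \<le> K * exp (e * t)" using poly_le_exp[OF e] by blast
    show ?thesis
    proof (rule Bochner_Integration.integrable_bound)
    show "integrable lborel (\<lambda>s. K * (exp (e * \<bar>s\<bar>) * \<bar>v s\<bar>))" by (rule integrable_mult_right[OF vint])
    have "\<bar>s ^ n\<bar> * \<bar>v s\<bar> \<le> K * (exp (e * \<bar>s\<bar>) * \<bar>v s\<bar>)" for s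
    proof -
      have "\<bar>s\<bar> ^ n \<le> (1 + \<bar>s\<bar>) ^ n" by (intro power_mono) auto
      also have "\<dots> \<le> K * exp (e * \<bar>s\<bar>)" by (rule K(2)) simp
      finally show ?thesis using mult_right_mono[of "\<bar>s\<bar> ^ n" "K * exp (e * \<bar>s\<bar>)" "\<bar>v s\<bar>"] by (simp add: power_abs mult.assoc)
    qed
    thus "AE s in lborel. norm (s ^ n * v s) \<le> norm (K * (exp (e * \<bar>s\<bar>) * \<bar>v s\<bar>))" 
      using K(1) by (intro AE_I2) (simp add: abs_mult)
    qed measurable
  qed
  have moments: "(LINT s|lborel. s ^ n * v s) = 0" for n
  proof (cases "even n")
    case True
    then obtain k where k: "n = 2 * k" by blast
    have pk: "poly (monom 1 k) (s\<^sup>2) = s ^ n" for s :: real by (simp add: poly_monom k power_mult)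
    have m2: "(\<lambda>s. h s * s ^ n) \<in> borel_measurable ?M"
      using meas borel_measurable_spectral[of "\<lambda>s. s ^ n" a b c] by (intro borel_measurable_times) auto
    have "0 = (LINT s|?M. h s * s ^ n)" using orth[of "monom 1 k"] unfolding pk by simp
    also have "\<dots> = (LINT s|lborel. indicator {0..} s *\<^sub>R ((1 / (2 * pi)) * (v s * s ^ n)))"
      unfolding spectral_integral(2)[OF pos m2] vind ..
    also have "\<dots> = (LINT s|lborel. (1 / (2 * pi)) * (v s * s ^ n)) / 2"
    proof (rule integral_even_half)
      show "integrable lborel (\<lambda>s. (1 / (2 * pi)) * (v s * s ^ n))"
        using vint0[of n] by (intro integrable_mult_right) (simp add: mult.commute)
    qed (simp add: veven True)
    finally show ?thesis by (simp add: mult.commute)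
  next
    case False
    have "(LINT s|lborel. s ^ n * v s) = \<bar>-1\<bar> *\<^sub>R (LINT s|lborel. (0 + (-1) * s) ^ n * v (0 + (-1) * s))"
      by (rule lborel_integral_real_affine) simp
    also have "\<dots> = - (LINT s|lborel. s ^ n * v s)" using False by (simp add: veven)
    finally show ?thesis by simp
  qed
  have "AE s in lborel. v s = 0"
    using vint0[of 0] by (intro Fourier_zero_imp_AE_zero Fourier_zero_of_moments_zero[OF e vint _ moments]) auto
  hence "AE s in lborel. s \<in> {0..} \<longrightarrow> h s = 0"
    using AE_lborel_singleton[of 0]
  proof eventually_elim
    case (elim s)
    thus ?case using hahn_weight_pos[OF pos, of s] by (auto simp: v_def g_def)
  qed
  hence "AE s in restrict_space lborel {0..}. h s = 0"
    by (subst AE_restrict_space_iff) auto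
  thus ?thesis unfolding spectral_measure_eq
    by (subst AE_density) (auto intro!: measurable_restrict_space1 elim: eventually_mono)
qed

text \<open>The polynomials take real values, so the real and imaginary parts of h are orthogonal to
  them separately.\<close>

theorem dual_hahn_complete:
  fixes h :: "real \<Rightarrow> complex"
  assumes pos: "0 < a" "0 < b" "0 < c"
    and h: "h \<in> L2_space (spectral_measure a b c)"
    and orth: "\<And>n. L2_inner (spectral_measure a b c) h (\<lambda>s. of_real (dual_hahn a b c n s)) = 0"
  shows "AE s in spectral_measure a b c. h s = 0"
proof -
  let ?M = "spectral_measure a b c"
  have pL: "(\<lambda>s. complex_of_real (poly f (s\<^sup>2))) \<in> L2_space ?M" for f
  proof (rule L2_spaceI)
    show "(\<lambda>s. complex_of_real (poly f (s\<^sup>2))) \<in> borel_measurable ?M"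
      by (intro borel_measurable_spectral borel_measurable_continuous_onI continuous_intros)
    have "(norm (complex_of_real (poly f (s\<^sup>2))))\<^sup>2 = poly (f * f) (s\<^sup>2)" for s by (simp add: power2_eq_square)
    thus "integrable ?M (\<lambda>s. (norm (complex_of_real (poly f (s\<^sup>2))))\<^sup>2)" using spectral_integral_poly(1)[OF pos, of "f * f"] by simp
  qed
  have I: "integrable ?M (\<lambda>s. h s * of_real (poly f (s\<^sup>2)))" for f
    using integrable_L2_mult[OF h pL[of f]] by simp
  have all: "(LINT s|?M. h s * of_real (poly f (s\<^sup>2))) = 0" for f
  proof (rule poly_as_shift_poly[where n="degree f" and B="hahn_poly a b c" and P="\<lambda>f. (LINT s|?M. h s * of_real (poly f (s\<^sup>2))) = 0"])
    show "(LINT s|?M. h s * of_real (poly (hahn_poly a b c k) (s\<^sup>2))) = 0" for k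
      using orth[of k] by (simp add: L2_inner_def dual_hahn_poly)
    show "(LINT s|?M. h s * of_real (poly (f + g) (s\<^sup>2))) = 0"
      if "(LINT s|?M. h s * of_real (poly f (s\<^sup>2))) = 0" "(LINT s|?M. h s * of_real (poly g (s\<^sup>2))) = 0" for f g
      using that I[of f] I[of g] by (simp add: distrib_left)
    show "(LINT s|?M. h s * of_real (poly (smult r f) (s\<^sup>2))) = 0"
      if "(LINT s|?M. h s * of_real (poly f (s\<^sup>2))) = 0" for r f
    proof -
      have "(LINT s|?M. h s * of_real (poly (smult r f) (s\<^sup>2))) = (LINT s|?M. of_real r * (h s * of_real (poly f (s\<^sup>2))))"
        by (simp add: mult_ac)
      thus ?thesis using that by (simp only: integral_mult_right_zero mult_zero_right)
    qed
  qed (auto simp: lead_hahn_poly_nonzero[OF pos])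
  have hm: "h \<in> borel_measurable ?M" and hsq: "integrable ?M (\<lambda>s. (norm (h s))\<^sup>2)" using h by (auto simp: L2_space_def)
  have "AE s in ?M. Re (h s) = 0"
  proof (rule dual_hahn_complete_real[OF pos])
    show m: "(\<lambda>s. Re (h s)) \<in> borel_measurable ?M" using hm by measurable
    show "integrable ?M (\<lambda>s. (Re (h s))\<^sup>2)"
      by (rule Bochner_Integration.integrable_bound[OF hsq]) (use m in \<open>auto simp: cmod_power2\<close>)
    show "(LINT s|?M. Re (h s) * poly f (s\<^sup>2)) = 0" for f
      using integral_Re[OF I[of f]] all[of f] by simp
  qed
  moreover have "AE s in ?M. Im (h s) = 0"
  proof (rule dual_hahn_complete_real[OF pos])
    show m: "(\<lambda>s. Im (h s)) \<in> borel_measurable ?M" using hm by measurable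
    show "integrable ?M (\<lambda>s. (Im (h s))\<^sup>2)"
      by (rule Bochner_Integration.integrable_bound[OF hsq]) (use m in \<open>auto simp: cmod_power2\<close>)
    show "(LINT s|?M. Im (h s) * poly f (s\<^sup>2)) = 0" for f
      using integral_Im[OF I[of f]] all[of f] by simp
  qed
  ultimately show ?thesis by eventually_elim (simp add: complex_eq_iff)
qed

section \<open>The disk space as a subspace of an \<open>L\<^sup>2\<close> space\<close>

text \<open>Rotation invariance of \<open>lborel\<close> on \<open>complex\<close> is imported from \<open>real^2\<close>, where the library has it.\<close>

definition cart_complex :: "real^2 \<Rightarrow> complex" where
  "cart_complex v = Complex (v $ 1) (v $ 2)"

definition complex_cart :: "complex \<Rightarrow> real^2" where
  "complex_cart z = vector [Re z, Im z]"

lemma cart_complex_inverse [simp]: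
  "cart_complex (complex_cart z) = z" "complex_cart (cart_complex v) = v"
  by (simp_all add: cart_complex_def complex_cart_def vec_eq_iff forall_2)

lemma linear_cart_complex: "linear cart_complex" "linear complex_cart"
  by (auto intro!: linearI simp: cart_complex_def complex_cart_def complex_eq_iff vec_eq_iff forall_2)

lemma norm_cart_complex: "norm (cart_complex v) = norm v"
  by (simp add: cart_complex_def cmod_def norm_vec_def L2_set_def sum_2)

lemma measurable_cart_complex [measurable]:
  "cart_complex \<in> borel_measurable borel" "complex_cart \<in> borel_measurable borel"
  using linear_cart_complex by (auto intro: borel_measurable_continuous_onI linear_continuous_on linear_conv_bounded_linear[THEN iffD1])

lemma emeasure_box_cart: "emeasure lborel (box l u :: (real^2) set) =
   (if l $ 1 \<le> u $ 1 \<and> l $ 2 \<le> u $ 2 then ennreal ((u $ 1 - l $ 1) * (u $ 2 - l $ 2)) else 0)"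
proof -
  have B: "(Basis :: (real^2) set) = {axis 1 1, axis 2 1}"
    by (auto simp: Basis_vec_def UNIV_2)
  have ne: "axis 1 1 \<noteq> (axis 2 1 :: real^2)" by (simp add: axis_eq_axis)
  show ?thesis unfolding emeasure_lborel_box_eq B using ne
    by (simp add: inner_axis)
qed

lemma lborel_distr_cart_complex: "distr lborel borel cart_complex = lborel"
proof (rule lborel_eqI[symmetric])
  fix l u :: complex assume lu: "\<And>b. b \<in> Basis \<Longrightarrow> l \<bullet> b \<le> u \<bullet> b"
  have "cart_complex -` box l u = box (complex_cart l) (complex_cart u)"
    by (auto simp: box_def Basis_complex_def cart_complex_def complex_cart_def Basis_vec_def UNIV_2 inner_axis)
  hence "emeasure (distr lborel borel cart_complex) (box l u) = emeasure lborel (box (complex_cart l) (complex_cart u))"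
    by (simp add: emeasure_distr)
  also have "\<dots> = ennreal ((Re u - Re l) * (Im u - Im l))"
    using lu[of 1] lu[of \<i>] by (simp add: emeasure_box_cart complex_cart_def Basis_complex_def)
  also have "(Re u - Re l) * (Im u - Im l) = (\<Prod>b\<in>Basis. (u - l) \<bullet> b)"
    by (simp add: Basis_complex_def)
  finally show "emeasure (distr lborel borel cart_complex) (box l u) = (\<Prod>b\<in>Basis. (u - l) \<bullet> b)" .
qed simp

lemma lborel_distr_orthogonal_cart:
  fixes R R' :: "real^2 \<Rightarrow> real^2"
  assumes R: "orthogonal_transformation R" "orthogonal_transformation R'" and inv: "\<And>v. R (R' v) = v" "\<And>v. R' (R v) = v"
  shows "distr lborel borel R = lborel"
proof (rule lborel_eqI[symmetric])
  fix l u :: "real^2" assume lu: "\<And>b. b \<in> Basis \<Longrightarrow> l \<bullet> b \<le> u \<bullet> b"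
  have [measurable]: "R \<in> borel_measurable borel"
    using orthogonal_transformation_linear[OF R(1)]
    by (auto intro: borel_measurable_continuous_onI linear_continuous_on linear_conv_bounded_linear[THEN iffD1])
  have pre: "R -` box l u = R' ` box l u"
    using inv by (auto simp: image_iff) metis
  have Rb: "R -` box l u \<in> sets borel" using measurable_sets[of R borel borel "box l u"] by simp
  have "emeasure (distr lborel borel R) (box l u) = emeasure lborel (R' ` box l u)"
    by (simp add: emeasure_distr pre)
  also have "\<dots> = emeasure lebesgue (R' ` box l u)"
    using Rb unfolding pre by simp
  also have "\<dots> = ennreal (measure lebesgue (R' ` box l u))"
    by (intro emeasure_eq_measure2 fmeasurableD2 measurable_orthogonal_image R(2)) simp
  also have "measure lebesgue (R' ` box l u) = measure lebesgue (box l u)"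
    by (intro measure_orthogonal_image R(2)) simp
  also have "ennreal (measure lebesgue (box l u)) = emeasure lebesgue (box l u)"
    by (intro emeasure_eq_measure2[symmetric] fmeasurableD2) simp
  also have "\<dots> = emeasure lborel (box l u)" by simp
  also have "\<dots> = (\<Prod>b\<in>Basis. (u - l) \<bullet> b)" using lu by (rule emeasure_lborel_box)
  finally show "emeasure (distr lborel borel R) (box l u) = (\<Prod>b\<in>Basis. (u - l) \<bullet> b)" .
qed simp

text \<open>Multiplication by \<zeta> is conjugate, under \<open>cart_complex\<close>, to an
  orthogonal map of the plane whose inverse is multiplication by the conjugate of \<zeta>.\<close>

lemma lborel_distr_rotation:
  fixes \<zeta> :: complex
  assumes "norm \<zeta> = 1"
  shows "distr lborel borel ((*) \<zeta>) = lborel"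
proof -
  define R where "R = (\<lambda>w v. complex_cart (w * cart_complex v))"
  have R: "orthogonal_transformation (R w)" if "norm w = 1" for w
    unfolding orthogonal_transformation
  proof
    have "linear ((*) w :: complex \<Rightarrow> complex)" by (intro linearI) (auto simp: algebra_simps)
    thus "linear (R w)" unfolding R_def using linear_compose[OF linear_compose[OF linear_cart_complex(1)] linear_cart_complex(2)]
      by (simp add: o_def)
    have "norm (complex_cart z) = norm z" for z using norm_cart_complex[of "complex_cart z"] by simp
    thus "\<forall>v. norm (R w v) = norm v" using that by (simp add: R_def norm_mult norm_cart_complex)
  qed
  have c: "\<zeta> * cnj \<zeta> = 1" using assms by (simp add: complex_norm_square[symmetric])
  have RL: "distr lborel borel (R \<zeta>) = lborel"
  proof (rule lborel_distr_orthogonal_cart[OF R R, of \<zeta> "cnj \<zeta>"])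
    have "\<zeta> * (cnj \<zeta> * z) = z" "cnj \<zeta> * (\<zeta> * z) = z" for z
      using c by (simp_all add: mult.assoc[symmetric] mult.commute[of "cnj \<zeta>" \<zeta>])
    thus "R \<zeta> (R (cnj \<zeta>) v) = v" "R (cnj \<zeta>) (R \<zeta> v) = v" for v
      by (simp_all only: R_def cart_complex_inverse)
  qed (use assms in auto)
  have [measurable]: "R \<zeta> \<in> borel_measurable borel" unfolding R_def by measurable
  have "distr lborel borel ((*) \<zeta>) = distr (distr lborel borel cart_complex) borel ((*) \<zeta>)"
    by (simp add: lborel_distr_cart_complex)
  also have "\<dots> = distr lborel borel ((*) \<zeta> \<circ> cart_complex)" by (rule distr_distr) measurable
  also have "(*) \<zeta> \<circ> cart_complex = cart_complex \<circ> R \<zeta>" by (auto simp: R_def)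
  also have "distr lborel borel (cart_complex \<circ> R \<zeta>) = distr (distr lborel borel (R \<zeta>)) borel cart_complex"
    by (rule distr_distr[symmetric]) measurable
  also have "\<dots> = lborel" by (simp add: RL lborel_distr_cart_complex)
  finally show ?thesis .
qed

text \<open>Rotation by \<zeta> with \<zeta>^(m - n) = -1 preserves the measure and changes the sign
  of the integrand.\<close>

lemma integral_radial_monomials:
  fixes \<psi> :: "real \<Rightarrow> real"
  assumes [measurable]: "\<psi> \<in> borel_measurable borel" and "m \<noteq> n"
  shows "(LINT z|lborel. z ^ m * cnj (z ^ n) * of_real (\<psi> (norm z))) = 0"
proof -
  define G where "G = (\<lambda>z. z ^ m * cnj (z ^ n) * complex_of_real (\<psi> (norm z)))"
  have [measurable]: "G \<in> borel_measurable borel" unfolding G_def by measurable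
  define \<zeta> where "\<zeta> = cis (pi / (real m - real n))"
  have \<zeta>: "norm \<zeta> = 1" by (simp add: \<zeta>_def)
  have "\<zeta> ^ m * cnj (\<zeta> ^ n) = cis ((real m - real n) * (pi / (real m - real n)))"
    by (simp add: \<zeta>_def Complex.DeMoivre cis_cnj cis_mult left_diff_distrib diff_divide_distrib)
  also have "\<dots> = -1" using assms(2) by simp
  finally have z: "\<zeta> ^ m * cnj (\<zeta> ^ n) = -1" .
  have "(LINT z|lborel. G z) = (LINT z|distr lborel borel ((*) \<zeta>). G z)"
    by (simp add: lborel_distr_rotation[OF \<zeta>])
  also have "\<dots> = (LINT z|lborel. G (\<zeta> * z))" by (rule integral_distr) measurable
  also have "(\<lambda>z. G (\<zeta> * z)) = (\<lambda>z. - G z)"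
  proof
    fix z
    have "G (\<zeta> * z) = (\<zeta> ^ m * cnj (\<zeta> ^ n)) * G z"
      using \<zeta> by (simp add: G_def norm_mult power_mult_distrib mult_ac)
    thus "G (\<zeta> * z) = - G z" unfolding z by simp
  qed
  finally show ?thesis unfolding G_def by simp
qed

text \<open>Polar coordinates in the variable t = |z|^2: the part of the disk with |z|^2 > x has
  area pi (1 - x), so t is uniformly distributed on (0, 1). Half-lines determine the measure, so
  only areas of discs enter.\<close>

lemma distr_norm_square_disk:
  "distr (restrict_space lborel (ball (0::complex) 1)) borel (\<lambda>z. (norm z)\<^sup>2) = density lborel (\<lambda>t. ennreal (pi * indicator {0<..<1} t))"
    (is "?M = ?N")
proof (rule measure_eqI_lessThan)
  have ball: "emeasure lborel (ball (0::complex) r) = ennreal (pi * r\<^sup>2)" "emeasure lborel (cball (0::complex) r) = ennreal (pi * r\<^sup>2)"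
    if "r \<ge> 0" for r
    using emeasure_ball[OF that, of "0::complex"] emeasure_cball[OF that, of "0::complex"] by (simp_all add: eval_unit_ball_vol)
  have M: "emeasure ?M {x<..} = emeasure lborel {z \<in> ball (0::complex) 1. x < (norm z)\<^sup>2}" for x
  proof -
    have "(\<lambda>z. (norm z)\<^sup>2) -` {x<..} \<inter> ball (0::complex) 1 = {z \<in> ball (0::complex) 1. x < (norm z)\<^sup>2}" by auto
    moreover have "emeasure (restrict_space lborel (ball (0::complex) 1)) {z \<in> ball (0::complex) 1. x < (norm z)\<^sup>2} = emeasure lborel {z \<in> ball (0::complex) 1. x < (norm z)\<^sup>2}"
      by (rule emeasure_restrict_space) auto
    ultimately show ?thesis
      by (subst emeasure_distr) (auto simp: space_restrict_space intro!: measurable_restrict_space1)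
  qed
  have N: "emeasure ?N {x<..} = ennreal pi * emeasure lborel ({0<..<1} \<inter> {x<..})" for x
  proof -
    have "emeasure ?N {x<..} = (\<integral>\<^sup>+t. ennreal pi * indicator ({0<..<1} \<inter> {x<..}) t \<partial>lborel)"
      by (subst emeasure_density) (auto intro!: nn_integral_cong simp: indicator_def)
    thus ?thesis by (simp add: nn_integral_cmult_indicator)
  qed
  fix x :: real
  show eq: "emeasure ?M {x<..} = emeasure ?N {x<..}"
  proof -
    consider "x < 0" | "0 \<le> x" "x < 1" | "1 \<le> x" by linarith
    thus ?thesis
    proof cases
      case 1
      hence "x < (norm z)\<^sup>2" for z :: complex using zero_le_power2[of "norm z"] by linarith
      hence "{z \<in> ball (0::complex) 1. x < (norm z)\<^sup>2} = ball 0 1" by auto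
      moreover have "{0<..<1} \<inter> {x<..} = {0<..<1::real}" using 1 by auto
      ultimately show ?thesis unfolding M N using ball(1)[of 1] by simp
    next
      case 2
      define r where "r = sqrt x"
      have r: "0 \<le> r" "r < 1" "x = r\<^sup>2" using 2 by (auto simp: r_def)
      have iff: "x < (norm z)\<^sup>2 \<longleftrightarrow> r < norm z" for z :: complex
        unfolding r(3) using r(1) by (auto simp: power2_less_imp_less intro: power_strict_mono)
      have s: "{z \<in> ball (0::complex) 1. x < (norm z)\<^sup>2} = ball 0 1 - cball 0 r" unfolding iff by auto
      have "emeasure lborel (ball (0::complex) 1 - cball 0 r) = emeasure lborel (ball (0::complex) 1) - emeasure lborel (cball (0::complex) r)"
        using r by (intro emeasure_Diff) (auto simp: ball)
      also have "\<dots> = ennreal (pi * 1\<^sup>2 - pi * r\<^sup>2)"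
        unfolding ball(1)[OF zero_le_one] ball(2)[OF r(1)] by (rule ennreal_minus) simp
      finally have "emeasure ?M {x<..} = ennreal (pi * (1 - x))" unfolding M s by (simp add: r(3) algebra_simps)
      moreover have "{0<..<1} \<inter> {x<..} = {x<..<1}" using 2 by auto
      ultimately show ?thesis unfolding N using 2 by (simp add: ennreal_mult)
    next
      case 3
      have "\<not> x < (norm z)\<^sup>2" if "z \<in> ball 0 1" for z :: complex
      proof -
        have "(norm z)\<^sup>2 \<le> 1\<^sup>2" using that by (intro power_mono) auto
        thus ?thesis using 3 by simp
      qed
      hence "{z \<in> ball (0::complex) 1. x < (norm z)\<^sup>2} = {}" by auto
      moreover have "{0<..<1} \<inter> {x<..} = {}" using 3 by auto
      ultimately show ?thesis unfolding M N by (simp only: emeasure_empty mult_zero_right)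
    qed
  qed
  have "emeasure ?N {x<..} \<le> ennreal pi * emeasure lborel {0<..<1::real}"
    unfolding N by (intro mult_left_mono emeasure_mono) auto
  also have "\<dots> < \<infinity>" by simp
  finally show "emeasure ?M {x<..} < \<infinity>" unfolding eq .
qed auto

lemma nn_integral_radial_disk:
  fixes \<phi> :: "real \<Rightarrow> ennreal"
  assumes [measurable]: "\<phi> \<in> borel_measurable borel"
  shows "(\<integral>\<^sup>+z. \<phi> ((norm z)\<^sup>2) \<partial>restrict_space lborel (ball (0::complex) 1)) = ennreal pi * (\<integral>\<^sup>+t. \<phi> t * indicator {0<..<1} t \<partial>lborel)"
proof -
  have "(\<integral>\<^sup>+z. \<phi> ((norm z)\<^sup>2) \<partial>restrict_space lborel (ball (0::complex) 1)) = (\<integral>\<^sup>+t. \<phi> t \<partial>distr (restrict_space lborel (ball (0::complex) 1)) borel (\<lambda>z. (norm z)\<^sup>2))"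
    by (rule nn_integral_distr[symmetric]) (auto intro!: measurable_restrict_space1)
  also have "\<dots> = (\<integral>\<^sup>+t. ennreal pi * (\<phi> t * indicator {0<..<1} t) \<partial>lborel)"
    unfolding distr_norm_square_disk
    by (subst nn_integral_density) (auto intro!: nn_integral_cong simp: indicator_def)
  also have "\<dots> = ennreal pi * (\<integral>\<^sup>+t. \<phi> t * indicator {0<..<1} t \<partial>lborel)"
    by (rule nn_integral_cmult) measurable
  finally show ?thesis .
qed

text \<open>The density is a function of \<open>t = |z|\<^sup>2\<close>.  Its value at \<open>t = 0\<close>, where the series may diverge, is irrelevant.\<close>

definition weight_coeff :: "real \<Rightarrow> real \<Rightarrow> real \<Rightarrow> nat \<Rightarrow> real" where
  "weight_coeff a b c k = pochhammer (a - b) k * pochhammer (a - c) k / (pochhammer (2 * a - 1) k * fact k)"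

definition weight_series :: "real \<Rightarrow> real \<Rightarrow> real \<Rightarrow> real \<Rightarrow> real" where
  "weight_series a b c u = (\<Sum>k. weight_coeff a b c k * u ^ k)"

definition disk_density :: "real \<Rightarrow> real \<Rightarrow> real \<Rightarrow> real \<Rightarrow> real" where
  "disk_density a b c t = (1 - t) powr (2 * a - 2) * weight_series a b c (1 - t) / (pi * Gamma (2 * a - 1))"

definition disk_measure :: "real \<Rightarrow> real \<Rightarrow> real \<Rightarrow> complex measure" where
  "disk_measure a b c = density (restrict_space lborel (ball 0 1)) (\<lambda>z. ennreal (disk_density a b c ((norm z)\<^sup>2)))"

lemma weight_series_measurable [measurable]: "weight_series a b c \<in> borel_measurable borel"
  unfolding weight_series_def by measurable

lemma disk_density_measurable [measurable]: "disk_density a b c \<in> borel_measurable borel"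
  unfolding disk_density_def by measurable

section \<open>Positivity and moments of the radial density\<close>

locale disk_parameters =
  fixes a b c :: real
  assumes pos: "0 < a" "0 < b" "0 < c" and ba: "b < a" and ca: "c < a" and a2: "1 < 2 * a"
begin

lemma weight_coeff_nonneg: "weight_coeff a b c k \<ge> 0"
  using ba ca a2 by (auto simp: weight_coeff_def intro!: divide_nonneg_nonneg mult_nonneg_nonneg pochhammer_nonneg)

lemma weight_coeff_complex:
  "complex_of_real (weight_coeff a b c k) = gauss_coeff (of_real (a - b)) (of_real (a - c)) (of_real (2 * a - 1)) k"
  unfolding weight_coeff_def gauss_coeff_def pochhammer_of_real by simp

lemma summable_weight:
  assumes "0 \<le> u" "u < 1"
  shows "summable (\<lambda>k. weight_coeff a b c k * u ^ k)"
proof -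
  have "summable (\<lambda>k. norm (gauss_coeff (of_real (a - b)) (of_real (a - c)) (of_real (2 * a - 1)) k) * u ^ k)"
    using ba ca a2 assms by (intro summable_gauss_power) auto
  thus ?thesis unfolding weight_coeff_complex[symmetric] using weight_coeff_nonneg by simp
qed

text \<open>All coefficients are nonnegative and the constant one is 1. The bound makes the norm
  with the hypergeometric factor control the one without it.\<close>

lemma weight_series_ge_1:
  assumes "0 \<le> u" "u < 1"
  shows "weight_series a b c u \<ge> 1"
proof -
  have "(\<Sum>k\<in>{0}. weight_coeff a b c k * u ^ k) \<le> weight_series a b c u"
    unfolding weight_series_def using assms weight_coeff_nonneg by (intro sum_le_suminf summable_weight) auto
  thus ?thesis by (simp add: weight_coeff_def)
qed

lemma weight_series_mono:
  assumes "0 \<le> u" "u \<le> v" "v < 1"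
  shows "weight_series a b c u \<le> weight_series a b c v"
  unfolding weight_series_def using assms weight_coeff_nonneg
  by (intro suminf_le mult_left_mono power_mono summable_weight) auto

lemma hyp2F1_weight:
  assumes "0 < u" "u < 1"
  shows "hyp2F1 (of_real (a - b)) (of_real (a - c)) (of_real (2 * a - 1)) (of_real u) = of_real (weight_series a b c u)"
proof -
  have "hyp2F1 (of_real (a - b)) (of_real (a - c)) (of_real (2 * a - 1)) (of_real u) = (\<Sum>k. complex_of_real (weight_coeff a b c k * u ^ k))"
    using assms by (simp add: hyp2F1_def gauss_series_eq weight_coeff_complex)
  thus ?thesis unfolding weight_series_def using summable_weight[of u] assms by (simp add: suminf_of_real)
qed

lemma Gamma_2a_pos: "Gamma (2 * a - 1) > 0"
  using a2 by (intro Gamma_real_pos) simp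

lemma Gamma_2a_nonzero [simp]: "Gamma (2 * a - 1) \<noteq> 0" "Gamma (a * 2 - 1) \<noteq> 0"
  using Gamma_2a_pos by (auto simp: mult.commute)

lemma disk_density_nonneg: "0 < t \<Longrightarrow> t \<le> 1 \<Longrightarrow> disk_density a b c t \<ge> 0"
  using weight_series_ge_1[of "1 - t"] Gamma_2a_pos by (auto simp: disk_density_def intro!: divide_nonneg_pos mult_nonneg_nonneg)

text \<open>The terms are nonnegative, so they may be integrated one by one; each is a beta integral
  with parameters n + 1 and 2a - 1 + k. Its value replaces (2a - 1)_k by (2a + n)_k in the
  coefficient, and Gauss's theorem sums the series with parameters (a - b, a - c; 2a + n) at 1, of
  excess b + c + n.\<close>

lemma disk_moment_integral:
  "(\<integral>\<^sup>+t. ennreal (t ^ n * disk_density a b c t) * indicator {0<..<1} t \<partial>lborel) = ennreal (disk_moment a b c n / pi)"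
proof -
  define f where "f = (\<lambda>k t. weight_coeff a b c k / (pi * Gamma (2 * a - 1)) * (indicator {0..1} t * (t powr (real n + 1 - 1) * (1 - t) powr (2 * a - 1 + real k - 1))))"
  have f0: "f k t \<ge> 0" for k t unfolding f_def using weight_coeff_nonneg Gamma_2a_pos by (intro mult_nonneg_nonneg divide_nonneg_nonneg) auto
  have fI: "(\<integral>\<^sup>+t. ennreal (f k t) \<partial>lborel) = ennreal (weight_coeff a b c k / (pi * Gamma (2 * a - 1)) * Beta (real n + 1) (2 * a - 1 + real k))" for k
  proof -
    have p: "real n + 1 > 0" "2 * a - 1 + real k > 0" using a2 by auto
    have hi: "((\<lambda>t. t powr (real n + 1 - 1) * (1 - t) powr (2 * a - 1 + real k - 1)) has_integral Beta (real n + 1) (2 * a - 1 + real k)) {0..1}"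
      by (rule has_integral_Beta_real[OF p])
    have "(\<integral>\<^sup>+t. ennreal (indicator {0..1} t * (t powr (real n + 1 - 1) * (1 - t) powr (2 * a - 1 + real k - 1))) \<partial>lborel) = ennreal (Beta (real n + 1) (2 * a - 1 + real k))"
      using nn_integral_has_integral_lebesgue[OF _ hi] by simp
    moreover have "(\<integral>\<^sup>+t. ennreal (f k t) \<partial>lborel) = ennreal (weight_coeff a b c k / (pi * Gamma (2 * a - 1))) * (\<integral>\<^sup>+t. ennreal (indicator {0..1} t * (t powr (real n + 1 - 1) * (1 - t) powr (2 * a - 1 + real k - 1))) \<partial>lborel)"
    proof -
      have "0 \<le> weight_coeff a b c k / (pi * Gamma (2 * a - 1))"
        using weight_coeff_nonneg[of k] Gamma_2a_pos by (intro divide_nonneg_pos) auto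
      hence "ennreal (f k t) = ennreal (weight_coeff a b c k / (pi * Gamma (2 * a - 1))) * ennreal (indicator {0..1} t * (t powr (real n + 1 - 1) * (1 - t) powr (2 * a - 1 + real k - 1)))" for t
        unfolding f_def by (rule ennreal_mult) auto
      thus ?thesis by (simp only:) (rule nn_integral_cmult, measurable)
    qed
    moreover have "Beta (real n + 1) (2 * a - 1 + real k) \<ge> 0"
      using p by (auto intro!: Beta_real_nonneg)
    moreover have "weight_coeff a b c k / (pi * Gamma (2 * a - 1)) \<ge> 0"
      using weight_coeff_nonneg[of k] Gamma_2a_pos by (intro divide_nonneg_pos) auto
    ultimately show ?thesis by (simp only: ennreal_mult)
  qed
  have "(\<integral>\<^sup>+t. ennreal (t ^ n * disk_density a b c t) * indicator {0<..<1} t \<partial>lborel) = (\<integral>\<^sup>+t. (\<Sum>k. ennreal (f k t)) \<partial>lborel)"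
  proof (rule nn_integral_cong_AE)
    show "AE t in lborel. ennreal (t ^ n * disk_density a b c t) * indicator {0<..<1} t = (\<Sum>k. ennreal (f k t))"
      using AE_lborel_singleton[of "0::real"] AE_lborel_singleton[of "1::real"]
    proof eventually_elim
      case (elim t)
      show ?case
      proof (cases "0 < t \<and> t < 1")
        case True
        have fk: "f k t = (t ^ n * (1 - t) powr (2 * a - 2) / (pi * Gamma (2 * a - 1))) * (weight_coeff a b c k * (1 - t) ^ k)" for k
        proof -
          have "(1 - t) powr (2 * a - 1 + real k - 1) = (1 - t) powr (2 * a - 2) * (1 - t) ^ k"
            using True powr_add[of "1 - t" "2 * a - 2" "real k"] by (simp add: powr_realpow algebra_simps)
          thus ?thesis using True by (simp add: f_def powr_realpow)
        qed
        have s: "summable (\<lambda>k. weight_coeff a b c k * (1 - t) ^ k)" using True by (intro summable_weight) auto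
        have "(\<Sum>k. ennreal (f k t)) = ennreal (\<Sum>k. f k t)"
          by (intro suminf_ennreal2 f0) (unfold fk, rule summable_mult[OF s])
        also have "(\<Sum>k. f k t) = t ^ n * disk_density a b c t"
          unfolding fk suminf_mult[OF s] by (simp add: disk_density_def weight_series_def)
        finally show ?thesis using True by simp
      next
        case False
        hence "f k t = 0" for k using elim by (auto simp: f_def indicator_def)
        thus ?thesis using False by simp
      qed
    qed
  qed
  also have "\<dots> = (\<Sum>k. \<integral>\<^sup>+t. ennreal (f k t) \<partial>lborel)"
    by (rule nn_integral_suminf) (auto simp: f_def)
  also have "\<dots> = ennreal (disk_moment a b c n / pi)"
  proof -
    define A where "A = complex_of_real (a - b)"
    define B where "B = complex_of_real (a - c)"
    define C where "C = complex_of_real (2 * a + real n)"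
    define T where "T = (\<lambda>k. pochhammer (a - b) k * pochhammer (a - c) k / (pochhammer (2 * a + real n) k * fact k))"
    have T0: "T k \<ge> 0" for k unfolding T_def using ba ca a2 by (intro divide_nonneg_nonneg mult_nonneg_nonneg pochhammer_nonneg) auto
    have Tc: "complex_of_real (T k) = gauss_coeff A B C k" for k
      unfolding T_def gauss_coeff_def A_def B_def C_def pochhammer_of_real by simp
    have Re: "Re A > 0" "Re B > 0" "Re (C - A - B) > 0" using pos ba ca by (auto simp: A_def B_def C_def)
    have sT: "summable T" using summable_gauss_coeff(1)[OF Re] unfolding Tc[symmetric] using T0 by simp
    have "complex_of_real (\<Sum>k. T k) = (\<Sum>k. gauss_coeff A B C k)" unfolding Tc[symmetric] using sT by (simp add: suminf_of_real)
    also have "\<dots> = Gamma C * Gamma (C - A - B) / (Gamma (C - A) * Gamma (C - B))" by (rule Gauss_summation[OF Re])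
    finally have ST0: "complex_of_real (\<Sum>k. T k) = Gamma C * Gamma (C - A - B) / (Gamma (C - A) * Gamma (C - B))" .
    have "C - A - B = of_real (b + c + real n)" "C - A = of_real (a + b + real n)" "C - B = of_real (a + c + real n)"
      by (simp_all add: A_def B_def C_def)
    with ST0 have ST: "(\<Sum>k. T k) = Gamma (2 * a + real n) * Gamma (b + c + real n) / (Gamma (a + b + real n) * Gamma (a + c + real n))"
      by (simp only: C_def Gamma_complex_of_real of_real_mult[symmetric] of_real_divide[symmetric] of_real_eq_iff)
    have G: "Gamma (2 * a + real n) > 0" using pos by (intro Gamma_real_pos) simp
    have summand: "weight_coeff a b c k / (pi * Gamma (2 * a - 1)) * Beta (real n + 1) (2 * a - 1 + real k) = fact n / (pi * Gamma (2 * a + real n)) * T k" for k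
    proof -
      have 1: "Gamma (2 * a - 1 + real k) = Gamma (2 * a - 1) * pochhammer (2 * a - 1) k"
        using pochhammer_Gamma[of "2 * a - 1" k] a2 Gamma_2a_pos by (simp add: pos_notin_nonpos_Ints)
      have 2: "Gamma (2 * a + real n + real k) = Gamma (2 * a + real n) * pochhammer (2 * a + real n) k"
        using pochhammer_Gamma[of "2 * a + real n" k] a2 less_imp_neq[OF G, symmetric] by (simp add: pos_notin_nonpos_Ints)
      have 3: "real n + 1 + (2 * a - 1 + real k) = 2 * a + real n + real k" by simp
      have 4: "Gamma (real n + 1) = fact n" using Gamma_fact[of n, where 'a=real] by (simp add: add.commute)
      have 5: "pochhammer (2 * a - 1) k > 0" using a2 by (intro pochhammer_pos) simp
      show ?thesis unfolding Beta_def 3 1 2 4 weight_coeff_def T_def using 5 Gamma_2a_pos by (simp add: mult_ac)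
    qed
    have "(\<Sum>k. \<integral>\<^sup>+t. ennreal (f k t) \<partial>lborel) = (\<Sum>k. ennreal (fact n / (pi * Gamma (2 * a + real n)) * T k))"
      unfolding fI summand ..
    also have "\<dots> = ennreal (\<Sum>k. fact n / (pi * Gamma (2 * a + real n)) * T k)"
      using T0 G sT by (intro suminf_ennreal2 summable_mult mult_nonneg_nonneg) auto
    also have "(\<Sum>k. fact n / (pi * Gamma (2 * a + real n)) * T k) = disk_moment a b c n / pi"
      unfolding suminf_mult[OF sT] ST disk_moment_def using G by (simp add: mult_ac)
    finally show ?thesis .
  qed
  finally show ?thesis .
qed

end

section \<open>Finite orthogonal sums and polynomials with given coefficients\<close>

lemma
  fixes e :: "nat \<Rightarrow> 'a \<Rightarrow> complex" and g :: "nat \<Rightarrow> real"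
  assumes e: "\<And>n. e n \<in> L2_space M" and orth: "\<And>m n. L2_inner M (e m) (e n) = (if m = n then of_real (g n) else 0)"
    and A: "finite A"
  shows L2_inner_orthogonal_sum: "L2_inner M (\<lambda>x. \<Sum>n\<in>A. \<alpha> n * e n x) (\<lambda>x. \<Sum>n\<in>A. \<beta> n * e n x) = (\<Sum>n\<in>A. \<alpha> n * cnj (\<beta> n) * of_real (g n))"
    and L2_norm_orthogonal_sum: "(L2_norm M (\<lambda>x. \<Sum>n\<in>A. \<alpha> n * e n x))\<^sup>2 = (\<Sum>n\<in>A. (norm (\<alpha> n))\<^sup>2 * g n)"
proof -
  have eL: "(\<lambda>x. \<gamma> n * e n x) \<in> L2_space M" for \<gamma> n by (rule L2_space_scale[OF e])
  have inner: "L2_inner M (\<lambda>x. \<Sum>n\<in>A. \<alpha> n * e n x) (\<lambda>x. \<Sum>n\<in>A. \<beta> n * e n x) = (\<Sum>n\<in>A. \<alpha> n * cnj (\<beta> n) * of_real (g n))" for \<beta>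
  proof -
    have "L2_inner M (\<lambda>x. \<Sum>n\<in>A. \<alpha> n * e n x) (\<lambda>x. \<Sum>n\<in>A. \<beta> n * e n x) = (\<Sum>m\<in>A. L2_inner M (\<lambda>x. \<alpha> m * e m x) (\<lambda>x. \<Sum>n\<in>A. \<beta> n * e n x))"
      by (intro L2_inner_sum_left A eL L2_space_sum)
    also have "\<dots> = (\<Sum>m\<in>A. \<Sum>n\<in>A. L2_inner M (\<lambda>x. \<alpha> m * e m x) (\<lambda>x. \<beta> n * e n x))"
      by (intro sum.cong refl L2_inner_sum_right A eL)
    also have "\<dots> = (\<Sum>m\<in>A. \<Sum>n\<in>A. if n = m then \<alpha> n * cnj (\<beta> n) * of_real (g n) else 0)"
      by (intro sum.cong refl) (simp add: L2_inner_scale_left L2_inner_scale_right orth)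
    also have "\<dots> = (\<Sum>n\<in>A. \<alpha> n * cnj (\<beta> n) * of_real (g n))"
      using A by (simp add: sum.delta')
    finally show ?thesis .
  qed
  show "L2_inner M (\<lambda>x. \<Sum>n\<in>A. \<alpha> n * e n x) (\<lambda>x. \<Sum>n\<in>A. \<beta> n * e n x) = (\<Sum>n\<in>A. \<alpha> n * cnj (\<beta> n) * of_real (g n))"
    by (rule inner)
  have "complex_of_real ((L2_norm M (\<lambda>x. \<Sum>n\<in>A. \<alpha> n * e n x))\<^sup>2) = (\<Sum>n\<in>A. \<alpha> n * cnj (\<alpha> n) * of_real (g n))"
    unfolding L2_inner_self_norm[symmetric] by (rule inner)
  also have "\<dots> = of_real (\<Sum>n\<in>A. (norm (\<alpha> n))\<^sup>2 * g n)"
    by (simp add: complex_norm_square[symmetric] flip: of_real_power)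
  finally show "(L2_norm M (\<lambda>x. \<Sum>n\<in>A. \<alpha> n * e n x))\<^sup>2 = (\<Sum>n\<in>A. (norm (\<alpha> n))\<^sup>2 * g n)"
    by (simp only: of_real_eq_iff)
qed

lemma ball_sets_borel [measurable]: "ball (x :: complex) r \<in> sets borel"
  by simp

definition coeff_poly :: "(nat \<Rightarrow> complex) \<Rightarrow> nat \<Rightarrow> complex poly" where
  "coeff_poly \<alpha> N = (\<Sum>n<N. monom (\<alpha> n) n)"

lemma poly_coeff_poly: "poly (coeff_poly \<alpha> N) z = (\<Sum>n<N. \<alpha> n * z ^ n)"
  by (simp add: coeff_poly_def poly_sum poly_monom)

lemma coeff_coeff_poly: "coeff (coeff_poly \<alpha> N) n = (if n < N then \<alpha> n else 0)"
  by (simp add: coeff_poly_def coeff_sum)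

lemma poly_as_sum:
  fixes p :: "complex poly"
  assumes "degree p < N"
  shows "poly p z = (\<Sum>n<N. coeff p n * z ^ n)"
  unfolding poly_altdef using assms by (intro sum.mono_neutral_left) (auto simp: coeff_eq_0)

section \<open>The disk measure and expansions in powers of z\<close>

context disk_parameters
begin

lemma space_disk_measure [simp]: "space (disk_measure a b c) = ball 0 1"
  by (simp add: disk_measure_def space_restrict_space)

lemma borel_measurable_disk_iff:
  fixes f :: "complex \<Rightarrow> 'b :: real_normed_vector"
  shows "f \<in> borel_measurable (disk_measure a b c) \<longleftrightarrow> (\<lambda>z. indicator (ball 0 1) z *\<^sub>R f z) \<in> borel_measurable borel"
proof -
  have "f \<in> borel_measurable (disk_measure a b c) \<longleftrightarrow> f \<in> borel_measurable (restrict_space borel (ball 0 1))"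
    unfolding disk_measure_def by (simp cong: measurable_cong_sets sets_restrict_space_cong)
  thus ?thesis by (subst (asm) borel_measurable_restrict_space_iff) auto
qed

lemma borel_measurable_disk: "f \<in> borel_measurable borel \<Longrightarrow> f \<in> borel_measurable (disk_measure a b c)"
  unfolding disk_measure_def by (simp add: measurable_restrict_space1)

lemma holomorphic_measurable_disk:
  assumes "f holomorphic_on ball 0 1"
  shows "f \<in> borel_measurable (disk_measure a b c)"
proof -
  have "f \<in> borel_measurable (restrict_space borel (ball 0 1))"
    by (rule borel_measurable_continuous_on_restrict[OF holomorphic_on_imp_continuous_on[OF assms]])
  thus ?thesis unfolding disk_measure_def by (simp cong: measurable_cong_sets sets_restrict_space_cong)
qed

lemma AE_density_nonneg: "AE z in restrict_space lborel (ball (0::complex) 1). 0 \<le> disk_density a b c ((norm z)\<^sup>2)"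
proof -
  have "AE z in lborel. z \<in> ball (0::complex) 1 \<longrightarrow> 0 \<le> disk_density a b c ((norm z)\<^sup>2)"
    using AE_lborel_singleton[of "0::complex"]
  proof eventually_elim
    case (elim z)
    show ?case
    proof
      assume "z \<in> ball 0 1"
      hence "(norm z)\<^sup>2 \<le> 1\<^sup>2" by (intro power_mono) auto
      thus "0 \<le> disk_density a b c ((norm z)\<^sup>2)" using elim by (intro disk_density_nonneg) auto
    qed
  qed
  thus ?thesis by (subst AE_restrict_space_iff) auto
qed

lemma disk_integral:
  fixes g :: "complex \<Rightarrow> 'b :: {banach, second_countable_topology}"
  assumes g: "g \<in> borel_measurable (disk_measure a b c)"
  shows "integrable (disk_measure a b c) g \<longleftrightarrow> integrable lborel (\<lambda>z. indicator (ball 0 1) z *\<^sub>R (disk_density a b c ((norm z)\<^sup>2) *\<^sub>R g z))"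
    and "(LINT z|disk_measure a b c. g z) = (LINT z|lborel. indicator (ball 0 1) z *\<^sub>R (disk_density a b c ((norm z)\<^sup>2) *\<^sub>R g z))"
proof -
  have g': "g \<in> borel_measurable (restrict_space lborel (ball 0 1))" using g by (simp add: disk_measure_def)
  have w: "(\<lambda>z. disk_density a b c ((norm z)\<^sup>2)) \<in> borel_measurable (restrict_space lborel (ball (0::complex) 1))"
    by (intro measurable_restrict_space1) measurable
  show "integrable (disk_measure a b c) g \<longleftrightarrow> integrable lborel (\<lambda>z. indicator (ball 0 1) z *\<^sub>R (disk_density a b c ((norm z)\<^sup>2) *\<^sub>R g z))"
    unfolding disk_measure_def integrable_density[OF g' w AE_density_nonneg]
    by (subst integrable_restrict_space) auto
  show "(LINT z|disk_measure a b c. g z) = (LINT z|lborel. indicator (ball 0 1) z *\<^sub>R (disk_density a b c ((norm z)\<^sup>2) *\<^sub>R g z))"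
    unfolding disk_measure_def integral_density[OF g' w AE_density_nonneg]
    by (subst integral_restrict_space) auto
qed

lemma disk_moment_nonneg: "disk_moment a b c n \<ge> 0"
  and disk_moment_pos: "disk_moment a b c n > 0"
proof -
  show "disk_moment a b c n > 0" using pos by (auto simp: disk_moment_def intro!: divide_pos_pos mult_pos_pos Gamma_real_pos)
  thus "disk_moment a b c n \<ge> 0" by simp
qed

lemma disk_monomial_moment:
  "has_bochner_integral (disk_measure a b c) (\<lambda>z. (norm z)^(2 * n)) (disk_moment a b c n)"
proof (rule has_bochner_integral_nn_integral)
  show "(\<lambda>z. (norm z)^(2 * n)) \<in> borel_measurable (disk_measure a b c)" by (intro borel_measurable_disk) measurable
  show "(\<integral>\<^sup>+z. ennreal ((norm z)^(2 * n)) \<partial>disk_measure a b c) = ennreal (disk_moment a b c n)"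
  proof -
    have "(\<integral>\<^sup>+z. ennreal ((norm z)^(2 * n)) \<partial>disk_measure a b c) =
        (\<integral>\<^sup>+z. ennreal (disk_density a b c ((norm z)\<^sup>2)) * ennreal ((norm z)^(2 * n)) \<partial>restrict_space lborel (ball (0::complex) 1))"
      unfolding disk_measure_def by (rule nn_integral_density) (intro measurable_restrict_space1, measurable)+
    also have "\<dots> = (\<integral>\<^sup>+z. ennreal (((norm z)\<^sup>2) ^ n * disk_density a b c ((norm z)\<^sup>2)) \<partial>restrict_space lborel (ball (0::complex) 1))"
    proof (rule nn_integral_cong)
      fix z :: complex
      have "((norm z)\<^sup>2) ^ n * disk_density a b c ((norm z)\<^sup>2) = disk_density a b c ((norm z)\<^sup>2) * (norm z)^(2 * n)"
        unfolding power_mult by (rule mult.commute)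
      thus "ennreal (disk_density a b c ((norm z)\<^sup>2)) * ennreal ((norm z)^(2 * n)) = ennreal (((norm z)\<^sup>2) ^ n * disk_density a b c ((norm z)\<^sup>2))"
        by (simp only: ennreal_mult''[OF zero_le_power[OF norm_ge_zero]])
    qed
    also have "\<dots> = ennreal pi * (\<integral>\<^sup>+t. ennreal (t ^ n * disk_density a b c t) * indicator {0<..<1} t \<partial>lborel)"
      by (rule nn_integral_radial_disk) measurable
    also have "\<dots> = ennreal pi * ennreal (disk_moment a b c n / pi)" unfolding disk_moment_integral ..
    also have "\<dots> = ennreal (disk_moment a b c n)"
      using disk_moment_nonneg[of n] by (simp add: ennreal_mult[symmetric])
    finally show ?thesis .
  qed
qed (auto simp: disk_moment_nonneg)

lemma disk_norm_bounded_L2: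
  assumes "f \<in> borel_measurable (disk_measure a b c)" "\<And>z. z \<in> ball 0 1 \<Longrightarrow> norm (f z) \<le> B"
  shows "f \<in> L2_space (disk_measure a b c)"
proof (rule L2_spaceI[OF assms(1)], rule Bochner_Integration.integrable_bound)
  show "integrable (disk_measure a b c) (\<lambda>z. B\<^sup>2 * (norm z)^(2 * 0))"
    using disk_monomial_moment[of 0] by (intro integrable_mult_right) (auto simp: has_bochner_integral_iff)
  show "AE z in disk_measure a b c. norm ((norm (f z))\<^sup>2) \<le> norm (B\<^sup>2 * (norm z)^(2 * 0))"
    using assms(2) by (intro AE_I2) (auto intro!: power_mono)
qed (use assms(1) in measurable)

text \<open>For \<rho> < 1 the Taylor series of a function holomorphic in the disk converges
  uniformly on the support; for \<rho> = 1 these are the monomials themselves on the disk.\<close>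

definition cut_monomial :: "real \<Rightarrow> nat \<Rightarrow> complex \<Rightarrow> complex" where
  "cut_monomial \<rho> n z = indicator (ball 0 \<rho>) z * z ^ n"

definition cut_moment :: "real \<Rightarrow> nat \<Rightarrow> real" where
  "cut_moment \<rho> n = (LINT z|disk_measure a b c. indicator (ball 0 \<rho>) z * (norm z)^(2 * n))"

lemma cut_monomial_measurable [measurable]: "cut_monomial \<rho> n \<in> borel_measurable borel"
  unfolding cut_monomial_def by measurable

lemma cut_monomial_L2: "cut_monomial \<rho> n \<in> L2_space (disk_measure a b c)"
proof (rule disk_norm_bounded_L2)
  show "cut_monomial \<rho> n \<in> borel_measurable (disk_measure a b c)" by (intro borel_measurable_disk) measurable
  show "norm (cut_monomial \<rho> n z) \<le> 1" if "z \<in> ball 0 1" for z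
    using that by (auto simp: cut_monomial_def norm_mult norm_power indicator_def power_le_one)
qed

lemma cut_monomial_orthogonal:
  "L2_inner (disk_measure a b c) (cut_monomial \<rho> m) (cut_monomial \<rho> n) = (if m = n then of_real (cut_moment \<rho> n) else 0)"
proof (cases "m = n")
  case True
  have "cut_monomial \<rho> n z * cnj (cut_monomial \<rho> n z) = complex_of_real (indicator (ball 0 \<rho>) z * (norm z)^(2 * n))" for z
    by (simp add: cut_monomial_def indicator_def complex_norm_square[symmetric] norm_power power_mult mult.commute power2_eq_square flip: power_mult_distrib)
  thus ?thesis using True by (simp only: L2_inner_def cut_moment_def integral_complex_of_real if_True simp_thms)
next
  case False
  define \<psi> where "\<psi> = (\<lambda>r::real. indicator {..<1} r * indicator {..<\<rho>} r * disk_density a b c (r\<^sup>2))"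
  have m: "(\<lambda>z. cut_monomial \<rho> m z * cnj (cut_monomial \<rho> n z)) \<in> borel_measurable (disk_measure a b c)"
    by (intro borel_measurable_disk) measurable
  have "L2_inner (disk_measure a b c) (cut_monomial \<rho> m) (cut_monomial \<rho> n) = (LINT z|lborel. z ^ m * cnj (z ^ n) * of_real (\<psi> (norm z)))"
    unfolding L2_inner_def disk_integral(2)[OF m]
    by (intro Bochner_Integration.integral_cong) (auto simp: \<psi>_def cut_monomial_def indicator_def scaleR_conv_of_real)
  also have "\<dots> = 0" unfolding \<psi>_def by (rule integral_radial_monomials[OF _ False]) measurable
  finally show ?thesis using False by simp
qed

lemma cut_moment_1: "cut_moment 1 n = disk_moment a b c n"
proof -
  have "cut_moment 1 n = (LINT z|disk_measure a b c. (norm z)^(2 * n))"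
    unfolding cut_moment_def by (intro Bochner_Integration.integral_cong) auto
  thus ?thesis using disk_monomial_moment[of n] by (simp add: has_bochner_integral_iff)
qed

lemma cut_moment_tendsto: "(\<lambda>j. cut_moment (1 - 1 / (real j + 1)) n) \<longlonglongrightarrow> disk_moment a b c n"
proof -
  have "(\<lambda>j. cut_moment (1 - 1 / (real j + 1)) n) \<longlonglongrightarrow> (LINT z|disk_measure a b c. (norm z)^(2 * n))"
    unfolding cut_moment_def
  proof (rule integral_dominated_convergence[where w="\<lambda>z. (norm z)^(2 * n)"])
    show "(\<lambda>z. (norm z)^(2 * n)) \<in> borel_measurable (disk_measure a b c)" by (intro borel_measurable_disk) measurable
    show "(\<lambda>z. indicator (ball 0 (1 - 1 / (real j + 1))) z * (norm z)^(2 * n)) \<in> borel_measurable (disk_measure a b c)" for j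
      by (intro borel_measurable_disk) measurable
    show "integrable (disk_measure a b c) (\<lambda>z. (norm z)^(2 * n))"
      using disk_monomial_moment[of n] by (simp add: has_bochner_integral_iff)
    show "AE z in disk_measure a b c. (\<lambda>j. indicator (ball 0 (1 - 1 / (real j + 1))) z * (norm z)^(2 * n)) \<longlonglongrightarrow> (norm z)^(2 * n)"
    proof (rule AE_I2, rule tendsto_eventually)
      fix z assume "z \<in> space (disk_measure a b c)"
      hence "norm z < 1" by simp
      moreover have "(\<lambda>j. 1 - 1 / (real j + 1)) \<longlonglongrightarrow> 1" by real_asymp
      ultimately have "\<forall>\<^sub>F j in sequentially. norm z < 1 - 1 / (real j + 1)" by (intro order_tendstoD(1))
      thus "\<forall>\<^sub>F j in sequentially. indicator (ball 0 (1 - 1 / (real j + 1))) z * (norm z)^(2 * n) = (norm z)^(2 * n)"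
        by eventually_elim simp
    qed
  qed (auto simp: indicator_def)
  thus ?thesis using disk_monomial_moment[of n] by (simp add: has_bochner_integral_iff)
qed

lemma
  shows disk_L2_sum: "(\<lambda>z. \<Sum>n\<in>A. \<alpha> n * z ^ n) \<in> L2_space (disk_measure a b c)" (is ?th1)
    and disk_norm_sum: "finite A \<Longrightarrow> (L2_norm (disk_measure a b c) (\<lambda>z. \<Sum>n\<in>A. \<alpha> n * z ^ n))\<^sup>2 = (\<Sum>n\<in>A. (norm (\<alpha> n))\<^sup>2 * disk_moment a b c n)"
proof -
  have mon: "(\<lambda>z. z ^ n) \<in> L2_space (disk_measure a b c)" for n
  proof (rule disk_norm_bounded_L2)
    show "(\<lambda>z. z ^ n) \<in> borel_measurable (disk_measure a b c)" by (intro borel_measurable_disk) measurable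
    show "norm (z ^ n) \<le> 1" if "z \<in> ball 0 1" for z :: complex
      using that by (auto simp: norm_power power_le_one)
  qed
  show ?th1
  proof (cases "finite A")
    case True
    thus ?thesis by (intro L2_space_sum L2_space_scale mon)
  next
    case False
    thus ?thesis using L2_space_scale[OF mon, of 0] by simp
  qed
  assume A: "finite A"
  have "(\<Sum>n\<in>A. \<alpha> n * z ^ n) = (\<Sum>n\<in>A. \<alpha> n * cut_monomial 1 n z)" if "z \<in> ball 0 1" for z
    using that by (simp add: cut_monomial_def)
  hence "L2_norm (disk_measure a b c) (\<lambda>z. \<Sum>n\<in>A. \<alpha> n * z ^ n) = L2_norm (disk_measure a b c) (\<lambda>z. \<Sum>n\<in>A. \<alpha> n * cut_monomial 1 n z)"
    unfolding L2_norm_def by (intro arg_cong[where f=sqrt] Bochner_Integration.integral_cong) auto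
  thus "(L2_norm (disk_measure a b c) (\<lambda>z. \<Sum>n\<in>A. \<alpha> n * z ^ n))\<^sup>2 = (\<Sum>n\<in>A. (norm (\<alpha> n))\<^sup>2 * disk_moment a b c n)"
    using L2_norm_orthogonal_sum[OF cut_monomial_L2[of 1] cut_monomial_orthogonal[of 1] A, where \<alpha>=\<alpha>] by (simp add: cut_moment_1)
qed

text \<open>Differences of partial sums are orthogonal sums, so their squared norms are bounded by
  the tail of the series. Fatou's lemma carries the bound to f minus the N-th partial sum, and the
  tails tend to 0.\<close>

lemma power_series_L2_converges:
  assumes sm: "summable (\<lambda>n. (norm (\<alpha> n))\<^sup>2 * disk_moment a b c n)"
    and f: "\<And>z. z \<in> ball 0 1 \<Longrightarrow> (\<lambda>n. \<alpha> n * z ^ n) sums f z" and fm: "f \<in> borel_measurable (disk_measure a b c)"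
  shows "f \<in> L2_space (disk_measure a b c)"
    and "(\<lambda>N. L2_dist (disk_measure a b c) (poly (coeff_poly \<alpha> N)) f) \<longlonglongrightarrow> 0"
proof -
  let ?D = "disk_measure a b c"
  define u where "u = (\<lambda>n. (norm (\<alpha> n))\<^sup>2 * disk_moment a b c n)"
  have u0: "u n \<ge> 0" for n unfolding u_def using disk_moment_nonneg by simp
  have su: "summable u" using sm by (simp add: u_def)
  define tail where "tail = (\<lambda>N. \<Sum>n. u (n + N))"
  have t0: "tail N \<ge> 0" for N unfolding tail_def using su u0 by (intro suminf_nonneg) (simp_all add: summable_iff_shift)
  have key: "(\<lambda>z. f z - poly (coeff_poly \<alpha> N) z) \<in> L2_space ?D \<and> L2_norm ?D (\<lambda>z. f z - poly (coeff_poly \<alpha> N) z) \<le> sqrt (tail N)" for N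
  proof -
    define F where "F = (\<lambda>M z. poly (coeff_poly \<alpha> M) z - poly (coeff_poly \<alpha> N) z)"
    have FL: "F M \<in> L2_space ?D" for M
      unfolding F_def poly_coeff_poly by (intro L2_space_diff disk_L2_sum)
    have pm: "(\<lambda>z. f z - poly (coeff_poly \<alpha> N) z) \<in> borel_measurable ?D"
      using fm L2_spaceD(1)[OF disk_L2_sum[of \<alpha> "{..<N}"]] unfolding poly_coeff_poly by (rule borel_measurable_diff)
    have lim: "AE z in ?D. (\<lambda>M. F M z) \<longlonglongrightarrow> f z - poly (coeff_poly \<alpha> N) z"
      using f unfolding F_def poly_coeff_poly by (intro AE_I2 tendsto_diff tendsto_const) (simp add: sums_def)
    have bnd: "\<forall>\<^sub>F M in sequentially. L2_norm ?D (F M) \<le> sqrt (tail N)"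
    proof (rule eventually_sequentiallyI[of N])
      fix M assume NM: "N \<le> M"
      have "F M z = (\<Sum>n\<in>{N..<M}. \<alpha> n * z ^ n)" for z
        unfolding F_def poly_coeff_poly lessThan_atLeast0 using sum_diff_nat_ivl[of 0 N M "\<lambda>n. \<alpha> n * z ^ n"] NM by simp
      hence "F M = (\<lambda>z. \<Sum>n\<in>{N..<M}. \<alpha> n * z ^ n)" by (rule ext)
      hence "(L2_norm ?D (F M))\<^sup>2 = (\<Sum>n\<in>{N..<M}. u n)" using disk_norm_sum[of "{N..<M}" \<alpha>] by (simp add: u_def)
      also have "\<dots> = (\<Sum>n<M - N. u (n + N))"
        using NM sum.shift_bounds_nat_ivl[of u 0 N "M - N"] by (simp add: lessThan_atLeast0)
      also have "\<dots> \<le> tail N" unfolding tail_def using su u0 by (intro sum_le_suminf) (auto simp: summable_iff_shift)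
      finally show "L2_norm ?D (F M) \<le> sqrt (tail N)" by (rule real_le_rsqrt)
    qed
    show ?thesis using L2_norm_le_Fatou[OF FL pm lim bnd] t0 by simp
  qed
  show "f \<in> L2_space ?D"
    using conjunct1[OF key[of 0]] by (simp add: coeff_poly_def)
  have "tail \<longlonglongrightarrow> 0" unfolding tail_def by (rule suminf_exist_split2[OF su])
  hence "(\<lambda>N. sqrt (tail N)) \<longlonglongrightarrow> sqrt 0" by (rule tendsto_real_sqrt)
  thus "(\<lambda>N. L2_dist ?D (poly (coeff_poly \<alpha> N)) f) \<longlonglongrightarrow> 0"
  proof -
    assume lim: "(\<lambda>N. sqrt (tail N)) \<longlonglongrightarrow> sqrt 0"
    have "\<forall>\<^sub>F N in sequentially. norm (L2_dist ?D (poly (coeff_poly \<alpha> N)) f) \<le> sqrt (tail N)"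
    proof (rule always_eventually, rule allI)
      fix N
      have "L2_dist ?D (poly (coeff_poly \<alpha> N)) f = L2_norm ?D (\<lambda>z. f z - poly (coeff_poly \<alpha> N) z)"
        by (subst L2_dist_commute) (rule L2_dist_norm)
      thus "norm (L2_dist ?D (poly (coeff_poly \<alpha> N)) f) \<le> sqrt (tail N)" using key[of N] by simp
    qed
    from Lim_null_comparison[OF this] lim show ?thesis by simp
  qed
qed

text \<open>On smaller disks the Taylor series converges uniformly, so that the orthogonality of the monomials applies; then the radius tends to 1.\<close>

lemma Taylor_Bessel:
  assumes hol: "f holomorphic_on ball 0 1" and fL: "f \<in> L2_space (disk_measure a b c)"
  defines "\<alpha> \<equiv> \<lambda>n. (deriv ^^ n) f 0 / fact n"
  shows "summable (\<lambda>n. (norm (\<alpha> n))\<^sup>2 * disk_moment a b c n)"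
    and "\<And>z. z \<in> ball 0 1 \<Longrightarrow> (\<lambda>n. \<alpha> n * z ^ n) sums f z"
proof -
  let ?D = "disk_measure a b c"
  show sums: "(\<lambda>n. \<alpha> n * z ^ n) sums f z" if "z \<in> ball 0 1" for z
    using holomorphic_power_series[OF hol that] by (simp add: \<alpha>_def)
  \<comment> \<open>The squared norms of the partial sums S M increase with M, and their limit is
    the squared norm of f cut off at \<rho>, which is at most that of f.\<close>
  have cut: "(\<Sum>n<N. (norm (\<alpha> n))\<^sup>2 * cut_moment \<rho> n) \<le> (L2_norm ?D f)\<^sup>2" if \<rho>: "0 \<le> \<rho>" "\<rho> < 1" for N \<rho>
  proof -
    define S where "S = (\<lambda>M z. \<Sum>n<M. \<alpha> n * cut_monomial \<rho> n z)"
    have SL: "S M \<in> L2_space ?D" for M unfolding S_def by (intro L2_space_sum L2_space_scale cut_monomial_L2) simp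
    have SN: "(L2_norm ?D (S M))\<^sup>2 = (\<Sum>n<M. (norm (\<alpha> n))\<^sup>2 * cut_moment \<rho> n)" for M
      unfolding S_def by (rule L2_norm_orthogonal_sum[OF cut_monomial_L2 cut_monomial_orthogonal]) simp
    have Seq: "S M z = indicator (ball 0 \<rho>) z * (\<Sum>n<M. \<alpha> n * z ^ n)" for M z
      by (simp add: S_def cut_monomial_def sum_distrib_left mult_ac)
    obtain r where r: "\<rho> < r" "r < 1" using dense[OF \<rho>(2)] by blast
    have "summable (\<lambda>n. norm (\<alpha> n * (of_real \<rho>) ^ n))"
    proof (rule powser_insidea)
      show "summable (\<lambda>n. \<alpha> n * of_real r ^ n)" using sums[of "of_real r"] r \<rho> by (auto simp: sums_iff)
      show "norm (complex_of_real \<rho>) < norm (complex_of_real r)" using r \<rho> by simp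
    qed
    hence sa: "summable (\<lambda>n. norm (\<alpha> n) * \<rho> ^ n)" using \<rho> by (simp add: norm_mult norm_power)
    define B where "B = (\<Sum>n. norm (\<alpha> n) * \<rho> ^ n)"
    have SB: "norm (S M z) \<le> B" for M z
    proof (cases "z \<in> ball 0 \<rho>")
      case True
      have "norm (S M z) \<le> (\<Sum>n<M. norm (\<alpha> n * z ^ n))" using True unfolding Seq by (simp add: norm_sum)
      also have "\<dots> \<le> (\<Sum>n<M. norm (\<alpha> n) * \<rho> ^ n)"
        using True by (intro sum_mono) (auto simp: norm_mult norm_power intro!: mult_left_mono power_mono)
      also have "\<dots> \<le> B" unfolding B_def using sa \<rho> by (intro sum_le_suminf) auto
      finally show ?thesis .
    next
      case False
      have "B \<ge> 0" unfolding B_def using sa \<rho> by (intro suminf_nonneg) auto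
      thus ?thesis using False by (simp add: Seq)
    qed
    have fm: "f \<in> borel_measurable ?D" by (rule holomorphic_measurable_disk[OF hol])
    have im: "(\<lambda>z. indicator (ball 0 \<rho>) z :: complex) \<in> borel_measurable ?D" by (intro borel_measurable_disk) measurable
    have "(\<lambda>M. LINT z|?D. (norm (S M z))\<^sup>2) \<longlonglongrightarrow> (LINT z|?D. (norm (indicator (ball 0 \<rho>) z * f z))\<^sup>2)"
    proof (rule integral_dominated_convergence[where w="\<lambda>z. B\<^sup>2 * (norm z)^(2 * 0)"])
      show "integrable ?D (\<lambda>z. B\<^sup>2 * (norm z)^(2 * 0))"
        using disk_monomial_moment[of 0] by (intro integrable_mult_right) (auto simp: has_bochner_integral_iff)
      show "(\<lambda>z. (norm (indicator (ball 0 \<rho>) z * f z))\<^sup>2) \<in> borel_measurable ?D"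
      proof -
        note [measurable] = fm im
        show ?thesis by measurable
      qed
      show "(\<lambda>z. (norm (S M z))\<^sup>2) \<in> borel_measurable ?D" for M
        using L2_spaceD(2)[OF SL[of M]] by (rule borel_measurable_integrable)
      show "AE z in ?D. (\<lambda>M. (norm (S M z))\<^sup>2) \<longlonglongrightarrow> (norm (indicator (ball 0 \<rho>) z * f z))\<^sup>2"
        using sums unfolding Seq by (intro AE_I2 tendsto_power tendsto_norm tendsto_mult tendsto_const) (auto simp: sums_def)
      show "AE z in ?D. norm ((norm (S M z))\<^sup>2) \<le> B\<^sup>2 * (norm z)^(2 * 0)" for M
        using SB[of M] by (intro AE_I2) (auto intro!: power_mono)
    qed
    hence lim: "(\<lambda>M. (L2_norm ?D (S M))\<^sup>2) \<longlonglongrightarrow> (LINT z|?D. (norm (indicator (ball 0 \<rho>) z * f z))\<^sup>2)"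
      by (simp add: L2_norm_sq)
    have cm0: "cut_moment \<rho> n \<ge> 0" for n unfolding cut_moment_def by (intro integral_nonneg_AE AE_I2) simp
    have "(L2_norm ?D (S N))\<^sup>2 \<le> (LINT z|?D. (norm (indicator (ball 0 \<rho>) z * f z))\<^sup>2)"
    proof (rule LIMSEQ_le_const[OF lim], intro exI allI impI)
      fix M assume "N \<le> M"
      thus "(L2_norm ?D (S N))\<^sup>2 \<le> (L2_norm ?D (S M))\<^sup>2"
        unfolding SN using cm0 by (intro sum_mono2) auto
    qed
    also have "\<dots> \<le> (LINT z|?D. (norm (f z))\<^sup>2)"
    proof (rule integral_mono_AE)
      show i: "integrable ?D (\<lambda>z. (norm (f z))\<^sup>2)" using L2_spaceD(2)[OF fL] .
      show "integrable ?D (\<lambda>z. (norm (indicator (ball 0 \<rho>) z * f z))\<^sup>2)"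
        by (rule Bochner_Integration.integrable_bound[OF i]) (use fm im in \<open>auto simp: indicator_def\<close>)
    qed (auto simp: indicator_def)
    finally have "(L2_norm ?D (S N))\<^sup>2 \<le> (L2_norm ?D f)\<^sup>2" by (simp only: L2_norm_sq)
    thus ?thesis by (simp only: SN)
  qed
  show "summable (\<lambda>n. (norm (\<alpha> n))\<^sup>2 * disk_moment a b c n)"
  proof (rule bounded_imp_summable)
    show "0 \<le> (norm (\<alpha> n))\<^sup>2 * disk_moment a b c n" for n using disk_moment_nonneg by simp
    fix N
    have "(\<lambda>j. \<Sum>n<Suc N. (norm (\<alpha> n))\<^sup>2 * cut_moment (1 - 1 / (real j + 1)) n) \<longlonglongrightarrow> (\<Sum>n<Suc N. (norm (\<alpha> n))\<^sup>2 * disk_moment a b c n)"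
      by (intro tendsto_sum tendsto_mult tendsto_const cut_moment_tendsto)
    hence "(\<Sum>n<Suc N. (norm (\<alpha> n))\<^sup>2 * disk_moment a b c n) \<le> (L2_norm ?D f)\<^sup>2"
      by (rule LIMSEQ_le_const2) (intro exI allI impI cut; simp)
    thus "(\<Sum>n\<le>N. (norm (\<alpha> n))\<^sup>2 * disk_moment a b c n) \<le> (L2_norm ?D f)\<^sup>2"
      by (simp only: lessThan_Suc_atMost)
  qed
qed

text \<open>With g the n-th moment, 2 |\<alpha> z^n| is at most |\<alpha>|^2 g + |z|^(2n) / g. The
  series of |z|^(2n) / g is the reproducing kernel on the diagonal; it converges in the disk because
  the ratio of consecutive moments tends to 1.\<close>

lemma power_series_exists:
  fixes \<alpha> :: "nat \<Rightarrow> complex"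
  assumes sm: "summable (\<lambda>n. (norm (\<alpha> n))\<^sup>2 * disk_moment a b c n)" and z: "z \<in> ball 0 1"
  shows "summable (\<lambda>n. \<alpha> n * z ^ n)"
proof -
  define r where "r = (norm z)\<^sup>2"
  have r: "0 \<le> r" "r < 1" using z by (auto simp: r_def power_less_one_iff)
  define g where "g = (\<lambda>n. disk_moment a b c n)"
  have g: "g n > 0" for n unfolding g_def by (rule disk_moment_pos)
  have ratio: "r ^ Suc n / g (Suc n) = (r * ((a + b + real n) * (a + c + real n) / ((real n + 1) * (b + c + real n)))) * (r ^ n / g n)" for n
  proof -
    have "Gamma (x + real (Suc n)) = (x + real n) * Gamma (x + real n)" if "x > 0" for x
      using Gamma_plus1[of "x + real n"] that pos_notin_nonpos_Ints[of "x + real n"] by (simp add: add_ac)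
    hence G: "Gamma (a + b + real (Suc n)) = (a + b + real n) * Gamma (a + b + real n)"
      "Gamma (a + c + real (Suc n)) = (a + c + real n) * Gamma (a + c + real n)"
      "Gamma (b + c + real (Suc n)) = (b + c + real n) * Gamma (b + c + real n)" using pos by auto
    have P: "Gamma (a + b + real n) > 0" "Gamma (a + c + real n) > 0" "Gamma (b + c + real n) > 0" "b + c + real n > 0" "a + b + real n > 0" "a + c + real n > 0"
      using pos by (auto intro!: Gamma_real_pos)
    have f: "fact (Suc n) = (real n + 1) * fact n" by (simp add: add.commute)
    show ?thesis unfolding g_def disk_moment_def G f using P by (simp add: field_simps)
  qed
  have "(\<lambda>n. r * ((a + b + real n) * (a + c + real n) / ((real n + 1) * (b + c + real n)))) \<longlonglongrightarrow> r * 1"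
    using pos by (intro tendsto_mult tendsto_const) real_asymp
  moreover have "r * 1 < (1 + r) / 2" using r by simp
  ultimately have "\<forall>\<^sub>F n in sequentially. r * ((a + b + real n) * (a + c + real n) / ((real n + 1) * (b + c + real n))) < (1 + r) / 2"
    by (rule order_tendstoD(2))
  then obtain N where N: "\<And>n. n \<ge> N \<Longrightarrow> r * ((a + b + real n) * (a + c + real n) / ((real n + 1) * (b + c + real n))) < (1 + r) / 2"
    unfolding eventually_sequentially by blast
  have sr: "summable (\<lambda>n. r ^ n / g n)"
  proof (rule summable_ratio_test[of "(1 + r) / 2" N])
    fix n assume "N \<le> n"
    have "0 \<le> r ^ n / g n" "0 \<le> r ^ Suc n / g (Suc n)" using r g[of n] g[of "Suc n"] by (auto intro!: divide_nonneg_pos)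
    moreover have "r ^ Suc n / g (Suc n) \<le> (1 + r) / 2 * (r ^ n / g n)"
      unfolding ratio using N[OF \<open>N \<le> n\<close>] calculation(1) by (intro mult_right_mono) auto
    ultimately show "norm (r ^ Suc n / g (Suc n)) \<le> (1 + r) / 2 * norm (r ^ n / g n)"
      by (simp only: real_norm_def abs_of_nonneg)
  qed (use r in simp)
  have dom: "summable (\<lambda>n. ((norm (\<alpha> n))\<^sup>2 * g n + r ^ n / g n) / 2)"
    using sm sr by (intro summable_divide summable_add) (auto simp: g_def)
  show ?thesis
  proof (rule summable_comparison_test'[OF dom, of 0])
    fix n :: nat
    have "0 \<le> (norm (\<alpha> n) * g n - (norm z)^n)\<^sup>2 / g n" using g[of n] by simp
    also have "\<dots> = (norm (\<alpha> n))\<^sup>2 * g n + r ^ n / g n - 2 * norm (\<alpha> n * z ^ n)"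
    proof -
      have "((norm z)^n)\<^sup>2 = r ^ n" by (simp add: r_def power_mult[symmetric] mult.commute)
      moreover have "(A * x - w)\<^sup>2 / x = A\<^sup>2 * x + w\<^sup>2 / x - 2 * (A * w)" if "x > 0" for A w x :: real
        using that by (simp add: field_simps power2_eq_square)
      ultimately show ?thesis using g[of n] by (simp add: norm_mult norm_power)
    qed
    finally show "norm (\<alpha> n * z ^ n) \<le> ((norm (\<alpha> n))\<^sup>2 * g n + r ^ n / g n) / 2" by simp
  qed
qed

text \<open>The hypergeometric factor is at least 1 off the origin, which gives one direction.
  Conversely it is bounded for |z| > 1/2, while on |z| \<le> 1/2, where it may blow up at the
  origin, f is bounded and the density is integrable.\<close>

lemma W_space_iff: "f \<in> W_space a b c \<longleftrightarrow> f holomorphic_on ball 0 1 \<and> f \<in> L2_space (disk_measure a b c)"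
proof (cases "f holomorphic_on ball 0 1")
  case hol: True
  let ?D = "disk_measure a b c"
  let ?K = "pi * Gamma (2 * a - 1)"
  have K: "?K > 0" using Gamma_2a_pos by simp
  have fm: "f \<in> borel_measurable ?D" by (rule holomorphic_measurable_disk[OF hol])
  have fm2: "(\<lambda>z. (norm (f z))\<^sup>2) \<in> borel_measurable ?D" using fm by measurable
  have m1: "(\<lambda>z. indicator (ball 0 1) z *\<^sub>R ((norm (f z))\<^sup>2 * (1 - (norm z)\<^sup>2) powr (2 * a - 2))) \<in> borel_measurable lborel"
  proof -
    have "(\<lambda>z. (indicator (ball 0 1) z *\<^sub>R (norm (f z))\<^sup>2) * (1 - (norm z)\<^sup>2) powr (2 * a - 2)) \<in> borel_measurable borel"
      using fm2[unfolded borel_measurable_disk_iff] by measurable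
    thus ?thesis by (simp add: mult.assoc)
  qed
  have m2: "(\<lambda>z. indicator (ball 0 1) z *\<^sub>R (disk_density a b c ((norm z)\<^sup>2) *\<^sub>R (norm (f z))\<^sup>2)) \<in> borel_measurable lborel"
  proof -
    have "(\<lambda>z. disk_density a b c ((norm z)\<^sup>2) * (indicator (ball 0 1) z *\<^sub>R (norm (f z))\<^sup>2)) \<in> borel_measurable borel"
      using fm2[unfolded borel_measurable_disk_iff] by measurable
    thus ?thesis by (simp add: mult_ac)
  qed
  have nz: "AE z in lborel. z \<noteq> (0::complex)" by (rule AE_lborel_singleton)
  have z2: "0 < (norm z)\<^sup>2" "(norm z)\<^sup>2 < 1" if "z \<noteq> 0" "z \<in> ball 0 1" for z :: complex
    using that by (auto simp: power_less_one_iff)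
  have L2: "f \<in> L2_space ?D \<longleftrightarrow> integrable lborel (\<lambda>z. indicator (ball 0 1) z *\<^sub>R (disk_density a b c ((norm z)\<^sup>2) *\<^sub>R (norm (f z))\<^sup>2))"
    using fm by (simp add: L2_space_def disk_integral(1)[OF fm2])
  have "f \<in> W_space a b c \<longleftrightarrow> f \<in> L2_space ?D"
  proof
    assume "f \<in> L2_space ?D"
    hence "integrable lborel (\<lambda>z. ?K * (indicator (ball 0 1) z *\<^sub>R (disk_density a b c ((norm z)\<^sup>2) *\<^sub>R (norm (f z))\<^sup>2)))"
      unfolding L2 by (rule integrable_mult_right)
    hence "integrable lborel (\<lambda>z. indicator (ball 0 1) z *\<^sub>R ((norm (f z))\<^sup>2 * (1 - (norm z)\<^sup>2) powr (2 * a - 2)))"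
    proof (rule Bochner_Integration.integrable_bound[OF _ m1])
      show "AE z in lborel. norm (indicator (ball 0 1) z *\<^sub>R ((norm (f z))\<^sup>2 * (1 - (norm z)\<^sup>2) powr (2 * a - 2)))
        \<le> norm (?K * (indicator (ball 0 1) z *\<^sub>R (disk_density a b c ((norm z)\<^sup>2) *\<^sub>R (norm (f z))\<^sup>2)))"
        using nz
      proof eventually_elim
        case (elim z)
        show ?case
        proof (cases "z \<in> ball 0 1")
          case True
          have "1 \<le> weight_series a b c (1 - (norm z)\<^sup>2)" using z2[OF elim True] by (intro weight_series_ge_1) auto
          from mult_left_mono[OF this, of "(norm (f z))\<^sup>2 * (1 - (norm z)\<^sup>2) powr (2 * a - 2)"]
          have "(norm (f z))\<^sup>2 * (1 - (norm z)\<^sup>2) powr (2 * a - 2) \<le> ?K * (disk_density a b c ((norm z)\<^sup>2) * (norm (f z))\<^sup>2)"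
            using K by (simp add: disk_density_def mult_ac)
          thus ?thesis using True by (simp add: order.trans[OF _ abs_ge_self])
        qed simp
      qed
    qed
    thus "f \<in> W_space a b c" using hol by (simp add: W_space_def set_integrable_def)
  next
    assume "f \<in> W_space a b c"
    hence iw: "integrable lborel (\<lambda>z. indicator (ball 0 1) z *\<^sub>R ((norm (f z))\<^sup>2 * (1 - (norm z)\<^sup>2) powr (2 * a - 2)))"
      by (simp add: W_space_def set_integrable_def)
    \<comment> \<open>3/4 = 1 - (1/2)^2 is the largest argument of the series for |z| \<ge>
      1/2.\<close>
    define H where "H = weight_series a b c (3/4) / ?K"
    have "weight_series a b c (3/4) \<ge> 1" by (rule weight_series_ge_1) auto
    hence H: "H \<ge> 0" using K by (simp add: H_def)
    have "compact (f ` cball 0 (1/2))"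
      by (intro compact_continuous_image holomorphic_on_imp_continuous_on holomorphic_on_subset[OF hol]) auto
    then obtain B where B: "\<And>z. z \<in> cball 0 (1/2) \<Longrightarrow> norm (f z) \<le> B"
      using compact_imp_bounded[THEN bounded_iff[THEN iffD1]] by (metis imageI)
    have id: "integrable lborel (\<lambda>z. indicator (ball 0 1) z *\<^sub>R (disk_density a b c ((norm (z::complex))\<^sup>2) *\<^sub>R (norm z)^(2 * 0)))"
      using disk_monomial_moment[of 0] disk_integral(1)[of "\<lambda>z. (norm z)^(2 * 0)"] by (simp add: has_bochner_integral_iff)
    show "f \<in> L2_space ?D" unfolding L2
    proof (rule Bochner_Integration.integrable_bound[OF _ m2])
      show "integrable lborel (\<lambda>z. H * (indicator (ball 0 1) z *\<^sub>R ((norm (f z))\<^sup>2 * (1 - (norm z)\<^sup>2) powr (2 * a - 2))) + B\<^sup>2 * (indicator (ball 0 1) z *\<^sub>R (disk_density a b c ((norm z)\<^sup>2) *\<^sub>R (norm z)^(2 * 0))))"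
        by (rule Bochner_Integration.integrable_add[OF integrable_mult_right[OF iw] integrable_mult_right[OF id]])
      show "AE z in lborel. norm (indicator (ball 0 1) z *\<^sub>R (disk_density a b c ((norm z)\<^sup>2) *\<^sub>R (norm (f z))\<^sup>2))
         \<le> norm (H * (indicator (ball 0 1) z *\<^sub>R ((norm (f z))\<^sup>2 * (1 - (norm z)\<^sup>2) powr (2 * a - 2))) + B\<^sup>2 * (indicator (ball 0 1) z *\<^sub>R (disk_density a b c ((norm z)\<^sup>2) *\<^sub>R (norm z)^(2 * 0))))"
        using nz
      proof eventually_elim
        case (elim z)
        show ?case
        proof (cases "z \<in> ball 0 1")
          case True
          let ?d = "disk_density a b c ((norm z)\<^sup>2)"
          have d0: "?d \<ge> 0" using z2[OF elim True] by (intro disk_density_nonneg) auto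
          have P: "0 \<le> H * ((norm (f z))\<^sup>2 * (1 - (norm z)\<^sup>2) powr (2 * a - 2))" "0 \<le> B\<^sup>2 * ?d" using H d0 by auto
          have "?d * (norm (f z))\<^sup>2 \<le> H * ((norm (f z))\<^sup>2 * (1 - (norm z)\<^sup>2) powr (2 * a - 2)) + B\<^sup>2 * ?d"
          proof (cases "norm z \<le> 1/2")
            case True
            hence "(norm (f z))\<^sup>2 \<le> B\<^sup>2" by (intro power_mono B) auto
            from mult_left_mono[OF this d0] P(1) show ?thesis by (simp add: mult.commute)
          next
            case False
            have "(1/2)\<^sup>2 \<le> (norm z)\<^sup>2" using False by (intro power_mono) auto
            hence "weight_series a b c (1 - (norm z)\<^sup>2) \<le> weight_series a b c (3/4)"
              using z2[OF elim \<open>z \<in> ball 0 1\<close>] by (intro weight_series_mono) (auto simp: power2_eq_square)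
            hence "weight_series a b c (1 - (norm z)\<^sup>2) / ?K \<le> H" unfolding H_def using K by (intro divide_right_mono) auto
            from mult_right_mono[OF this, of "(norm (f z))\<^sup>2 * (1 - (norm z)\<^sup>2) powr (2 * a - 2)"] P(2)
            show ?thesis by (simp add: disk_density_def mult_ac)
          qed
          thus ?thesis using True d0 P by simp
        qed simp
      qed
    qed
  qed
  thus ?thesis using hol by simp
qed (simp add: W_space_def)

lemma W_inner_eq:
  assumes f: "f \<in> borel_measurable (disk_measure a b c)" and g: "g \<in> borel_measurable (disk_measure a b c)"
  shows "W_inner a b c f g = L2_inner (disk_measure a b c) f g"
proof -
  let ?K = "pi * Gamma (2 * a - 1)"
  have K: "?K > 0" using Gamma_2a_pos by simp
  have fg: "(\<lambda>z. f z * cnj (g z)) \<in> borel_measurable (disk_measure a b c)" using f g by measurable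
  define G where "G = (\<lambda>z. indicator (ball 0 1) z *\<^sub>R (disk_density a b c ((norm z)\<^sup>2) *\<^sub>R (f z * cnj (g z))))"
  have Gm: "G \<in> borel_measurable borel"
  proof -
    have "(\<lambda>z. disk_density a b c ((norm z)\<^sup>2) *\<^sub>R (indicator (ball 0 1) z *\<^sub>R (f z * cnj (g z)))) \<in> borel_measurable borel"
      using fg[unfolded borel_measurable_disk_iff] by measurable
    thus ?thesis by (simp add: G_def mult_ac)
  qed
  define h where "h = (\<lambda>z::complex. hyp2F1 (of_real (a - b)) (of_real (a - c)) (of_real (2 * a - 1)) (of_real (1 - (norm z)\<^sup>2)))"
  \<comment> \<open>At the origin \<open>hyp2F1\<close> is evaluated at 1, on the cut, where its
    default value is 0; \<open>disk_density\<close> may differ there, so the case z = 0 is split off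
    and removed as a null set.\<close>
  have eq: "indicator (ball 0 1) z *\<^sub>R (f z * cnj (g z) * of_real ((1 - (norm z)\<^sup>2) powr (2 * a - 2)) * h z) = (if z = 0 then 0 else of_real ?K * G z)" for z
  proof (cases "z = 0 \<or> z \<notin> ball 0 1")
    case True
    have "h 0 = 0" by (simp add: h_def hyp2F1_def slit_plane_def)
    thus ?thesis using True by (auto simp: G_def)
  next
    case False
    hence "0 < 1 - (norm z)\<^sup>2" "1 - (norm z)\<^sup>2 < 1" by (auto simp: power_less_one_iff)
    hence "h z = of_real (weight_series a b c (1 - (norm z)\<^sup>2))" unfolding h_def by (rule hyp2F1_weight)
    thus ?thesis using False Gamma_2a_pos by (simp add: G_def disk_density_def scaleR_conv_of_real)
  qed
  have "(LINT z|lborel. (if z = 0 then 0 else of_real ?K * G z)) = (LINT z|lborel. of_real ?K * G z)"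
  proof (rule integral_cong_AE)
    show "AE z in lborel. (if z = 0 then 0 else of_real ?K * G z) = of_real ?K * G z"
      using AE_lborel_singleton[of "0::complex"] by eventually_elim simp
  qed (use Gm in measurable)
  also have "\<dots> = of_real ?K * (LINT z|lborel. G z)" by simp
  finally have "W_inner a b c f g = 1 / of_real ?K * (of_real ?K * (LINT z|lborel. G z))"
    using eq by (simp only: W_inner_def set_lebesgue_integral_def h_def)
  also have "\<dots> = (LINT z|lborel. G z)" using K by simp
  also have "\<dots> = L2_inner (disk_measure a b c) f g" unfolding L2_inner_def disk_integral(2)[OF fg] G_def ..
  finally show ?thesis .
qed

lemma W_dist_eq:
  assumes "f \<in> borel_measurable (disk_measure a b c)" "g \<in> borel_measurable (disk_measure a b c)"
  shows "W_dist a b c f g = L2_dist (disk_measure a b c) f g"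
proof -
  have "(\<lambda>z. f z - g z) \<in> borel_measurable (disk_measure a b c)" using assms by measurable
  thus ?thesis by (simp add: W_dist_def L2_dist_def W_inner_eq)
qed

lemma poly_in_W: "poly p \<in> W_space a b c"
  unfolding W_space_iff using disk_L2_sum[of "coeff p" "{..<Suc (degree p)}"]
  by (auto simp: poly_as_sum[OF lessI, abs_def] intro!: holomorphic_intros)

end

section \<open>Extension by continuity\<close>

lemma tendsto_zero_squeeze:
  fixes X Y :: "nat \<Rightarrow> real"
  assumes "\<And>n. 0 \<le> X n" "\<And>n. X n \<le> Y n" "Y \<longlonglongrightarrow> 0"
  shows "X \<longlonglongrightarrow> 0"
  by (rule tendsto_sandwich[OF _ _ tendsto_const assms(3)]) (use assms(1,2) in auto)

lemma L2_dist_lincomb: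
  assumes "f \<in> L2_space M" "f' \<in> L2_space M" "g \<in> L2_space M" "g' \<in> L2_space M"
  shows "L2_dist M (\<lambda>x. \<alpha> * f x + \<beta> * g x) (\<lambda>x. \<alpha> * f' x + \<beta> * g' x) \<le> norm \<alpha> * L2_dist M f f' + norm \<beta> * L2_dist M g g'"
proof -
  have scale: "L2_norm M (\<lambda>x. \<gamma> * h x) = norm \<gamma> * L2_norm M h" for \<gamma> h
    by (simp add: L2_norm_def norm_mult power_mult_distrib real_sqrt_mult)
  have "L2_dist M (\<lambda>x. \<alpha> * f x + \<beta> * g x) (\<lambda>x. \<alpha> * f' x + \<beta> * g' x) = L2_norm M (\<lambda>x. \<alpha> * (f x - f' x) + \<beta> * (g x - g' x))"
    by (simp add: L2_dist_norm algebra_simps)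
  also have "\<dots> \<le> L2_norm M (\<lambda>x. \<alpha> * (f x - f' x)) + L2_norm M (\<lambda>x. \<beta> * (g x - g' x))"
    by (intro L2_norm_triangle L2_space_scale L2_space_diff assms)
  finally show ?thesis by (simp add: scale L2_dist_norm)
qed

lemma L2_inner_diff_right:
  assumes "f \<in> L2_space M" "g \<in> L2_space M" "h \<in> L2_space M"
  shows "L2_inner M h (\<lambda>x. f x - g x) = L2_inner M h f - L2_inner M h g"
  unfolding L2_inner_def complex_cnj_diff right_diff_distrib
  using assms by (intro Bochner_Integration.integral_diff integrable_L2_mult)

lemma L2_inner_tendsto:
  assumes "\<And>n. f n \<in> L2_space M" "\<And>n. g n \<in> L2_space M" "F \<in> L2_space M" "G \<in> L2_space M"
    and lim: "(\<lambda>n. L2_dist M (f n) F) \<longlonglongrightarrow> 0" "(\<lambda>n. L2_dist M (g n) G) \<longlonglongrightarrow> 0"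
  shows "(\<lambda>n. L2_inner M (f n) (g n)) \<longlonglongrightarrow> L2_inner M F G"
proof -
  have bnd: "norm (L2_inner M (f n) (g n) - L2_inner M F G) \<le> L2_dist M (f n) F * (L2_dist M (g n) G + L2_norm M G) + L2_norm M F * L2_dist M (g n) G" for n
  proof -
    have "L2_inner M (f n) (g n) - L2_inner M F G = L2_inner M (\<lambda>x. f n x - F x) (g n) + L2_inner M F (\<lambda>x. g n x - G x)"
      using assms by (simp add: L2_inner_diff_left L2_inner_diff_right)
    also have "norm \<dots> \<le> norm (L2_inner M (\<lambda>x. f n x - F x) (g n)) + norm (L2_inner M F (\<lambda>x. g n x - G x))"
      by (rule norm_triangle_ineq)
    also have "\<dots> \<le> L2_dist M (f n) F * L2_norm M (g n) + L2_norm M F * L2_dist M (g n) G"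
      unfolding L2_dist_norm by (intro add_mono L2_Cauchy_Schwarz L2_space_diff assms)
    also have "L2_norm M (g n) \<le> L2_dist M (g n) G + L2_norm M G"
      using L2_norm_triangle[OF L2_space_diff[OF assms(2)[of n] assms(4)] assms(4)] by (simp add: L2_dist_norm)
    finally show ?thesis by (simp add: mult_left_mono)
  qed
  have "(\<lambda>n. L2_dist M (f n) F * (L2_dist M (g n) G + L2_norm M G) + L2_norm M F * L2_dist M (g n) G) \<longlonglongrightarrow> 0 * (0 + L2_norm M G) + L2_norm M F * 0"
    by (intro tendsto_intros lim)
  hence "(\<lambda>n. L2_inner M (f n) (g n) - L2_inner M F G) \<longlonglongrightarrow> 0"
    by (intro Lim_null_comparison[OF always_eventually[OF allI[OF bnd]]]) simp
  thus ?thesis by (simp add: LIM_zero_iff)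
qed

lemma L2_limit_unique:
  assumes "\<And>n. f n \<in> L2_space M" "F \<in> L2_space M" "G \<in> L2_space M"
    and "(\<lambda>n. L2_dist M (f n) F) \<longlonglongrightarrow> 0" "(\<lambda>n. L2_dist M (f n) G) \<longlonglongrightarrow> 0"
  shows "AE x in M. F x = G x"
proof (rule L2_dist_eq_0_AE[OF assms(2,3)])
  have "(\<lambda>n. L2_dist M (f n) F + L2_dist M (f n) G) \<longlonglongrightarrow> 0 + 0" by (intro tendsto_add assms)
  moreover have "L2_dist M F G \<le> L2_dist M (f n) F + L2_dist M (f n) G" for n
    using L2_dist_triangle[OF assms(2) assms(1)[of n] assms(3)] by (simp add: L2_dist_commute)
  ultimately have "L2_dist M F G \<le> 0" by (intro LIMSEQ_le_const[where X="\<lambda>n. L2_dist M (f n) F + L2_dist M (f n) G"]) auto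
  thus "L2_dist M F G = 0" using L2_dist_nonneg[of M F G] by linarith
qed

section \<open>The isometry on polynomials and its extension to the disk space\<close>

context disk_parameters
begin

abbreviation "D \<equiv> disk_measure a b c"
abbreviation "S \<equiv> spectral_measure a b c"
abbreviation "J \<equiv> \<lambda>p. J_integral a b c (poly p)"

lemma J_poly_sum:
  assumes "degree p < N"
  shows "J p s = (\<Sum>n<N. coeff p n * of_real (dual_hahn a b c n s))"
  unfolding J_integral_poly[OF pos] using assms by (intro sum.mono_neutral_left) (auto simp: coeff_eq_0)

lemma J_lincomb: "J (smult \<alpha> p + smult \<beta> q) s = \<alpha> * J p s + \<beta> * J q s"
proof -
  define N where "N = Suc (max (degree p) (degree q))"
  have d: "degree p < N" "degree q < N" "degree (smult \<alpha> p + smult \<beta> q) < N"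
    using degree_add_le_max[of "smult \<alpha> p" "smult \<beta> q"] degree_smult_le[of \<alpha> p] degree_smult_le[of \<beta> q] by (auto simp: N_def)
  show ?thesis unfolding d[THEN J_poly_sum] by (simp add: distrib_right sum.distrib sum_distrib_left mult.assoc)
qed

lemma J_L2: "J p \<in> L2_space S"
proof -
  have "J p = (\<lambda>s. \<Sum>n<Suc (degree p). coeff p n * of_real (dual_hahn a b c n s))"
    by (rule ext) (rule J_poly_sum, simp)
  thus ?thesis by (simp only:) (intro L2_space_sum L2_space_scale dual_hahn_L2[OF pos]; simp)
qed

lemma poly_L2: "poly p \<in> L2_space D"
  using poly_in_W[of p] W_space_iff by blast

text \<open>Both squared norms are the sum of |coeff p n|^2 times \<open>disk_moment\<close>: the
  powers z^n and their images are orthogonal families with the same norms.\<close>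

lemma J_isometry: "L2_norm S (J p) = L2_norm D (poly p)"
proof -
  define N where "N = Suc (degree p)"
  have d: "degree p < N" by (simp add: N_def)
  have "J p = (\<lambda>s. \<Sum>n<N. coeff p n * of_real (dual_hahn a b c n s))" using J_poly_sum[OF d] by blast
  hence "(L2_norm S (J p))\<^sup>2 = (\<Sum>n<N. (norm (coeff p n))\<^sup>2 * disk_moment a b c n)"
    using L2_norm_orthogonal_sum[where e="\<lambda>n s. complex_of_real (dual_hahn a b c n s)" and g="disk_moment a b c" and A="{..<N}" and \<alpha>="coeff p",
        OF dual_hahn_L2[OF pos] dual_hahn_orthogonal[OF pos]] by simp
  also have "\<dots> = (L2_norm D (poly p))\<^sup>2"
  proof -
    have "poly p = (\<lambda>z. \<Sum>n<N. coeff p n * z ^ n)" by (rule ext) (rule poly_as_sum[OF d])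
    thus ?thesis using disk_norm_sum[of "{..<N}" "coeff p"] by simp
  qed
  finally show ?thesis by (simp add: power2_eq_iff_nonneg)
qed

lemma J_dist: "L2_dist S (J p) (J q) = L2_dist D (poly p) (poly q)"
proof -
  have "(\<lambda>s. J p s - J q s) = J (smult 1 p + smult (-1) q)" by (rule ext) (simp only: J_lincomb, simp)
  moreover have "(\<lambda>z. poly p z - poly q z) = poly (smult 1 p + smult (-1) q)" by (rule ext) simp
  ultimately show ?thesis unfolding L2_dist_norm by (simp only: J_isometry)
qed

lemma W_L2: "f \<in> W_space a b c \<Longrightarrow> f \<in> L2_space D"
  by (simp add: W_space_iff)

lemma W_dist_poly: "f \<in> W_space a b c \<Longrightarrow> W_dist a b c (poly p) f = L2_dist D (poly p) f"
  by (intro W_dist_eq L2_spaceD(1) W_L2 poly_in_W)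

lemma W_approx:
  assumes "f \<in> W_space a b c"
  obtains p where "(\<lambda>n. L2_dist D (poly (p n)) f) \<longlonglongrightarrow> 0"
proof -
  have hol: "f holomorphic_on ball 0 1" and fL: "f \<in> L2_space D" using assms by (auto simp: W_space_iff)
  show ?thesis
    by (rule that, rule power_series_L2_converges(2)[OF Taylor_Bessel(1)[OF hol fL] Taylor_Bessel(2)[OF hol fL]])
       (auto intro: holomorphic_measurable_disk[OF hol])
qed

text \<open>Polynomials that approximate f form a Cauchy sequence, the isometry transfers this to
  their transforms, and completeness supplies the limit h. A triangle inequality through the one
  sequence p shows that the transforms along any other sequence q tend to the same h.\<close>

lemma J_op_exists:
  assumes f: "f \<in> W_space a b c"
  shows "\<exists>h. h \<in> L2_space S \<and> (\<forall>p :: nat \<Rightarrow> complex poly. (\<lambda>n. W_dist a b c (poly (p n)) f) \<longlonglongrightarrow> 0 \<longrightarrow>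
           (\<lambda>n. L2_dist S (J (p n)) h) \<longlonglongrightarrow> 0)"
proof -
  obtain p where p: "(\<lambda>n. L2_dist D (poly (p n)) f) \<longlonglongrightarrow> 0" using W_approx[OF f] by blast
  have fL: "f \<in> L2_space D" by (rule W_L2[OF f])
  have "\<exists>N. \<forall>m\<ge>N. \<forall>n\<ge>N. L2_dist S (J (p m)) (J (p n)) < e" if "e > 0" for e
  proof -
    have "\<forall>\<^sub>F n in sequentially. L2_dist D (poly (p n)) f < e / 2" using p that by (intro order_tendstoD(2)) auto
    then obtain N where N: "\<And>n. n \<ge> N \<Longrightarrow> L2_dist D (poly (p n)) f < e / 2" by (auto simp: eventually_sequentially)
    have "L2_dist S (J (p m)) (J (p n)) < e" if "m \<ge> N" "n \<ge> N" for m n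
    proof -
      have "L2_dist D (poly (p m)) (poly (p n)) \<le> L2_dist D (poly (p m)) f + L2_dist D f (poly (p n))"
        by (rule L2_dist_triangle[OF poly_L2 fL poly_L2])
      also have "\<dots> < e / 2 + e / 2" using N[OF that(1)] N[OF that(2)] L2_dist_commute[of D f "poly (p n)"] by linarith
      finally show ?thesis by (simp add: J_dist)
    qed
    thus ?thesis by blast
  qed
  then obtain h where h: "h \<in> L2_space S" "(\<lambda>n. L2_dist S (J (p n)) h) \<longlonglongrightarrow> 0"
    using L2_complete[of "\<lambda>n. J (p n)" S] J_L2 by blast
  have "(\<lambda>n. L2_dist S (J (q n)) h) \<longlonglongrightarrow> 0" if q: "(\<lambda>n. W_dist a b c (poly (q n)) f) \<longlonglongrightarrow> 0" for q
  proof -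
    have q': "(\<lambda>n. L2_dist D (poly (q n)) f) \<longlonglongrightarrow> 0" using q by (simp add: W_dist_poly[OF f])
    have "L2_dist S (J (q n)) h \<le> (L2_dist D (poly (q n)) f + L2_dist D (poly (p n)) f) + L2_dist S (J (p n)) h" for n
    proof -
      have "L2_dist S (J (q n)) h \<le> L2_dist S (J (q n)) (J (p n)) + L2_dist S (J (p n)) h"
        by (intro L2_dist_triangle J_L2 h)
      moreover have "L2_dist D (poly (q n)) (poly (p n)) \<le> L2_dist D (poly (q n)) f + L2_dist D f (poly (p n))"
        by (intro L2_dist_triangle poly_L2 fL)
      ultimately show ?thesis using L2_dist_commute[of D f "poly (p n)"] by (simp add: J_dist)
    qed
    moreover have "(\<lambda>n. (L2_dist D (poly (q n)) f + L2_dist D (poly (p n)) f) + L2_dist S (J (p n)) h) \<longlonglongrightarrow> 0 + 0 + 0"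
      by (intro tendsto_add q' p h)
    ultimately show ?thesis by (intro tendsto_zero_squeeze[OF L2_dist_nonneg]) simp_all
  qed
  thus ?thesis using h(1) by blast
qed

text \<open>The existence lemma gives the choice in \<open>J_op\<close> its meaning; from here on
  the operator is accessed through these two properties.\<close>

lemma
  assumes f: "f \<in> W_space a b c"
  shows J_op_L2: "J_op a b c f \<in> L2_space S"
    and J_op_lim: "\<And>p. (\<lambda>n. L2_dist D (poly (p n)) f) \<longlonglongrightarrow> 0 \<Longrightarrow> (\<lambda>n. L2_dist S (J (p n)) (J_op a b c f)) \<longlonglongrightarrow> 0"
proof -
  have *: "J_op a b c f \<in> L2_space S \<and> (\<forall>p :: nat \<Rightarrow> complex poly. (\<lambda>n. W_dist a b c (poly (p n)) f) \<longlonglongrightarrow> 0 \<longrightarrow>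
           (\<lambda>n. L2_dist S (J (p n)) (J_op a b c f)) \<longlonglongrightarrow> 0)"
    unfolding J_op_def by (rule someI_ex[OF J_op_exists[OF f]])
  show "J_op a b c f \<in> L2_space S" using conjunct1[OF *] .
  fix p :: "nat \<Rightarrow> complex poly" assume "(\<lambda>n. L2_dist D (poly (p n)) f) \<longlonglongrightarrow> 0"
  hence "(\<lambda>n. W_dist a b c (poly (p n)) f) \<longlonglongrightarrow> 0" by (simp only: W_dist_poly[OF f])
  with spec[OF conjunct2[OF *], of p] show "(\<lambda>n. L2_dist S (J (p n)) (J_op a b c f)) \<longlonglongrightarrow> 0" by (rule mp)
qed

lemma J_op_poly: "AE s in S. J_op a b c (poly p) s = J p s"
proof (rule L2_limit_unique[where f="\<lambda>_. J p"])
  have "L2_dist D (poly p) (poly p) = 0" by (simp add: L2_dist_norm L2_norm_def)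
  thus "(\<lambda>n. L2_dist S (J p) (J_op a b c (poly p))) \<longlonglongrightarrow> 0"
    using J_op_lim[OF poly_in_W, of "\<lambda>_. p" p] by simp
  show "(\<lambda>n. L2_dist S (J p) (J p)) \<longlonglongrightarrow> 0" by (simp add: L2_dist_norm L2_norm_def)
qed (use J_L2 J_op_L2[OF poly_in_W] in auto)

lemma W_lincomb:
  assumes "f \<in> W_space a b c" "g \<in> W_space a b c"
  shows "(\<lambda>z. \<alpha> * f z + \<beta> * g z) \<in> W_space a b c"
  using assms unfolding W_space_iff by (auto intro!: holomorphic_intros L2_space_add L2_space_scale)

text \<open>Combinations of approximating sequences approximate the combination, on both sides; L2
  limits are unique up to null sets, whence equality almost everywhere.\<close>

lemma J_op_lincomb:
  assumes f: "f \<in> W_space a b c" and g: "g \<in> W_space a b c"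
  shows "AE s in S. J_op a b c (\<lambda>z. \<alpha> * f z + \<beta> * g z) s = \<alpha> * J_op a b c f s + \<beta> * J_op a b c g s"
proof -
  obtain p where p: "(\<lambda>n. L2_dist D (poly (p n)) f) \<longlonglongrightarrow> 0" using W_approx[OF f] by blast
  obtain q where q: "(\<lambda>n. L2_dist D (poly (q n)) g) \<longlonglongrightarrow> 0" using W_approx[OF g] by blast
  define r where "r = (\<lambda>n. smult \<alpha> (p n) + smult \<beta> (q n))"
  have poly_r: "poly (r n) = (\<lambda>z. \<alpha> * poly (p n) z + \<beta> * poly (q n) z)" for n
    by (simp add: r_def fun_eq_iff)
  have squeeze: "X \<longlonglongrightarrow> 0" if "\<And>n. 0 \<le> X n" "\<And>n. X n \<le> norm \<alpha> * Y n + norm \<beta> * Z n" "Y \<longlonglongrightarrow> 0" "Z \<longlonglongrightarrow> 0" for X Y Z :: "nat \<Rightarrow> real"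
  proof (rule tendsto_zero_squeeze[OF that(1,2)])
    show "(\<lambda>n. norm \<alpha> * Y n + norm \<beta> * Z n) \<longlonglongrightarrow> 0"
      using tendsto_add[OF tendsto_mult_right_zero[OF that(3)] tendsto_mult_right_zero[OF that(4)]] by simp
  qed
  have "(\<lambda>n. L2_dist D (poly (r n)) (\<lambda>z. \<alpha> * f z + \<beta> * g z)) \<longlonglongrightarrow> 0"
  proof (rule squeeze[OF _ _ p q])
    show "L2_dist D (poly (r n)) (\<lambda>z. \<alpha> * f z + \<beta> * g z) \<le> norm \<alpha> * L2_dist D (poly (p n)) f + norm \<beta> * L2_dist D (poly (q n)) g" for n
      using L2_dist_lincomb[OF poly_L2[of "p n"] W_L2[OF f] poly_L2[of "q n"] W_L2[OF g], of \<alpha> \<beta>]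
      by (simp only: poly_r)
  qed simp
  hence 1: "(\<lambda>n. L2_dist S (J (r n)) (J_op a b c (\<lambda>z. \<alpha> * f z + \<beta> * g z))) \<longlonglongrightarrow> 0"
    by (rule J_op_lim[OF W_lincomb[OF f g]])
  have 2: "(\<lambda>n. L2_dist S (J (r n)) (\<lambda>s. \<alpha> * J_op a b c f s + \<beta> * J_op a b c g s)) \<longlonglongrightarrow> 0"
  proof (rule squeeze[OF _ _ J_op_lim[OF f p] J_op_lim[OF g q]])
    have "J (r n) = (\<lambda>s. \<alpha> * J (p n) s + \<beta> * J (q n) s)" for n unfolding r_def by (rule ext) (rule J_lincomb)
    thus "L2_dist S (J (r n)) (\<lambda>s. \<alpha> * J_op a b c f s + \<beta> * J_op a b c g s) \<le> norm \<alpha> * L2_dist S (J (p n)) (J_op a b c f) + norm \<beta> * L2_dist S (J (q n)) (J_op a b c g)" for n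
      using L2_dist_lincomb[OF J_L2[of "p n"] J_op_L2[OF f] J_L2[of "q n"] J_op_L2[OF g], of \<alpha> \<beta>] by simp
  qed simp
  show ?thesis
    by (rule L2_limit_unique[OF J_L2 _ _ 1 2]) (intro J_op_L2 W_lincomb f g L2_space_add L2_space_scale)+
qed

lemma J_inner: "L2_inner S (J p) (J q) = L2_inner D (poly p) (poly q)"
proof -
  define N where "N = Suc (max (degree p) (degree q))"
  have d: "degree p < N" "degree q < N" by (auto simp: N_def)
  have 1: "J p = (\<lambda>s. \<Sum>n<N. coeff p n * of_real (dual_hahn a b c n s))" "J q = (\<lambda>s. \<Sum>n<N. coeff q n * of_real (dual_hahn a b c n s))"
    using J_poly_sum[OF d(1)] J_poly_sum[OF d(2)] by blast+
  have "L2_inner S (J p) (J q) = (\<Sum>n<N. coeff p n * cnj (coeff q n) * of_real (disk_moment a b c n))"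
    unfolding 1 by (rule L2_inner_orthogonal_sum[where e="\<lambda>n s. complex_of_real (dual_hahn a b c n s)", OF dual_hahn_L2[OF pos] dual_hahn_orthogonal[OF pos]]) simp
  \<comment> \<open>On the disk the monomials agree with those cut off at radius 1, whose
    orthogonality is already established.\<close>
  also have "\<dots> = L2_inner D (\<lambda>z. \<Sum>n<N. coeff p n * cut_monomial 1 n z) (\<lambda>z. \<Sum>n<N. coeff q n * cut_monomial 1 n z)"
    by (subst L2_inner_orthogonal_sum[OF cut_monomial_L2[of 1] cut_monomial_orthogonal[of 1]]) (simp_all add: cut_moment_1)
  also have "\<dots> = L2_inner D (poly p) (poly q)"
    unfolding L2_inner_def by (intro Bochner_Integration.integral_cong refl) (simp add: poly_as_sum[OF d(1)] poly_as_sum[OF d(2)] cut_monomial_def)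
  finally show ?thesis .
qed

lemma J_op_inner:
  assumes f: "f \<in> W_space a b c" and g: "g \<in> W_space a b c"
  shows "L2_inner S (J_op a b c f) (J_op a b c g) = W_inner a b c f g"
proof -
  obtain p where p: "(\<lambda>n. L2_dist D (poly (p n)) f) \<longlonglongrightarrow> 0" using W_approx[OF f] by blast
  obtain q where q: "(\<lambda>n. L2_dist D (poly (q n)) g) \<longlonglongrightarrow> 0" using W_approx[OF g] by blast
  have "(\<lambda>n. L2_inner S (J (p n)) (J (q n))) \<longlonglongrightarrow> L2_inner S (J_op a b c f) (J_op a b c g)"
    by (intro L2_inner_tendsto J_L2 J_op_L2 f g J_op_lim[OF f p] J_op_lim[OF g q])
  moreover have "(\<lambda>n. L2_inner D (poly (p n)) (poly (q n))) \<longlonglongrightarrow> L2_inner D f g"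
    by (intro L2_inner_tendsto poly_L2 W_L2 f g p q)
  ultimately have "L2_inner S (J_op a b c f) (J_op a b c g) = L2_inner D f g"
    unfolding J_inner by (rule LIMSEQ_unique)
  thus ?thesis using W_inner_eq[OF L2_spaceD(1)[OF W_L2[OF f]] L2_spaceD(1)[OF W_L2[OF g]]] by simp
qed

text \<open>By Bessel's inequality the Fourier coefficients \<alpha> of h with respect to the dual
  Hahn polynomials are square summable with weights \<open>disk_moment\<close>, so they are the
  Taylor coefficients of some f in the disk space. The transform of f has the same Fourier
  coefficients as h, and completeness of the polynomials identifies the two.\<close>

lemma J_op_surj:
  assumes h: "h \<in> L2_space S"
  shows "\<exists>f\<in>W_space a b c. AE s in S. J_op a b c f s = h s"
proof -
  define e where "e = (\<lambda>n s. complex_of_real (dual_hahn a b c n s))"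
  have eL: "e n \<in> L2_space S" for n unfolding e_def by (rule dual_hahn_L2[OF pos])
  have orth: "L2_inner S (e m) (e n) = (if m = n then of_real (disk_moment a b c n) else 0)" for m n
    using dual_hahn_orthogonal[OF pos, of m n] by (simp add: e_def)
  have gp: "disk_moment a b c n > 0" for n by (rule disk_moment_pos)
  \<comment> \<open>The e n are orthogonal but not normalised, hence the division by the squared
    norm.\<close>
  define \<alpha> where "\<alpha> = (\<lambda>n. L2_inner S h (e n) / of_real (disk_moment a b c n))"
  have he: "L2_inner S h (e n) = \<alpha> n * of_real (disk_moment a b c n)" for n
    using gp[of n] by (simp add: \<alpha>_def)
  have inner_sum: "L2_inner S (\<lambda>s. \<Sum>n<N. \<alpha> n * e n s) (e k) = (if k < N then \<alpha> k * of_real (disk_moment a b c k) else 0)" for N k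
  proof -
    have "L2_inner S (\<lambda>s. \<Sum>n<N. \<alpha> n * e n s) (e k) = (\<Sum>n<N. L2_inner S (\<lambda>s. \<alpha> n * e n s) (e k))"
      by (intro L2_inner_sum_left L2_space_scale eL) simp
    also have "\<dots> = (\<Sum>n<N. if n = k then \<alpha> k * of_real (disk_moment a b c k) else 0)"
      by (intro sum.cong refl) (simp add: L2_inner_scale_left orth)
    finally show ?thesis by (simp add: sum.delta)
  qed
  have bessel: "(\<Sum>n<N. (norm (\<alpha> n))\<^sup>2 * disk_moment a b c n) \<le> (L2_norm S h)\<^sup>2" for N
  proof -
    define T where "T = (\<lambda>s. \<Sum>n<N. \<alpha> n * e n s)"
    define B where "B = (\<Sum>n<N. (norm (\<alpha> n))\<^sup>2 * disk_moment a b c n)"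
    have TL: "T \<in> L2_space S" unfolding T_def by (intro L2_space_sum L2_space_scale eL) simp
    have TT: "(L2_norm S T)\<^sup>2 = B" unfolding T_def B_def by (rule L2_norm_orthogonal_sum[OF eL orth]) simp
    have "L2_inner S h T = (\<Sum>n<N. L2_inner S h (\<lambda>s. \<alpha> n * e n s))"
      unfolding T_def by (intro L2_inner_sum_right L2_space_scale eL h) simp
    also have "\<dots> = of_real B"
      unfolding B_def of_real_sum
      by (intro sum.cong refl) (simp add: L2_inner_scale_right he complex_norm_square mult_ac flip: of_real_power)
    finally have hT: "L2_inner S h T = of_real B" .
    \<comment> \<open>The inner product of h with T and the squared norm of T are both B, so
      Cauchy-Schwarz bounds B by the squared norm of h.\<close>
    have "norm (L2_inner S h T) \<le> L2_norm S h * L2_norm S T" by (rule L2_Cauchy_Schwarz[OF h TL])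
    moreover have B0: "B \<ge> 0" unfolding B_def by (intro sum_nonneg mult_nonneg_nonneg disk_moment_nonneg) simp
    ultimately have "B \<le> L2_norm S h * L2_norm S T" by (simp add: hT)
    hence "B\<^sup>2 \<le> (L2_norm S h * L2_norm S T)\<^sup>2" using B0 by (rule power_mono)
    also have "\<dots> = (L2_norm S h)\<^sup>2 * B" by (simp only: power_mult_distrib TT)
    finally have "B\<^sup>2 \<le> (L2_norm S h)\<^sup>2 * B" .
    thus ?thesis unfolding B_def[symmetric] using B0 by (cases "B = 0") (auto simp: power2_eq_square)
  qed
  have sm: "summable (\<lambda>n. (norm (\<alpha> n))\<^sup>2 * disk_moment a b c n)"
  proof (rule bounded_imp_summable)
    show "0 \<le> (norm (\<alpha> n))\<^sup>2 * disk_moment a b c n" for n using disk_moment_nonneg by simp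
    show "(\<Sum>n\<le>N. (norm (\<alpha> n))\<^sup>2 * disk_moment a b c n) \<le> (L2_norm S h)\<^sup>2" for N
      using bessel[of "Suc N"] by (simp only: lessThan_Suc_atMost)
  qed
  define f where "f = (\<lambda>z. \<Sum>n. \<alpha> n * z ^ n)"
  have fs: "(\<lambda>n. \<alpha> n * z ^ n) sums f z" if "z \<in> ball 0 1" for z
    unfolding f_def using power_series_exists[OF sm that] by (rule summable_sums)
  have hol: "f holomorphic_on ball 0 1"
    using power_series_holomorphic[of 0 1 \<alpha> f] fs by simp
  have fm: "f \<in> borel_measurable D" by (rule holomorphic_measurable_disk[OF hol])
  have fW: "f \<in> W_space a b c" unfolding W_space_iff using hol power_series_L2_converges(1)[OF sm fs fm] by blast
  have lim: "(\<lambda>N. L2_dist S (J (coeff_poly \<alpha> N)) (J_op a b c f)) \<longlonglongrightarrow> 0"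
    by (rule J_op_lim[OF fW power_series_L2_converges(2)[OF sm fs fm]])
  have JT: "J (coeff_poly \<alpha> N) = (\<lambda>s. \<Sum>n<N. \<alpha> n * e n s)" for N
  proof
    fix s
    \<comment> \<open>The bound N also covers N = 0, where the zero polynomial has degree 0; in the
      sum below \<open>Suc N\<close> the additional coefficient is zero.\<close>
    have "degree (coeff_poly \<alpha> N) \<le> N" by (rule degree_le) (simp add: coeff_coeff_poly)
    hence "J (coeff_poly \<alpha> N) s = (\<Sum>n<Suc N. coeff (coeff_poly \<alpha> N) n * of_real (dual_hahn a b c n s))" by (intro J_poly_sum) simp
    thus "J (coeff_poly \<alpha> N) s = (\<Sum>n<N. \<alpha> n * e n s)" by (simp add: coeff_coeff_poly e_def)
  qed
  have inner_lim: "L2_inner S (J_op a b c f) (e k) = L2_inner S h (e k)" for k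
  proof -
    have "(\<lambda>N. L2_inner S (J (coeff_poly \<alpha> N)) (e k)) \<longlonglongrightarrow> L2_inner S (J_op a b c f) (e k)"
      by (rule L2_inner_tendsto[OF J_L2 eL J_op_L2[OF fW] eL lim]) (simp add: L2_dist_norm L2_norm_def)
    moreover have "(\<lambda>N. L2_inner S (J (coeff_poly \<alpha> N)) (e k)) \<longlonglongrightarrow> L2_inner S h (e k)"
      unfolding JT inner_sum he by (rule tendsto_eventually, rule eventually_sequentiallyI[of "Suc k"]) simp
    ultimately show ?thesis by (rule LIMSEQ_unique)
  qed
  have "AE s in S. J_op a b c f s - h s = 0"
  proof (rule dual_hahn_complete[OF pos])
    show "(\<lambda>s. J_op a b c f s - h s) \<in> L2_space S" by (intro L2_space_diff J_op_L2 fW h)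
    show "L2_inner S (\<lambda>s. J_op a b c f s - h s) (\<lambda>s. of_real (dual_hahn a b c n s)) = 0" for n
      using L2_inner_diff_left[OF J_op_L2[OF fW] h eL[of n]] inner_lim[of n] by (simp add: e_def)
  qed
  thus ?thesis using fW by (auto intro!: bexI[of _ f])
qed

lemma J_unitary:
  "J_well_defined a b c \<and> unitary_onto_L2 (W_space a b c) (W_inner a b c) S (J_op a b c)"
proof
  show "J_well_defined a b c" unfolding J_well_defined_def
  proof (intro conjI allI impI ballI)
    fix p s show "set_integrable lborel {0<..} (J_integrand a b c (poly p) s)" by (rule set_integrable_J_poly[OF pos])
  next
    fix f and e :: real assume f: "f \<in> W_space a b c" and e: "e > 0"
    obtain p where p: "(\<lambda>n. L2_dist D (poly (p n)) f) \<longlonglongrightarrow> 0" using W_approx[OF f] by blast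
    from order_tendstoD(2)[OF this e] obtain n where "L2_dist D (poly (p n)) f < e" by (auto simp: eventually_sequentially)
    thus "\<exists>p. W_dist a b c (poly p) f < e" by (auto simp: W_dist_poly[OF f])
  qed (rule poly_in_W J_L2 J_op_poly)+
  show "unitary_onto_L2 (W_space a b c) (W_inner a b c) S (J_op a b c)" unfolding unitary_onto_L2_def
    by (intro conjI ballI allI J_op_L2 J_op_lincomb J_op_inner J_op_surj)
qed

end

theorem theorem5p3:
  fixes a b c :: real
  assumes "0 < a" "0 < b" "0 < c"
    and "b < a" "c < a" "1 < 2 * a"
  shows "J_well_defined a b c \<and>
         unitary_onto_L2 (W_space a b c) (W_inner a b c) (spectral_measure a b c) (J_op a b c)"
proof -
  interpret disk_parameters a b c by unfold_locales (use assms in auto)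
  show ?thesis by (rule J_unitary)
qed

end
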